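(* Consider the modulo-sum relay channel described in the context, and let $R_0=\max_{p(x_1)} I(X_1;S)$ be the capacity of the relay–destination channel $p(s\mid x_1)$. Then its capacity is $$C=\max_{p(u\mid y_1):\ I(U;Y_1)\le R_0}\ \bigl(\log_2 m-H(Z\mid U)\bigr),$$ where $(Z,Y_1,U)$ has joint law $p(z)p(y_1\mid z)p(u\mid y_1)$, and the maximization may be restricted to $U$ with $|\mathcal U|\le|\mathcal Y_1|+2$.
   Context: Modulo-sum relay channel: fix an integer $m\ge2$. Source input $X_i\in\mathbb Z_m$; noise $Z_i\in\mathbb Z_m$ i.i.d. with an arbitrary distribution $p(z)$, independent of the message; the destination receives $Y_i=X_i+Z_i \pmod m$. The relay observes $Y_{1i}$ in a finite alphabet $\mathcal Y_1$, generated memorylessly from $Z_i$ via a fixed conditional law $p(y_1\mid z)$ (so $p(y_1\mid x,y,z)=p(y_1\mid z)$). The relay sends $X_{1i}$ over a separate discrete memoryless channel with finite alphabets and transition law $p(s\mid x_1)$, independent of everything else, whose output $S_i$ is seen by the destination. An $(n,2^{nR})$ code consists of a message $W$ uniform on $\{1,\dots,2^{nR}\}$, an encoder $X^n=X^n(W)$, relay functions $X_{1i}=f_i(Y_1^{i-1})$, and a decoder $\hat W=g(Y^n,S^n)$; a rate is achievable if codes exist with $\Pr(\hat W\ne W)\to0$, and the capacity is the supremum of achievable rates. Entropies are in bits. *)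

theory Defs
  imports Complex_Main "HOL-Library.FuncSet"
begin

text \<open>Z_m is represented by {0..<m} (nat); sequences of length n by extensional
functions on {0..<n}; entropies in bits with 0 log 0 = 0.\<close>

definition plogp :: "real \<Rightarrow> real" where
  "plogp x = (if x = 0 then 0 else x * log 2 x)"

definition ent :: "('a \<Rightarrow> real) \<Rightarrow> 'a set \<Rightarrow> real" where
  "ent p A = - (\<Sum>a\<in>A. plogp (p a))"

definition is_pmf_on :: "('a \<Rightarrow> real) \<Rightarrow> 'a set \<Rightarrow> bool" where
  "is_pmf_on p A \<longleftrightarrow> (\<forall>a\<in>A. 0 \<le> p a) \<and> sum p A = 1"

definition mutual_info ::
  "('a \<Rightarrow> real) \<Rightarrow> ('a \<Rightarrow> 'b \<Rightarrow> real) \<Rightarrow> 'a set \<Rightarrow> 'b set \<Rightarrow> real" where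
  "mutual_info p W A B =
     ent p A + ent (\<lambda>b. \<Sum>a\<in>A. p a * W a b) B
     - ent (\<lambda>(a,b). p a * W a b) (A \<times> B)"

definition R0 :: "('x1::finite \<Rightarrow> 's::finite \<Rightarrow> real) \<Rightarrow> real" where
  "R0 Wr = Sup {mutual_info p Wr UNIV UNIV | p. is_pmf_on p UNIV}"

text \<open>Auxiliary U with alphabet {0..<k}, test channel Q = p(u|y1).
  Law of Y1: p(y1) = sum_z p(z) p(y1|z).\<close>
definition pY1 :: "nat \<Rightarrow> (nat \<Rightarrow> real) \<Rightarrow> (nat \<Rightarrow> 'y1 \<Rightarrow> real) \<Rightarrow> 'y1 \<Rightarrow> real" where
  "pY1 m pz W1 y1 = (\<Sum>z<m. pz z * W1 z y1)"

definition I_UY1 :: "nat \<Rightarrow> (nat \<Rightarrow> real) \<Rightarrow> (nat \<Rightarrow> 'y1::finite \<Rightarrow> real)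
    \<Rightarrow> nat \<Rightarrow> ('y1 \<Rightarrow> nat \<Rightarrow> real) \<Rightarrow> real" where
  "I_UY1 m pz W1 k Q = mutual_info (pY1 m pz W1) Q UNIV {0..<k}"

definition pZU :: "(nat \<Rightarrow> real) \<Rightarrow> (nat \<Rightarrow> 'y1::finite \<Rightarrow> real)
    \<Rightarrow> ('y1 \<Rightarrow> nat \<Rightarrow> real) \<Rightarrow> nat \<times> nat \<Rightarrow> real" where
  "pZU pz W1 Q = (\<lambda>(z,u). \<Sum>y1\<in>UNIV. pz z * W1 z y1 * Q y1 u)"

definition H_Z_given_U :: "nat \<Rightarrow> (nat \<Rightarrow> real) \<Rightarrow> (nat \<Rightarrow> 'y1::finite \<Rightarrow> real)
    \<Rightarrow> nat \<Rightarrow> ('y1 \<Rightarrow> nat \<Rightarrow> real) \<Rightarrow> real" where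
  "H_Z_given_U m pz W1 k Q =
     ent (pZU pz W1 Q) ({0..<m} \<times> {0..<k})
     - ent (\<lambda>u. \<Sum>z<m. pZU pz W1 Q (z,u)) {0..<k}"

text \<open>Average error probability of a code of length n with M messages {1..M}:
  encoder enc w i \<in> Z_m, relay functions f i (depending on y1 at times < i),
  decoder g applied to (Y^n, S^n).\<close>
definition err_prob ::
  "nat \<Rightarrow> (nat \<Rightarrow> real) \<Rightarrow> (nat \<Rightarrow> 'y1::finite \<Rightarrow> real) \<Rightarrow> ('x1 \<Rightarrow> 's::finite \<Rightarrow> real)
   \<Rightarrow> nat \<Rightarrow> nat \<Rightarrow> (nat \<Rightarrow> nat \<Rightarrow> nat) \<Rightarrow> (nat \<Rightarrow> (nat \<Rightarrow> 'y1) \<Rightarrow> 'x1)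
   \<Rightarrow> ((nat \<Rightarrow> nat) \<Rightarrow> (nat \<Rightarrow> 's) \<Rightarrow> nat) \<Rightarrow> real" where
  "err_prob m pz W1 Wr n M enc f g =
    (1 / real M) * (\<Sum>w\<in>{1..M}.
       \<Sum>z\<in>PiE {0..<n} (\<lambda>_. {0..<m}).
       \<Sum>y1\<in>PiE {0..<n} (\<lambda>_. (UNIV::'y1 set)).
       \<Sum>s\<in>PiE {0..<n} (\<lambda>_. (UNIV::'s set)).
         (\<Prod>i<n. pz (z i) * W1 (z i) (y1 i) * Wr (f i y1) (s i)) *
         (if g (\<lambda>i\<in>{0..<n}. (enc w i + z i) mod m) s \<noteq> w then 1 else 0))"

definition num_msgs :: "nat \<Rightarrow> real \<Rightarrow> nat" where
  "num_msgs n R = nat \<lceil>2 powr (real n * R)\<rceil>"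

definition achievable ::
  "nat \<Rightarrow> (nat \<Rightarrow> real) \<Rightarrow> (nat \<Rightarrow> 'y1::finite \<Rightarrow> real) \<Rightarrow> ('x1 \<Rightarrow> 's::finite \<Rightarrow> real)
   \<Rightarrow> real \<Rightarrow> bool" where
  "achievable m pz W1 Wr R \<longleftrightarrow>
     (\<exists>(enc :: nat \<Rightarrow> nat \<Rightarrow> nat \<Rightarrow> nat) (f :: nat \<Rightarrow> nat \<Rightarrow> (nat \<Rightarrow> 'y1) \<Rightarrow> 'x1)
        (g :: nat \<Rightarrow> (nat \<Rightarrow> nat) \<Rightarrow> (nat \<Rightarrow> 's) \<Rightarrow> nat).
        (\<forall>n w i. 1 \<le> w \<and> w \<le> num_msgs n R \<and> i < n \<longrightarrow> enc n w i < m) \<and>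
        (\<forall>n i y y'. (\<forall>j<i. y j = y' j) \<longrightarrow> f n i y = f n i y') \<and>
        (\<lambda>n. err_prob m pz W1 Wr n (num_msgs n R) (enc n) (f n) (g n)) \<longlonglongrightarrow> 0)"

definition capacity ::
  "nat \<Rightarrow> (nat \<Rightarrow> real) \<Rightarrow> (nat \<Rightarrow> 'y1::finite \<Rightarrow> real) \<Rightarrow> ('x1::finite \<Rightarrow> 's::finite \<Rightarrow> real)
   \<Rightarrow> real" where
  "capacity m pz W1 Wr = Sup {R. achievable m pz W1 Wr R}"

end

theory Submission
  imports Defs "HOL-Analysis.Analysis" "HOL-Real_Asymp.Real_Asymp"
begin

text \<open>
  \<^bold>\<open>Converse.\<close> Fano's inequality bounds the rate by \<open>log m - H(Z\<^sup>n | S\<^sup>n) / n\<close>, and \<open>I(Y\<^sub>1\<^sup>n; S\<^sup>n) \<le> n R\<^sub>0\<close>. Peeling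
  off coordinates one at a time shows that \<open>(p(y\<^sub>1), H(Y\<^sub>1\<^sup>n | S\<^sup>n) / n)\<close> together with some number below
  \<open>H(Z\<^sup>n | S\<^sup>n) / n\<close> is a point of the convex hull of the compact set of all \<open>(v, H(v), H(K v))\<close>, where \<open>v\<close> is a
  law on the relay alphabet and \<open>K\<close> is the backward channel \<open>p(z | y\<^sub>1)\<close>. Compactness gives an optimal point,
  and Caratheodory's theorem in a hyperplane represents it by an auxiliary variable with \<open>|Y\<^sub>1| + 2\<close> values.

  \<^bold>\<open>Achievability.\<close> A relaying scheme matters only through the law of \<open>(Z\<^sup>l, S\<^sup>l)\<close> it induces on a block: blocks
  are letters of a memoryless channel with additive noise, whose mutual information under uniform inputs is
  \<open>l log m - H(Z\<^sup>l | S\<^sup>l)\<close>. If \<open>I(U; Y\<^sub>1) < R\<^sub>0\<close>, the relay quantises a block of \<open>Y\<^sub>1\<close> under logarithmic loss for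
  \<open>Z\<close> and sends the index in the next block; the receiver then predicts \<open>Z\<^sup>l\<close> with loss about \<open>l H(Z | U)\<close>, which
  bounds \<open>H(Z\<^sup>l | S\<^sup>l)\<close>. The boundary case \<open>I(U; Y\<^sub>1) = R\<^sub>0\<close> follows by erasing \<open>U\<close> with small probability, or by
  data processing if \<open>R\<^sub>0 = 0\<close>.
\<close>

section \<open>Finite probability distributions\<close>

lemma is_pmf_on_nonneg: "is_pmf_on p A \<Longrightarrow> a \<in> A \<Longrightarrow> 0 \<le> p a"
  by (simp add: is_pmf_on_def)

lemma is_pmf_on_sum: "is_pmf_on p A \<Longrightarrow> sum p A = 1"
  by (simp add: is_pmf_on_def)

lemma is_pmf_on_finite: "is_pmf_on p A \<Longrightarrow> finite A"
  by (metis is_pmf_on_sum sum.infinite zero_neq_one)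

lemma is_pmf_on_nonempty: "is_pmf_on p A \<Longrightarrow> A \<noteq> {}"
  using is_pmf_on_sum by force

lemma is_pmf_on_uniform: "finite A \<Longrightarrow> A \<noteq> {} \<Longrightarrow> is_pmf_on (\<lambda>_. 1 / real (card A)) A"
  by (simp add: is_pmf_on_def)

lemma exists_ge_average:
  assumes p: "is_pmf_on p A" and r: "r \<le> (\<Sum>a\<in>A. p a * F a)"
  shows "\<exists>a\<in>A. r \<le> (F a :: real)"
proof -
  have A: "finite A" "A \<noteq> {}" using p by (auto dest: is_pmf_on_finite is_pmf_on_nonempty)
  then have "Max (F ` A) \<in> F ` A" by simp
  then obtain a where a: "Max (F ` A) = F a" "a \<in> A" by (rule imageE)
  have "(\<Sum>a\<in>A. p a * F a) \<le> (\<Sum>b\<in>A. p b * F a)"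
    using A by (intro sum_mono mult_left_mono is_pmf_on_nonneg[OF p]) (auto simp flip: a(1))
  also have "\<dots> = F a" by (simp add: is_pmf_on_sum[OF p] flip: sum_distrib_right)
  finally show ?thesis using r a(2) by (blast intro: order_trans)
qed

lemma exists_le_average:
  assumes "is_pmf_on p A" "(\<Sum>a\<in>A. p a * F a) \<le> r"
  shows "\<exists>a\<in>A. F a \<le> (r :: real)"
  using exists_ge_average[of p A "- r" "\<lambda>a. - F a"] assms by (simp add: sum_negf)

definition prob_on :: "('a \<Rightarrow> real) \<Rightarrow> 'a set \<Rightarrow> ('a \<Rightarrow> bool) \<Rightarrow> real" where
  "prob_on p A P = (\<Sum>a\<in>A. p a * of_bool (P a))"

lemma prob_on_nonneg: "(\<And>a. a \<in> A \<Longrightarrow> 0 \<le> p a) \<Longrightarrow> 0 \<le> prob_on p A P"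
  unfolding prob_on_def by (intro sum_nonneg) auto

lemma prob_on_mono:
  assumes "\<And>a. a \<in> A \<Longrightarrow> 0 \<le> p a" "\<And>a. a \<in> A \<Longrightarrow> p a \<noteq> 0 \<Longrightarrow> P a \<Longrightarrow> Q a"
  shows "prob_on p A P \<le> prob_on p A Q"
  unfolding prob_on_def
proof (rule sum_mono)
  show "p a * of_bool (P a) \<le> p a * of_bool (Q a)" if "a \<in> A" for a
    using assms[OF that] by (cases "p a = 0") auto
qed

lemma prob_on_not: "is_pmf_on p A \<Longrightarrow> prob_on p A (\<lambda>a. \<not> P a) = 1 - prob_on p A P"
  by (simp add: prob_on_def of_bool_not_iff right_diff_distrib sum_subtractf is_pmf_on_sum)

lemma prob_on_disj_le:
  assumes "\<And>a. a \<in> A \<Longrightarrow> 0 \<le> p a"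
  shows "prob_on p A (\<lambda>a. P a \<or> Q a) \<le> prob_on p A P + prob_on p A Q"
  unfolding prob_on_def sum.distrib[symmetric] using assms by (intro sum_mono) auto

lemma prob_on_Bex_le:
  assumes "finite I" "\<And>a. a \<in> A \<Longrightarrow> 0 \<le> p a"
  shows "prob_on p A (\<lambda>a. \<exists>i\<in>I. P i a) \<le> (\<Sum>i\<in>I. prob_on p A (P i))"
  using assms(1)
proof induction
  case empty
  show ?case by (simp add: prob_on_def)
next
  case (insert i I)
  then show ?case using prob_on_disj_le[of A p "P i" "\<lambda>a. \<exists>i\<in>I. P i a"] assms(2) by simp
qed

subsection \<open>Channels and images of distributions\<close>

definition is_channel :: "('a \<Rightarrow> 'b \<Rightarrow> real) \<Rightarrow> 'a set \<Rightarrow> 'b set \<Rightarrow> bool" where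
  "is_channel W A B \<longleftrightarrow> (\<forall>a\<in>A. is_pmf_on (W a) B)"

definition joint_law :: "('a \<Rightarrow> real) \<Rightarrow> ('a \<Rightarrow> 'b \<Rightarrow> real) \<Rightarrow> 'a \<times> 'b \<Rightarrow> real" where
  "joint_law p W = (\<lambda>(a, b). p a * W a b)"

definition output_law :: "('a \<Rightarrow> real) \<Rightarrow> ('a \<Rightarrow> 'b \<Rightarrow> real) \<Rightarrow> 'a set \<Rightarrow> 'b \<Rightarrow> real" where
  "output_law p W A b = (\<Sum>a\<in>A. p a * W a b)"

definition pushforward :: "('a \<Rightarrow> 'b) \<Rightarrow> ('a \<Rightarrow> real) \<Rightarrow> 'a set \<Rightarrow> 'b \<Rightarrow> real" where
  "pushforward f p A b = prob_on p A (\<lambda>a. f a = b)"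

lemma is_channelI: "(\<And>a. a \<in> A \<Longrightarrow> is_pmf_on (W a) B) \<Longrightarrow> is_channel W A B"
  by (simp add: is_channel_def)

lemma is_channel_pmf: "is_channel W A B \<Longrightarrow> a \<in> A \<Longrightarrow> is_pmf_on (W a) B"
  by (simp add: is_channel_def)

lemma is_channel_nonneg: "is_channel W A B \<Longrightarrow> a \<in> A \<Longrightarrow> b \<in> B \<Longrightarrow> 0 \<le> W a b"
  by (simp add: is_channel_def is_pmf_on_def)

lemma is_channel_sum: "is_channel W A B \<Longrightarrow> a \<in> A \<Longrightarrow> sum (W a) B = 1"
  by (simp add: is_channel_def is_pmf_on_def)

lemma is_channel_finite: "is_channel W A B \<Longrightarrow> A \<noteq> {} \<Longrightarrow> finite B"
  by (auto simp: is_channel_def dest: is_pmf_on_finite)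

lemma sum_joint_law:
  "(\<Sum>ab\<in>A \<times> B. joint_law p W ab * F ab) = (\<Sum>a\<in>A. p a * (\<Sum>b\<in>B. W a b * F (a, b)))"
  by (simp add: joint_law_def sum.cartesian_product' sum_distrib_left mult.assoc)

lemma is_pmf_on_joint_law:
  assumes "is_pmf_on p A" "is_channel W A B"
  shows "is_pmf_on (joint_law p W) (A \<times> B)"
  using sum_joint_law[of p W "\<lambda>_. 1" A B] assms
  by (auto simp: is_pmf_on_def joint_law_def is_channel_def)

lemma prob_on_joint_law:
  "prob_on (joint_law p W) (A \<times> B) P = (\<Sum>a\<in>A. p a * prob_on (W a) B (\<lambda>b. P (a, b)))"
  unfolding prob_on_def by (rule sum_joint_law)

lemma sum_output_law: "(\<Sum>b\<in>B. output_law p W A b * F b) = (\<Sum>a\<in>A. p a * (\<Sum>b\<in>B. W a b * F b))"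
proof -
  have "(\<Sum>b\<in>B. output_law p W A b * F b) = (\<Sum>a\<in>A. \<Sum>b\<in>B. p a * W a b * F b)"
    unfolding output_law_def sum_distrib_right by (rule sum.swap)
  then show ?thesis by (simp add: sum_distrib_left mult.assoc)
qed

lemma prob_on_output_law: "prob_on (output_law p W A) B P = (\<Sum>a\<in>A. p a * prob_on (W a) B P)"
  unfolding prob_on_def by (rule sum_output_law)

lemma output_law_nonneg:
  "(\<And>a. a \<in> A \<Longrightarrow> 0 \<le> p a) \<Longrightarrow> (\<And>a. a \<in> A \<Longrightarrow> 0 \<le> W a b) \<Longrightarrow> 0 \<le> output_law p W A b"
  unfolding output_law_def by (intro sum_nonneg mult_nonneg_nonneg)

lemma output_law_scale: "output_law (\<lambda>a. c * p a) W A = (\<lambda>b. c * output_law p W A b)"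
  by (simp add: fun_eq_iff output_law_def sum_distrib_left mult.assoc)

lemma mass_output_law:
  "is_channel W A B \<Longrightarrow> sum (output_law p W A) B = sum p A"
  using sum_output_law[of p W A "\<lambda>_. 1" B] by (simp add: is_channel_sum)

lemma is_pmf_on_output_law:
  assumes "is_pmf_on p A" "is_channel W A B"
  shows "is_pmf_on (output_law p W A) B"
  unfolding is_pmf_on_def
proof (intro conjI ballI)
  show "0 \<le> output_law p W A b" if "b \<in> B" for b
    using assms that by (intro output_law_nonneg) (auto dest: is_pmf_on_nonneg is_channel_nonneg)
  show "sum (output_law p W A) B = 1" using assms by (simp add: mass_output_law is_pmf_on_sum)
qed

lemma sum_pushforward:
  assumes B: "finite B" "f ` A \<subseteq> B"
  shows "(\<Sum>b\<in>B. pushforward f p A b * F b) = (\<Sum>a\<in>A. p a * F (f a))"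
proof -
  have "(\<Sum>b\<in>B. pushforward f p A b * F b) = (\<Sum>a\<in>A. p a * (\<Sum>b\<in>B. of_bool (f a = b) * F b))"
    unfolding pushforward_def prob_on_def by (rule sum_output_law[unfolded output_law_def])
  also have "\<dots> = (\<Sum>a\<in>A. p a * F (f a))"
    using B by (intro sum.cong refl) (auto simp: of_bool_def if_distrib[of "\<lambda>x. x * _"] cong: if_cong)
  finally show ?thesis .
qed

lemma prob_on_pushforward:
  "finite B \<Longrightarrow> f ` A \<subseteq> B \<Longrightarrow> prob_on (pushforward f p A) B P = prob_on p A (\<lambda>a. P (f a))"
  unfolding prob_on_def by (rule sum_pushforward)

lemma pushforward_nonneg: "(\<And>a. a \<in> A \<Longrightarrow> 0 \<le> p a) \<Longrightarrow> 0 \<le> pushforward f p A b"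
  unfolding pushforward_def by (rule prob_on_nonneg)

lemma is_pmf_on_pushforward:
  assumes "is_pmf_on p A" "finite B" "f ` A \<subseteq> B"
  shows "is_pmf_on (pushforward f p A) B"
  using sum_pushforward[OF assms(2,3), of p "\<lambda>_. 1"] assms(1)
  by (auto simp: is_pmf_on_def intro: pushforward_nonneg)

lemma pushforward_inj_on:
  assumes "finite A" "inj_on f A" "a \<in> A"
  shows "pushforward f p A (f a) = p a"
proof -
  have "pushforward f p A (f a) = (\<Sum>b\<in>A. if b = a then p b else 0)"
    unfolding pushforward_def prob_on_def using assms
    by (intro sum.cong refl) (auto dest: inj_onD)
  then show ?thesis using assms by simp
qed

subsection \<open>Product distributions\<close>

definition prod_law :: "'i set \<Rightarrow> ('i \<Rightarrow> 'a \<Rightarrow> real) \<Rightarrow> ('i \<Rightarrow> 'a) \<Rightarrow> real" where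
  "prod_law I g x = (\<Prod>i\<in>I. g i (x i))"

abbreviation iid :: "'i set \<Rightarrow> ('a \<Rightarrow> real) \<Rightarrow> ('i \<Rightarrow> 'a) \<Rightarrow> real" where
  "iid I p \<equiv> prod_law I (\<lambda>_. p)"

abbreviation memoryless :: "'i set \<Rightarrow> ('a \<Rightarrow> 'b \<Rightarrow> real) \<Rightarrow> ('i \<Rightarrow> 'a) \<Rightarrow> ('i \<Rightarrow> 'b) \<Rightarrow> real" where
  "memoryless I W x \<equiv> prod_law I (\<lambda>i. W (x i))"

abbreviation seqs :: "nat \<Rightarrow> 'a set \<Rightarrow> (nat \<Rightarrow> 'a) set" where
  "seqs n A \<equiv> {0..<n} \<rightarrow>\<^sub>E A"

abbreviation iid_joint :: "nat \<Rightarrow> ('a \<Rightarrow> real) \<Rightarrow> ('a \<Rightarrow> 'b \<Rightarrow> real) \<Rightarrow> (nat \<Rightarrow> 'a) \<times> (nat \<Rightarrow> 'b) \<Rightarrow> real" where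
  "iid_joint n p W \<equiv> joint_law (iid {0..<n} p) (memoryless {0..<n} W)"

lemma prod_law_nonneg: "(\<And>i. i \<in> I \<Longrightarrow> 0 \<le> g i (x i)) \<Longrightarrow> 0 \<le> prod_law I g x"
  unfolding prod_law_def by (rule prod_nonneg)

lemma prod_law_pos: "(\<And>i. i \<in> I \<Longrightarrow> 0 < g i (x i)) \<Longrightarrow> 0 < prod_law I g x"
  unfolding prod_law_def by (rule prod_pos)

lemma prod_law_mult: "prod_law I g x * prod_law I h y = (\<Prod>i\<in>I. g i (x i) * h i (y i))"
  by (simp add: prod_law_def prod.distrib)

lemma sum_prod_law:
  "finite I \<Longrightarrow> finite A \<Longrightarrow> sum (prod_law I g) (I \<rightarrow>\<^sub>E A) = (\<Prod>i\<in>I. sum (g i) A)"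
  unfolding prod_law_def by (rule prod_sum_PiE[symmetric]) auto

lemma is_pmf_on_prod_law:
  assumes I: "finite I" and A: "finite A" and g: "\<And>i. i \<in> I \<Longrightarrow> is_pmf_on (g i) A"
  shows "is_pmf_on (prod_law I g) (I \<rightarrow>\<^sub>E A)"
  unfolding is_pmf_on_def sum_prod_law[OF I A]
  using g by (auto intro!: prod_law_nonneg intro: is_pmf_on_nonneg simp: is_pmf_on_sum PiE_iff)

lemma is_channel_memoryless:
  assumes "finite I" "finite B" "is_channel W A B"
  shows "is_channel (memoryless I W) (I \<rightarrow>\<^sub>E A) (I \<rightarrow>\<^sub>E B)"
  using assms by (auto intro!: is_channelI is_pmf_on_prod_law is_channel_pmf[of W A])

lemma is_pmf_on_iid_joint:
  assumes p: "is_pmf_on p A" and W: "is_channel W A B"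
  shows "is_pmf_on (iid_joint n p W) (seqs n A \<times> seqs n B)"
  using is_pmf_on_finite[OF p] is_channel_finite[OF W is_pmf_on_nonempty[OF p]] p W
  by (intro is_pmf_on_joint_law is_pmf_on_prod_law is_channel_memoryless) auto

lemma log_prod_law:
  assumes "finite I" "\<And>i. i \<in> I \<Longrightarrow> 0 \<le> g i (x i)" "prod_law I g x \<noteq> 0"
  shows "log 2 (prod_law I g x) = (\<Sum>i\<in>I. log 2 (g i (x i)))"
proof -
  have "\<forall>i\<in>I. g i (x i) \<noteq> 0" using assms by (auto simp: prod_law_def)
  then show ?thesis using assms(1,2)
    by (simp add: prod_law_def log_def ln_prod sum_divide_distrib less_le)
qed

lemma prod_law_factor_pos:
  assumes "finite I" "i \<in> I" "0 \<le> g i (x i)" "prod_law I g x \<noteq> 0"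
  shows "0 < g i (x i)"
  using assms by (auto simp: prod_law_def less_le)

lemma sum_prod_law_coordinate:
  assumes I: "finite I" and A: "finite A" and g: "\<And>i. i \<in> I \<Longrightarrow> sum (g i) A = 1" and j: "j \<in> I"
  shows "(\<Sum>x\<in>I \<rightarrow>\<^sub>E A. prod_law I g x * h (x j)) = (\<Sum>a\<in>A. g j a * h a)"
proof -
  define g' where "g' i a = g i a * (if i = j then h a else 1)" for i a
  have "prod_law I g x * h (x j) = prod_law I g' x" for x
    using I j by (simp add: prod_law_def g'_def prod.distrib prod.delta)
  then have "(\<Sum>x\<in>I \<rightarrow>\<^sub>E A. prod_law I g x * h (x j)) = (\<Prod>i\<in>I. sum (g' i) A)"
    using I A by (simp add: sum_prod_law)
  also have "\<dots> = (\<Prod>i\<in>I. if i = j then (\<Sum>a\<in>A. g j a * h a) else 1)"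
    by (intro prod.cong refl) (auto simp: g'_def g)
  also have "\<dots> = (\<Sum>a\<in>A. g j a * h a)" using I j by (simp add: prod.delta)
  finally show ?thesis .
qed

lemma sum_prod_law_additive:
  assumes "finite I" "finite A" "\<And>i. i \<in> I \<Longrightarrow> sum (g i) A = 1"
  shows "(\<Sum>x\<in>I \<rightarrow>\<^sub>E A. prod_law I g x * (\<Sum>j\<in>I. h j (x j))) = (\<Sum>j\<in>I. \<Sum>a\<in>A. g j a * h j a)"
proof -
  have "(\<Sum>x\<in>I \<rightarrow>\<^sub>E A. prod_law I g x * (\<Sum>j\<in>I. h j (x j)))
      = (\<Sum>j\<in>I. \<Sum>x\<in>I \<rightarrow>\<^sub>E A. prod_law I g x * h j (x j))"
    unfolding sum_distrib_left by (rule sum.swap)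
  then show ?thesis using assms by (simp add: sum_prod_law_coordinate)
qed

lemma pushforward_prod_law_coordinate:
  assumes I: "finite I" and g: "\<And>i. i \<in> I \<Longrightarrow> is_pmf_on (g i) A" and j: "j \<in> I" and a: "a \<in> A"
  shows "pushforward (\<lambda>x. x j) (prod_law I g) (I \<rightarrow>\<^sub>E A) a = g j a"
proof -
  have A: "finite A" using g[OF j] by (rule is_pmf_on_finite)
  then show ?thesis
    using sum_prod_law_coordinate[OF I A is_pmf_on_sum[OF g] j, where h = "\<lambda>b. of_bool (b = a)"] a
    by (simp add: pushforward_def prob_on_def of_bool_def if_distrib cong: if_cong)
qed

lemma output_law_iid_memoryless:
  "finite I \<Longrightarrow> finite A \<Longrightarrow>
    output_law (iid I p) (memoryless I W) (I \<rightarrow>\<^sub>E A) = iid I (output_law p W A)"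
  unfolding output_law_def prod_law_mult fun_eq_iff
  by (simp add: prod_law_def prod_sum_PiE)

lemma sum_PiE_insert:
  assumes "i \<notin> I"
  shows "(\<Sum>x\<in>insert i I \<rightarrow>\<^sub>E A. F x) = (\<Sum>a\<in>A. \<Sum>x\<in>I \<rightarrow>\<^sub>E A. F (x(i := a)))"
proof -
  have "inj_on (\<lambda>(a, x). x(i := a)) (A \<times> (I \<rightarrow>\<^sub>E A))"
    using inj_combinator[OF assms, of "\<lambda>_. A"] by simp
  then show ?thesis
    by (simp add: PiE_insert_eq sum.reindex split_def sum.cartesian_product' comp_def)
qed

lemma memoryless_insert:
  assumes "finite I" "i \<notin> I"
  shows "memoryless (insert i I) W (x(i := a)) (y(i := b)) = W a b * memoryless I W x y"
proof -
  have "memoryless I W (x(i := a)) (y(i := b)) = memoryless I W x y"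
    unfolding prod_law_def using assms(2) by (intro prod.cong refl) auto
  then show ?thesis using assms by (simp add: prod_law_def)
qed

section \<open>Entropy\<close>

lemma plogp_eq: "plogp x = x * log 2 x"
  by (simp add: plogp_def)

lemma plogp_mult: "0 \<le> x \<Longrightarrow> 0 \<le> y \<Longrightarrow> plogp (x * y) = x * plogp y + y * plogp x"
  by (cases "x = 0"; cases "y = 0") (auto simp: plogp_eq log_mult algebra_simps)

lemma continuous_on_plogp: "continuous_on {0..} plogp"
  unfolding continuous_on_def
proof
  fix x :: real assume x: "x \<in> {0..}"
  have "((\<lambda>x. x * log 2 x) \<longlongrightarrow> x * log 2 x) (at x within {0..})"
  proof (cases "x = 0")
    case True
    have "((\<lambda>x::real. x * log 2 x) \<longlongrightarrow> 0) (at_right 0)" by real_asymp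
    moreover have "at 0 within {0..} = at_right (0::real)"
      by (auto simp: at_within_def intro!: arg_cong2[where f = inf])
    ultimately show ?thesis using True by simp
  next
    case False
    then show ?thesis using x by (auto intro!: tendsto_eq_intros)
  qed
  then show "(plogp \<longlongrightarrow> plogp x) (at x within {0..})"
    by (simp add: plogp_eq[abs_def])
qed

text \<open>The degree-one homogeneous extension of entropy to unnormalised weights. A conditional entropy
  \<open>H(A | B)\<close> is the sum over \<open>b\<close> of \<open>hent (\<lambda>a. p (a, b))\<close> for the joint law \<open>p\<close>, so no conditional
  distributions are needed.\<close>
definition hent :: "('a \<Rightarrow> real) \<Rightarrow> 'a set \<Rightarrow> real" where
  "hent p A = plogp (sum p A) - (\<Sum>a\<in>A. plogp (p a))"

lemma hent_pmf: "is_pmf_on p A \<Longrightarrow> hent p A = ent p A"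
  by (simp add: hent_def ent_def is_pmf_on_sum plogp_eq)

lemma hent_cong: "(\<And>a. a \<in> A \<Longrightarrow> p a = q a) \<Longrightarrow> hent p A = hent q A"
  by (simp add: hent_def)

lemma hent_zero [simp]: "hent (\<lambda>_. 0) A = 0"
  by (simp add: hent_def plogp_eq)

lemma hent_reindex: "inj_on f A \<Longrightarrow> hent p (f ` A) = hent (\<lambda>a. p (f a)) A"
  by (simp add: hent_def sum.reindex comp_def)

lemma hent_scale:
  assumes c: "0 \<le> c" and p: "\<And>a. a \<in> A \<Longrightarrow> 0 \<le> p a"
  shows "hent (\<lambda>a. c * p a) A = c * hent p A"
proof -
  have "plogp (\<Sum>a\<in>A. c * p a) = c * plogp (sum p A) + sum p A * plogp c"
    unfolding sum_distrib_left[symmetric] using c p by (intro plogp_mult) (auto intro: sum_nonneg)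
  moreover have "(\<Sum>a\<in>A. plogp (c * p a)) = c * (\<Sum>a\<in>A. plogp (p a)) + sum p A * plogp c"
    using c p by (simp add: plogp_mult sum.distrib flip: sum_distrib_left sum_distrib_right)
  ultimately show ?thesis by (simp add: hent_def right_diff_distrib)
qed

lemma hent_const:
  assumes "finite A" "0 \<le> c"
  shows "hent (\<lambda>_. c) A = real (card A) * c * log 2 (real (card A))"
  using assms plogp_mult[of "real (card A)" c] by (simp add: hent_def plogp_eq)

lemma hent_normalized:
  assumes "finite A" "\<And>a. a \<in> A \<Longrightarrow> 0 \<le> p a"
  shows "(\<Sum>a\<in>A. p a * - log 2 (p a / sum p A)) = hent p A"
proof -
  have "p a * - log 2 (p a / sum p A) = p a * log 2 (sum p A) - plogp (p a)" if a: "a \<in> A" for a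
  proof (cases "p a = 0")
    case False
    then have "0 < p a" using assms(2)[OF a] by simp
    moreover from this have "0 < sum p A" using assms a by (intro sum_pos2) auto
    ultimately show ?thesis by (simp add: log_divide plogp_eq algebra_simps)
  qed (simp add: plogp_eq)
  then show ?thesis
    by (simp add: hent_def plogp_eq sum_subtractf flip: sum_distrib_right)
qed

lemma hent_nonneg:
  assumes "finite A" "\<And>a. a \<in> A \<Longrightarrow> 0 \<le> p a"
  shows "0 \<le> hent p A"
proof -
  have "0 \<le> (\<Sum>a\<in>A. p a * - log 2 (p a / sum p A))"
  proof (rule sum_nonneg)
    fix a assume a: "a \<in> A"
    show "0 \<le> p a * - log 2 (p a / sum p A)"
    proof (cases "p a = 0")
      case False
      then have "0 < p a" "p a \<le> sum p A"
        using assms a member_le_sum[of a A p] by (auto simp: less_le)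
      then have "log 2 (p a / sum p A) \<le> 0" by simp
      then show ?thesis using \<open>0 < p a\<close> by (simp add: mult_nonneg_nonpos)
    qed simp
  qed
  then show ?thesis using assms by (simp only: hent_normalized)
qed

subsection \<open>Gibbs' inequality\<close>

lemma gibbs_inequality:
  assumes A: "finite A" and p: "\<And>a. a \<in> A \<Longrightarrow> 0 \<le> p a" and q: "\<And>a. a \<in> A \<Longrightarrow> 0 \<le> q a"
    and pq: "\<And>a. a \<in> A \<Longrightarrow> 0 < p a \<Longrightarrow> 0 < q a" and mass: "sum q A \<le> 1"
  shows "hent p A \<le> (\<Sum>a\<in>A. p a * - log 2 (q a))"
proof -
  define T where "T = sum p A"
  have T: "0 \<le> T" unfolding T_def by (intro sum_nonneg p)
  have pointwise: "p a * - log 2 (p a / T) - p a * - log 2 (q a) \<le> (q a * T - p a) / ln 2"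
    if a: "a \<in> A" for a
  proof (cases "p a = 0")
    case True
    then show ?thesis using q[OF a] T by simp
  next
    case False
    then have "0 < p a" using p[OF a] by simp
    then have pos: "0 < p a" "0 < q a" "0 < T"
      using pq[OF a] sum_pos2[of A a p] A a p by (auto simp: T_def)
    have "ln (q a * T / p a) \<le> q a * T / p a - 1"
      using pos by (intro ln_le_minus_one) simp
    then have "p a * ln (q a * T / p a) \<le> q a * T - p a"
      using pos by (simp add: field_simps)
    then have "p a * ln (q a * T / p a) / ln 2 \<le> (q a * T - p a) / ln 2"
      by (intro divide_right_mono) auto
    moreover have "p a * - log 2 (p a / T) - p a * - log 2 (q a) = p a * ln (q a * T / p a) / ln 2"
      using pos by (simp add: log_def ln_div ln_mult field_simps)
    ultimately show ?thesis by simp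
  qed
  have "hent p A - (\<Sum>a\<in>A. p a * - log 2 (q a))
      = (\<Sum>a\<in>A. p a * - log 2 (p a / T) - p a * - log 2 (q a))"
    unfolding sum_subtractf T_def using A p by (simp only: hent_normalized)
  also have "\<dots> \<le> (\<Sum>a\<in>A. (q a * T - p a) / ln 2)" by (rule sum_mono) (rule pointwise)
  also have "\<dots> = (sum q A - 1) * T / ln 2"
    by (simp add: sum_subtractf T_def algebra_simps flip: sum_divide_distrib sum_distrib_right)
  also have "\<dots> \<le> 0" using mass T by (simp add: divide_nonpos_pos mult_nonpos_nonneg)
  finally show ?thesis by simp
qed

lemma hent_superadditive:
  assumes J: "finite J" and A: "finite A" and p: "\<And>j a. j \<in> J \<Longrightarrow> a \<in> A \<Longrightarrow> 0 \<le> p j a"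
  shows "(\<Sum>j\<in>J. hent (p j) A) \<le> hent (\<lambda>a. \<Sum>j\<in>J. p j a) A"
proof -
  define P where "P a = (\<Sum>j\<in>J. p j a)" for a
  have P: "0 \<le> P a" if "a \<in> A" for a unfolding P_def using p that by (intro sum_nonneg)
  have "hent (p j) A \<le> (\<Sum>a\<in>A. p j a * - log 2 (P a / sum P A))" if j: "j \<in> J" for j
  proof (rule gibbs_inequality)
    fix a assume a: "a \<in> A" and "0 < p j a"
    then have "0 < P a" unfolding P_def using J p j by (intro sum_pos2) auto
    moreover from this have "0 < sum P A" using A P a by (intro sum_pos2) auto
    ultimately show "0 < P a / sum P A" by simp
  qed (use A p j P in \<open>auto intro!: divide_nonneg_nonneg sum_nonneg simp flip: sum_divide_distrib\<close>)
  then have "(\<Sum>j\<in>J. hent (p j) A) \<le> (\<Sum>j\<in>J. \<Sum>a\<in>A. p j a * - log 2 (P a / sum P A))"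
    by (rule sum_mono)
  also have "\<dots> = (\<Sum>a\<in>A. P a * - log 2 (P a / sum P A))"
    unfolding P_def sum_distrib_right by (rule sum.swap)
  also have "\<dots> = hent P A" by (rule hent_normalized) (use A P in auto)
  finally show ?thesis by (simp add: P_def[abs_def])
qed

lemma hent_le_log_card:
  assumes A: "finite A" and p: "\<And>a. a \<in> A \<Longrightarrow> 0 \<le> p a"
  shows "hent p A \<le> sum p A * log 2 (real (card A))"
proof (cases "A = {}")
  case False
  then have "0 < card A" using A by (simp add: card_gt_0_iff)
  then have "hent p A \<le> (\<Sum>a\<in>A. p a * - log 2 (1 / real (card A)))"
    using A p by (intro gibbs_inequality) auto
  then show ?thesis using \<open>0 < card A\<close> by (simp add: log_divide flip: sum_distrib_right)
qed (simp add: hent_def plogp_eq)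

text \<open>The comparison distribution puts half of its mass on the guess \<open>g\<close> and spreads the other half
  evenly.\<close>
lemma fano_inequality:
  assumes A: "finite A" and p: "\<And>a. a \<in> A \<Longrightarrow> 0 \<le> p a"
  shows "hent p A \<le> sum p A + prob_on p A (\<lambda>a. g \<noteq> a) * log 2 (real (card A))"
proof (cases "A = {}")
  case False
  define N where "N = real (card A)"
  have N: "1 \<le> N" using A False by (simp add: N_def card_gt_0_iff Suc_leI)
  define q where "q a = 1 / (2 * N) + of_bool (g = a) / 2" for a
  have q: "0 < q a" for a unfolding q_def using N by (intro add_pos_nonneg) auto
  have "(\<Sum>a\<in>A. of_bool (g = a)) \<le> (1 :: real)"
    using A by (simp add: of_bool_def)
  then have "sum q A \<le> 1"
    using N by (simp add: q_def sum.distrib N_def flip: sum_divide_distrib)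
  then have "hent p A \<le> (\<Sum>a\<in>A. p a * - log 2 (q a))"
    using A p q by (intro gibbs_inequality) (auto simp: less_imp_le)
  also have "\<dots> \<le> (\<Sum>a\<in>A. p a * (1 + of_bool (g \<noteq> a) * log 2 N))"
  proof (intro sum_mono mult_left_mono p)
    fix a
    show "- log 2 (q a) \<le> 1 + of_bool (g \<noteq> a) * log 2 N"
    proof (cases "g = a")
      case True
      have "log 2 (1 / 2) \<le> log 2 (q a)" using True q[of a] N by (subst log_le_cancel_iff) (auto simp: q_def)
      then show ?thesis using True by (simp add: log_divide)
    next
      case False
      then show ?thesis using N by (simp add: q_def log_divide log_mult)
    qed
  qed
  also have "\<dots> = sum p A + prob_on p A (\<lambda>a. g \<noteq> a) * log 2 N"
    by (simp add: prob_on_def distrib_left sum.distrib sum_distrib_right mult.assoc)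
  finally show ?thesis by (simp add: N_def)
qed (simp add: hent_def plogp_eq prob_on_def)

text \<open>Mixing a little of the uniform distribution into \<open>v\<close> makes all log-losses finite at small cost.\<close>
lemma exists_positive_near_optimal_code:
  assumes A: "finite A" "A \<noteq> {}" and v: "\<And>a. a \<in> A \<Longrightarrow> 0 \<le> v a" and \<epsilon>: "0 < \<epsilon>"
  shows "\<exists>\<rho>. is_pmf_on \<rho> A \<and> (\<forall>a\<in>A. 0 < \<rho> a) \<and> (\<Sum>a\<in>A. v a * - log 2 (\<rho> a)) \<le> hent v A + \<epsilon> * sum v A"
proof (cases "sum v A = 0")
  case True
  then have "\<forall>a\<in>A. v a = 0" using A v by (simp add: sum_nonneg_eq_0_iff)
  then have "(\<Sum>a\<in>A. v a * - log 2 (1 / real (card A))) \<le> hent v A + \<epsilon> * sum v A"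
    using hent_cong[of A v "\<lambda>_. 0"] by simp
  then show ?thesis
    using A is_pmf_on_uniform[OF A] by (intro exI[of _ "\<lambda>_. 1 / real (card A)"]) (auto simp: card_gt_0_iff)
next
  case False
  define T where "T = sum v A"
  have T: "0 < T" using False A v by (simp add: T_def less_le sum_nonneg)
  define \<rho> where "\<rho> a = 2 powr (- \<epsilon>) * (v a / T) + (1 - 2 powr (- \<epsilon>)) / real (card A)" for a
  have N: "0 < real (card A)" using A by (simp add: card_gt_0_iff)
  have \<kappa>: "2 powr (- \<epsilon>) < (1 :: real)" using \<epsilon> powr_less_cancel_iff[of 2 "- \<epsilon>" 0] by simp
  have \<rho>: "0 < \<rho> a" "2 powr (- \<epsilon>) * (v a / T) \<le> \<rho> a" if "a \<in> A" for a
    using v[OF that] T N \<kappa> by (auto simp: \<rho>_def intro!: add_nonneg_pos)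
  have "sum \<rho> A = 2 powr (- \<epsilon>) * (sum v A / T) + (1 - 2 powr (- \<epsilon>))"
    using N by (simp add: \<rho>_def sum.distrib flip: sum_distrib_left sum_divide_distrib)
  then have "is_pmf_on \<rho> A" using \<rho>(1) T by (auto simp: is_pmf_on_def T_def less_imp_le)
  moreover have "v a * - log 2 (\<rho> a) \<le> v a * - log 2 (v a / T) + \<epsilon> * v a" if a: "a \<in> A" for a
  proof (cases "v a = 0")
    case False
    then have va: "0 < v a" using v[OF a] by simp
    have "log 2 (2 powr (- \<epsilon>) * (v a / T)) \<le> log 2 (\<rho> a)"
      using va T \<rho>[OF a] by (subst log_le_cancel_iff) auto
    then have "- log 2 (\<rho> a) \<le> - log 2 (v a / T) + \<epsilon>"
      using va T by (subst (asm) log_mult) auto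
    from mult_left_mono[OF this, of "v a"] va show ?thesis by (simp add: algebra_simps)
  qed simp
  then have "(\<Sum>a\<in>A. v a * - log 2 (\<rho> a)) \<le> (\<Sum>a\<in>A. v a * - log 2 (v a / T) + \<epsilon> * v a)"
    by (rule sum_mono)
  then have "(\<Sum>a\<in>A. v a * - log 2 (\<rho> a)) \<le> hent v A + \<epsilon> * sum v A"
    unfolding sum.distrib sum_distrib_left[symmetric] T_def using A v by (simp only: hent_normalized)
  ultimately show ?thesis using \<rho>(1) by blast
qed

subsection \<open>Chain rules\<close>

lemma hent_chain:
  assumes "finite A" "finite B"
  shows "hent p (A \<times> B) = hent (\<lambda>a. \<Sum>b\<in>B. p (a, b)) A + (\<Sum>a\<in>A. hent (\<lambda>b. p (a, b)) B)"
  using assms by (simp add: hent_def sum_subtractf sum.cartesian_product')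

lemma hent_chain_swap:
  assumes "finite A" "finite B"
  shows "hent p (A \<times> B) = hent (\<lambda>b. \<Sum>a\<in>A. p (a, b)) B + (\<Sum>b\<in>B. hent (\<lambda>a. p (a, b)) A)"
proof -
  have "hent p (A \<times> B) = hent (\<lambda>ba. p (prod.swap ba)) (B \<times> A)"
    using hent_reindex[of prod.swap "B \<times> A" p] unfolding product_swap by simp
  then show ?thesis using hent_chain[OF assms(2,1), of "\<lambda>ba. p (prod.swap ba)"] by simp
qed

lemma hent_joint_law:
  assumes A: "finite A" and B: "finite B" and p: "\<And>a. a \<in> A \<Longrightarrow> 0 \<le> p a" and W: "is_channel W A B"
  shows "hent (joint_law p W) (A \<times> B) = hent p A + (\<Sum>a\<in>A. p a * ent (W a) B)"
proof -
  have "hent (\<lambda>b. p a * W a b) B = p a * ent (W a) B" if "a \<in> A" for a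
    using hent_scale[of "p a" B "W a"] p W that by (simp add: is_channel_nonneg is_channel_pmf hent_pmf)
  moreover have "hent (\<lambda>a. \<Sum>b\<in>B. p a * W a b) A = hent p A"
    using W by (intro hent_cong) (simp add: is_channel_sum flip: sum_distrib_left)
  ultimately show ?thesis using A B by (simp add: hent_chain joint_law_def)
qed

lemma hent_PiE_insert:
  assumes "i \<notin> I" "finite I" "finite A"
  shows "hent p (insert i I \<rightarrow>\<^sub>E A)
    = hent (\<lambda>a. \<Sum>x\<in>I \<rightarrow>\<^sub>E A. p (x(i := a))) A + (\<Sum>a\<in>A. hent (\<lambda>x. p (x(i := a))) (I \<rightarrow>\<^sub>E A))"
proof -
  have "inj_on (\<lambda>(a, x). x(i := a)) (A \<times> (I \<rightarrow>\<^sub>E A))"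
    using inj_combinator[OF assms(1), of "\<lambda>_. A"] by simp
  then have "hent p (insert i I \<rightarrow>\<^sub>E A) = hent (\<lambda>(a, x). p (x(i := a))) (A \<times> (I \<rightarrow>\<^sub>E A))"
    by (simp add: PiE_insert_eq hent_reindex split_def)
  then show ?thesis using assms by (simp add: hent_chain finite_PiE)
qed

text \<open>The joint law of \<open>(A, B)\<close> has the same information gap between total and parts as the law of \<open>A\<close>,
  and the conditional entropy \<open>H(A | B)\<close> is concave.\<close>
lemma hent_data_processing:
  assumes J: "finite J" and A: "finite A" and B: "finite B"
    and v: "\<And>j a. j \<in> J \<Longrightarrow> a \<in> A \<Longrightarrow> 0 \<le> v j a" and W: "is_channel W A B"
  defines "V \<equiv> \<lambda>a. \<Sum>j\<in>J. v j a"
  shows "hent (output_law V W A) B - (\<Sum>j\<in>J. hent (output_law (v j) W A) B)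
    \<le> hent V A - (\<Sum>j\<in>J. hent (v j) A)"
proof -
  define L where "L w = (\<Sum>a\<in>A. w a * ent (W a) B)" for w
  have chain: "hent w A + L w = hent (output_law w W A) B + (\<Sum>b\<in>B. hent (\<lambda>a. w a * W a b) A)"
    if "\<And>a. a \<in> A \<Longrightarrow> 0 \<le> w a" for w
    using hent_joint_law[OF A B that W] hent_chain_swap[OF A B, of "joint_law w W"]
    by (simp add: L_def joint_law_def output_law_def[abs_def])
  have V: "0 \<le> V a" if "a \<in> A" for a unfolding V_def using v that by (intro sum_nonneg)
  have "(\<Sum>j\<in>J. hent (v j) A) + L V
      = (\<Sum>j\<in>J. hent (output_law (v j) W A) B) + (\<Sum>j\<in>J. \<Sum>b\<in>B. hent (\<lambda>a. v j a * W a b) A)"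
  proof -
    have "L V = (\<Sum>j\<in>J. L (v j))"
      unfolding L_def V_def sum_distrib_right by (rule sum.swap)
    then show ?thesis using chain[OF v] by (simp flip: sum.distrib)
  qed
  also have "(\<Sum>j\<in>J. \<Sum>b\<in>B. hent (\<lambda>a. v j a * W a b) A) = (\<Sum>b\<in>B. \<Sum>j\<in>J. hent (\<lambda>a. v j a * W a b) A)"
    by (rule sum.swap)
  also have "\<dots> \<le> (\<Sum>b\<in>B. hent (\<lambda>a. V a * W a b) A)"
    unfolding V_def sum_distrib_right
    using J A v is_channel_nonneg[OF W] by (intro sum_mono hent_superadditive mult_nonneg_nonneg) auto
  finally show ?thesis using chain[of V, OF V] by linarith
qed

lemma ent_prod_law:
  assumes I: "finite I" and A: "finite A" and g: "\<And>i. i \<in> I \<Longrightarrow> is_pmf_on (g i) A"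
  shows "ent (prod_law I g) (I \<rightarrow>\<^sub>E A) = (\<Sum>i\<in>I. ent (g i) A)"
proof -
  have "plogp (prod_law I g x) = prod_law I g x * (\<Sum>i\<in>I. log 2 (g i (x i)))" if "x \<in> I \<rightarrow>\<^sub>E A" for x
    using log_prod_law[of I g x] I is_pmf_on_nonneg[OF g] that
    by (cases "prod_law I g x = 0") (auto simp: plogp_eq PiE_iff)
  then have "ent (prod_law I g) (I \<rightarrow>\<^sub>E A)
      = - (\<Sum>x\<in>I \<rightarrow>\<^sub>E A. prod_law I g x * (\<Sum>i\<in>I. log 2 (g i (x i))))"
    by (simp add: ent_def)
  also have "\<dots> = - (\<Sum>i\<in>I. \<Sum>a\<in>A. g i a * log 2 (g i a))"
    using I A g by (subst sum_prod_law_additive) (auto simp: is_pmf_on_sum)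
  finally show ?thesis by (simp add: ent_def plogp_eq sum_negf)
qed

lemma ent_le_sum_ent_coordinates:
  assumes I: "finite I" and A: "finite A" and q: "is_pmf_on q (I \<rightarrow>\<^sub>E A)"
  shows "ent q (I \<rightarrow>\<^sub>E A) \<le> (\<Sum>i\<in>I. ent (pushforward (\<lambda>x. x i) q (I \<rightarrow>\<^sub>E A)) A)"
proof -
  let ?X = "I \<rightarrow>\<^sub>E A"
  define r where "r i = pushforward (\<lambda>x. x i) q ?X" for i
  have r: "is_pmf_on (r i) A" if "i \<in> I" for i
    unfolding r_def using q A that by (intro is_pmf_on_pushforward) auto
  have pos: "0 < r i (x i)" if "i \<in> I" "x \<in> ?X" "0 < q x" for i x
  proof -
    have "q x * of_bool (x i = x i) \<le> r i (x i)"
      unfolding r_def pushforward_def prob_on_def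
      by (rule member_le_sum) (use that q in \<open>auto intro: is_pmf_on_finite is_pmf_on_nonneg[OF q]\<close>)
    then show ?thesis using that by simp
  qed
  have "ent q ?X = hent q ?X" by (simp add: hent_pmf q)
  also have "\<dots> \<le> (\<Sum>x\<in>?X. q x * - log 2 (prod_law I r x))"
  proof (rule gibbs_inequality)
    show "sum (prod_law I r) ?X \<le> 1"
      using is_pmf_on_prod_law[OF I A r] by (simp add: is_pmf_on_sum)
    show "0 < prod_law I r x" if "x \<in> ?X" "0 < q x" for x
      using pos that by (intro prod_law_pos) auto
  qed (use q is_pmf_on_nonneg[OF q] is_pmf_on_nonneg[OF r] in
      \<open>auto intro!: prod_law_nonneg intro: is_pmf_on_finite simp: PiE_iff\<close>)
  also have "\<dots> = (\<Sum>x\<in>?X. \<Sum>i\<in>I. q x * - log 2 (r i (x i)))"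
  proof (intro sum.cong refl)
    fix x assume x: "x \<in> ?X"
    show "q x * - log 2 (prod_law I r x) = (\<Sum>i\<in>I. q x * - log 2 (r i (x i)))"
    proof (cases "q x = 0")
      case False
      then have "0 < q x" using is_pmf_on_nonneg[OF q x] by simp
      then have "0 < r i (x i)" if "i \<in> I" for i using pos x that by blast
      then show ?thesis
        using prod_law_pos[of I r x] I by (simp add: log_prod_law less_imp_le sum_negf sum_distrib_left)
    qed simp
  qed
  also have "\<dots> = (\<Sum>i\<in>I. \<Sum>x\<in>?X. q x * - log 2 (r i (x i)))" by (rule sum.swap)
  also have "\<dots> = (\<Sum>i\<in>I. \<Sum>a\<in>A. r i a * - log 2 (r i a))"
    unfolding r_def using A by (intro sum.cong refl sum_pushforward[symmetric]) auto
  finally show ?thesis by (simp add: ent_def plogp_eq r_def sum_negf)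
qed

section \<open>Mutual information\<close>

context
  fixes p :: "'a \<Rightarrow> real" and W :: "'a \<Rightarrow> 'b \<Rightarrow> real" and A B
  assumes p: "is_pmf_on p A" and W: "is_channel W A B"
begin

lemma mutual_info_entropies:
  "mutual_info p W A B = hent p A + hent (output_law p W A) B - hent (joint_law p W) (A \<times> B)"
  using is_pmf_on_output_law[OF p W] is_pmf_on_joint_law[OF p W] p
  by (simp add: mutual_info_def hent_pmf output_law_def[abs_def] joint_law_def)

lemma mutual_info_equivocation:
  "mutual_info p W A B = ent p A - (\<Sum>b\<in>B. hent (\<lambda>a. p a * W a b) A)"
  using hent_chain_swap[OF is_pmf_on_finite[OF p] is_channel_finite[OF W is_pmf_on_nonempty[OF p]], where p = "joint_law p W"]
  by (simp add: mutual_info_entropies hent_pmf p joint_law_def output_law_def[abs_def])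

lemma mutual_info_noise_entropy:
  "mutual_info p W A B = ent (output_law p W A) B - (\<Sum>a\<in>A. p a * ent (W a) B)"
proof -
  have "hent (joint_law p W) (A \<times> B) = hent p A + (\<Sum>a\<in>A. p a * ent (W a) B)"
    using is_pmf_on_finite[OF p] is_pmf_on_nonneg[OF p] is_channel_finite[OF W is_pmf_on_nonempty[OF p]] W
    by (intro hent_joint_law) auto
  then show ?thesis
    using is_pmf_on_output_law[OF p W] by (simp add: mutual_info_entropies hent_pmf)
qed

text \<open>Every junk value \<open>log 2 0\<close> is multiplied by \<open>0\<close> here.\<close>
lemma mutual_info_density:
  "mutual_info p W A B
    = (\<Sum>ab\<in>A \<times> B. joint_law p W ab * (case ab of (a, b) \<Rightarrow> log 2 (W a b) - log 2 (output_law p W A b)))"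
proof -
  have "ent (output_law p W A) B = - (\<Sum>a\<in>A. p a * (\<Sum>b\<in>B. W a b * log 2 (output_law p W A b)))"
    unfolding ent_def plogp_eq sum_output_law ..
  then show ?thesis
    unfolding sum_joint_law mutual_info_noise_entropy
    by (simp add: ent_def plogp_eq right_diff_distrib sum_subtractf sum_negf)
qed

lemma mutual_info_nonneg: "0 \<le> mutual_info p W A B"
proof -
  have "(\<Sum>b\<in>B. hent (\<lambda>a. p a * W a b) A) \<le> hent (\<lambda>a. \<Sum>b\<in>B. p a * W a b) A"
    using is_pmf_on_finite[OF p] is_channel_finite[OF W is_pmf_on_nonempty[OF p]] is_pmf_on_nonneg[OF p] is_channel_nonneg[OF W]
    by (intro hent_superadditive) auto
  also have "\<dots> = ent p A"
    unfolding hent_pmf[OF p, symmetric]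
    by (intro hent_cong) (simp add: is_channel_sum[OF W] flip: sum_distrib_left)
  finally show ?thesis by (simp add: mutual_info_equivocation)
qed

lemma mutual_info_le_log_card: "mutual_info p W A B \<le> log 2 (real (card A))"
proof -
  have "0 \<le> (\<Sum>b\<in>B. hent (\<lambda>a. p a * W a b) A)"
    using is_pmf_on_finite[OF p] is_pmf_on_nonneg[OF p] is_channel_nonneg[OF W]
    by (intro sum_nonneg hent_nonneg) auto
  moreover have "ent p A \<le> log 2 (real (card A))"
    using hent_le_log_card[of A p] is_pmf_on_finite[OF p] is_pmf_on_nonneg[OF p]
    by (simp add: hent_pmf[OF p] is_pmf_on_sum[OF p])
  ultimately show ?thesis by (simp add: mutual_info_equivocation)
qed

end

lemma mutual_info_pushforward:
  assumes p: "is_pmf_on p A" and X: "finite X" "f ` A \<subseteq> X" and W: "is_channel W X B"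
  shows "mutual_info p (\<lambda>a. W (f a)) A B = mutual_info (pushforward f p A) W X B"
proof -
  have "output_law (pushforward f p A) W X = output_law p (\<lambda>a. W (f a)) A"
    unfolding output_law_def fun_eq_iff using X by (simp add: sum_pushforward)
  moreover have "(\<Sum>x\<in>X. pushforward f p A x * ent (W x) B) = (\<Sum>a\<in>A. p a * ent (W (f a)) B)"
    using X by (rule sum_pushforward)
  moreover have "is_channel (\<lambda>a. W (f a)) A B"
    using X W by (auto simp: is_channel_def)
  ultimately show ?thesis
    using mutual_info_noise_entropy[OF p, of "\<lambda>a. W (f a)" B]
      mutual_info_noise_entropy[OF is_pmf_on_pushforward[OF p X] W] by simp
qed

lemma mutual_info_product_channel_le:
  assumes I: "finite I" and B: "finite B" and p: "is_pmf_on p A"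
    and W: "\<And>i. i \<in> I \<Longrightarrow> is_channel (W i) A B"
  shows "mutual_info p (\<lambda>a. prod_law I (\<lambda>i. W i a)) A (I \<rightarrow>\<^sub>E B) \<le> (\<Sum>i\<in>I. mutual_info p (W i) A B)"
proof -
  define V where "V a = prod_law I (\<lambda>i. W i a)" for a
  have row: "is_pmf_on (W i a) B" if "i \<in> I" "a \<in> A" for i a
    by (rule is_channel_pmf[OF W]) (fact that)+
  have V: "is_channel V A (I \<rightarrow>\<^sub>E B)"
    unfolding V_def using I B row by (intro is_channelI is_pmf_on_prod_law)
  have coordinate: "ent (pushforward (\<lambda>y. y i) (output_law p V A) (I \<rightarrow>\<^sub>E B)) B = ent (output_law p (W i) A) B"
    if i: "i \<in> I" for i
  proof -
    have "pushforward (\<lambda>y. y i) (output_law p V A) (I \<rightarrow>\<^sub>E B) b = output_law p (W i) A b" if b: "b \<in> B" for b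
    proof -
      have "pushforward (\<lambda>y. y i) (V a) (I \<rightarrow>\<^sub>E B) b = W i a b" if "a \<in> A" for a
        unfolding V_def using I row i b that
        by (intro pushforward_prod_law_coordinate) auto
      then show ?thesis
        by (simp add: pushforward_def prob_on_output_law output_law_def)
    qed
    then show ?thesis by (simp add: ent_def)
  qed
  have "mutual_info p V A (I \<rightarrow>\<^sub>E B) = ent (output_law p V A) (I \<rightarrow>\<^sub>E B) - (\<Sum>a\<in>A. p a * ent (V a) (I \<rightarrow>\<^sub>E B))"
    by (rule mutual_info_noise_entropy[OF p V])
  also have "(\<Sum>a\<in>A. p a * ent (V a) (I \<rightarrow>\<^sub>E B)) = (\<Sum>a\<in>A. \<Sum>i\<in>I. p a * ent (W i a) B)"
    unfolding V_def sum_distrib_left[symmetric]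
    using I B row by (intro sum.cong refl) (simp add: ent_prod_law)
  also have "\<dots> = (\<Sum>i\<in>I. \<Sum>a\<in>A. p a * ent (W i a) B)" by (rule sum.swap)
  also have "ent (output_law p V A) (I \<rightarrow>\<^sub>E B) - \<dots>
      \<le> (\<Sum>i\<in>I. ent (output_law p (W i) A) B) - (\<Sum>i\<in>I. \<Sum>a\<in>A. p a * ent (W i a) B)"
    using ent_le_sum_ent_coordinates[OF I B is_pmf_on_output_law[OF p V]] by (simp add: coordinate)
  also have "\<dots> = (\<Sum>i\<in>I. mutual_info p (W i) A B)"
    using W by (simp add: mutual_info_noise_entropy[OF p] flip: sum_subtractf)
  finally show ?thesis unfolding V_def .
qed

subsection \<open>Additive noise channels\<close>

text \<open>The receiver also sees the side information \<open>s\<close> about the noise \<open>z\<close>.\<close>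
definition additive_channel ::
  "('x \<Rightarrow> 'z \<Rightarrow> 'z) \<Rightarrow> ('z \<times> 's \<Rightarrow> real) \<Rightarrow> 'z set \<Rightarrow> 's set \<Rightarrow> 'x \<Rightarrow> 'z \<times> 's \<Rightarrow> real" where
  "additive_channel \<sigma> N Z S x = pushforward (\<lambda>(z, s). (\<sigma> x z, s)) N (Z \<times> S)"

lemma sum_second_marginal:
  assumes "is_pmf_on N (Z \<times> S)"
  shows "(\<Sum>s\<in>S. \<Sum>z\<in>Z. N (z, s)) = 1"
  using is_pmf_on_sum[OF assms] by (subst sum.swap) (simp add: sum.cartesian_product)

context
  fixes \<sigma> :: "'z \<Rightarrow> 'z \<Rightarrow> 'z" and N :: "'z \<times> 's \<Rightarrow> real" and Z S
  assumes N: "is_pmf_on N (Z \<times> S)"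
    and noise_bij: "\<And>x. x \<in> Z \<Longrightarrow> bij_betw (\<sigma> x) Z Z"
    and input_bij: "\<And>z. z \<in> Z \<Longrightarrow> bij_betw (\<lambda>x. \<sigma> x z) Z Z"
begin

lemma additive_noise_alphabets: "finite Z" "Z \<noteq> {}" "finite S"
  using is_pmf_on_finite[OF N] is_pmf_on_nonempty[OF N] by (auto simp: finite_cartesian_product_iff)

lemma bij_betw_noise_shift:
  assumes "x \<in> Z"
  shows "bij_betw (\<lambda>(z, s). (\<sigma> x z, s)) (Z \<times> S) (Z \<times> S)"
  using bij_betw_map_prod[OF noise_bij[OF assms] bij_betw_id[of S]] by (simp add: map_prod_def id_def)

lemma is_channel_additive_channel: "is_channel (additive_channel \<sigma> N Z S) Z (Z \<times> S)"
  unfolding additive_channel_def using N bij_betw_noise_shift is_pmf_on_finite[OF N]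
  by (intro is_channelI is_pmf_on_pushforward) (auto simp: bij_betw_def)

lemma ent_additive_channel:
  assumes x: "x \<in> Z"
  shows "ent (additive_channel \<sigma> N Z S x) (Z \<times> S) = hent N (Z \<times> S)"
proof -
  let ?shift = "\<lambda>(z, s). (\<sigma> x z, s)"
  have shift: "inj_on ?shift (Z \<times> S)" "?shift ` (Z \<times> S) = Z \<times> S"
    using bij_betw_noise_shift[OF x] by (auto simp: bij_betw_def)
  have "hent (additive_channel \<sigma> N Z S x) (Z \<times> S) = hent (\<lambda>zs. additive_channel \<sigma> N Z S x (?shift zs)) (Z \<times> S)"
    using hent_reindex[OF shift(1)] by (simp only: shift(2))
  also have "\<dots> = hent N (Z \<times> S)"
    unfolding additive_channel_def by (intro hent_cong pushforward_inj_on is_pmf_on_finite[OF N] shift(1))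
  finally show ?thesis by (simp add: hent_pmf is_channel_pmf[OF is_channel_additive_channel x])
qed

lemma output_law_additive_channel_uniform:
  assumes v: "v \<in> Z" and s: "s \<in> S"
  shows "output_law (\<lambda>_. 1 / real (card Z)) (additive_channel \<sigma> N Z S) Z (v, s)
    = 1 / real (card Z) * (\<Sum>z\<in>Z. N (z, s))"
proof -
  have "additive_channel \<sigma> N Z S x (v, s) = (\<Sum>z\<in>Z. N (z, s) * of_bool (\<sigma> x z = v))" for x
  proof -
    have "additive_channel \<sigma> N Z S x (v, s)
        = (\<Sum>z\<in>Z. \<Sum>s'\<in>S. if s' = s then N (z, s') * of_bool (\<sigma> x z = v) else 0)"
      unfolding additive_channel_def pushforward_def prob_on_def sum.cartesian_product'
      by (intro sum.cong refl) auto
    then show ?thesis using additive_noise_alphabets s by simp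
  qed
  then have "output_law (\<lambda>_. 1 / real (card Z)) (additive_channel \<sigma> N Z S) Z (v, s)
      = 1 / real (card Z) * (\<Sum>x\<in>Z. \<Sum>z\<in>Z. N (z, s) * of_bool (\<sigma> x z = v))"
    by (simp add: output_law_def sum_distrib_left)
  also have "(\<Sum>x\<in>Z. \<Sum>z\<in>Z. N (z, s) * of_bool (\<sigma> x z = v)) = (\<Sum>z\<in>Z. \<Sum>x\<in>Z. N (z, s) * of_bool (\<sigma> x z = v))"
    by (rule sum.swap)
  also have "\<dots> = (\<Sum>z\<in>Z. \<Sum>w\<in>Z. N (z, s) * of_bool (w = v))"
    by (intro sum.cong refl sum.reindex_bij_betw[OF input_bij])
  also have "\<dots> = (\<Sum>z\<in>Z. N (z, s))"
    using additive_noise_alphabets v by (simp add: of_bool_def if_distrib cong: if_cong)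
  finally show ?thesis .
qed

lemma mutual_info_additive_channel_uniform:
  "mutual_info (\<lambda>_. 1 / real (card Z)) (additive_channel \<sigma> N Z S) Z (Z \<times> S)
    = log 2 (real (card Z)) - (\<Sum>s\<in>S. hent (\<lambda>z. N (z, s)) Z)"
proof -
  note uniform = is_pmf_on_uniform[OF additive_noise_alphabets(1,2)]
  note W = is_channel_additive_channel
  define NS where "NS s = (\<Sum>z\<in>Z. N (z, s))" for s
  have card: "0 < real (card Z)" using additive_noise_alphabets by (simp add: card_gt_0_iff)
  have NS: "0 \<le> NS s" if "s \<in> S" for s
    unfolding NS_def using is_pmf_on_nonneg[OF N] that by (intro sum_nonneg) auto
  have "sum NS S = 1" unfolding NS_def by (rule sum_second_marginal[OF N])
  then have "hent (\<lambda>v. \<Sum>s\<in>S. 1 / real (card Z) * NS s) Z = log 2 (real (card Z))"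
    using hent_const[of Z "1 / real (card Z)"] additive_noise_alphabets card by (simp flip: sum_divide_distrib)
  moreover have "hent (\<lambda>s. 1 / real (card Z) * NS s) S = 1 / real (card Z) * hent NS S"
    using NS by (intro hent_scale) auto
  moreover have "ent (output_law (\<lambda>_. 1 / real (card Z)) (additive_channel \<sigma> N Z S) Z) (Z \<times> S)
      = hent (\<lambda>(v, s). 1 / real (card Z) * NS s) (Z \<times> S)"
    unfolding hent_pmf[OF is_pmf_on_output_law[OF uniform W], symmetric] NS_def
    by (intro hent_cong) (auto simp: output_law_additive_channel_uniform)
  ultimately have "ent (output_law (\<lambda>_. 1 / real (card Z)) (additive_channel \<sigma> N Z S) Z) (Z \<times> S)
      = log 2 (real (card Z)) + hent NS S"
    using additive_noise_alphabets card by (simp add: hent_chain)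
  moreover have "hent N (Z \<times> S) = hent NS S + (\<Sum>s\<in>S. hent (\<lambda>z. N (z, s)) Z)"
    unfolding NS_def using additive_noise_alphabets by (intro hent_chain_swap) auto
  ultimately show ?thesis
    using mutual_info_noise_entropy[OF uniform W] card by (simp add: ent_additive_channel)
qed

end

subsection \<open>The capacity \<open>R\<^sub>0\<close> of the relay link\<close>

context
  fixes Wr :: "'x1::finite \<Rightarrow> 's::finite \<Rightarrow> real"
  assumes Wr: "is_channel Wr UNIV UNIV"
begin

lemma bdd_above_mutual_info: "bdd_above {mutual_info p Wr UNIV UNIV | p. is_pmf_on p UNIV}"
  using mutual_info_le_log_card[OF _ Wr] by (intro bdd_aboveI) auto

lemma mutual_info_le_R0: "is_pmf_on p UNIV \<Longrightarrow> mutual_info p Wr UNIV UNIV \<le> R0 Wr"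
  unfolding R0_def by (intro cSup_upper bdd_above_mutual_info) auto

lemma R0_nonneg: "0 \<le> R0 Wr"
proof -
  have u: "is_pmf_on (\<lambda>_::'x1. 1 / real (card (UNIV :: 'x1 set))) UNIV"
    by (rule is_pmf_on_uniform) auto
  show ?thesis using mutual_info_nonneg[OF u Wr] mutual_info_le_R0[OF u] by linarith
qed

lemma less_R0E:
  assumes "J < R0 Wr"
  obtains p where "is_pmf_on p UNIV" "J < mutual_info p Wr UNIV UNIV"
proof -
  have "is_pmf_on (\<lambda>_::'x1. 1 / real (card (UNIV :: 'x1 set))) UNIV"
    by (rule is_pmf_on_uniform) auto
  then have "{mutual_info p Wr UNIV UNIV | p. is_pmf_on p UNIV} \<noteq> {}" by blast
  then show ?thesis
    using assms that by (auto simp: R0_def less_cSup_iff[OF _ bdd_above_mutual_info])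
qed

lemma mutual_info_memoryless_uses_le:
  assumes I: "finite I" and p: "is_pmf_on p A"
  shows "mutual_info p (\<lambda>a. prod_law I (\<lambda>i. Wr (f i a))) A (I \<rightarrow>\<^sub>E UNIV) \<le> real (card I) * R0 Wr"
proof -
  have "mutual_info p (\<lambda>a. prod_law I (\<lambda>i. Wr (f i a))) A (I \<rightarrow>\<^sub>E UNIV)
      \<le> (\<Sum>i\<in>I. mutual_info p (\<lambda>a. Wr (f i a)) A UNIV)"
    using I p Wr by (intro mutual_info_product_channel_le) (auto simp: is_channel_def)
  also have "\<dots> \<le> (\<Sum>i\<in>I. R0 Wr)"
  proof (rule sum_mono)
    fix i
    have "mutual_info p (\<lambda>a. Wr (f i a)) A UNIV = mutual_info (pushforward (f i) p A) Wr UNIV UNIV"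
      using p Wr by (intro mutual_info_pushforward) auto
    also have "\<dots> \<le> R0 Wr" using p by (intro mutual_info_le_R0 is_pmf_on_pushforward) auto
    finally show "mutual_info p (\<lambda>a. Wr (f i a)) A UNIV \<le> R0 Wr" .
  qed
  finally show ?thesis by simp
qed

end

section \<open>Coding for memoryless channels and sources\<close>

subsection \<open>Large deviations\<close>

lemma chernoff_exponent:
  assumes "is_pmf_on p A" "(\<Sum>a\<in>A. p a * f a) < \<theta>"
  shows "\<exists>t>0. (\<Sum>a\<in>A. p a * exp (t * (f a - \<theta>))) < 1"
proof -
  define F where "F t = (\<Sum>a\<in>A. p a * exp (t * (f a - \<theta>)))" for t
  have "(F has_real_derivative (\<Sum>a\<in>A. p a * (f a - \<theta>))) (at 0)"
    unfolding F_def by (auto intro!: derivative_eq_intros sum.cong)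
  moreover have "(\<Sum>a\<in>A. p a * (f a - \<theta>)) < 0"
    using assms by (simp add: right_diff_distrib sum_subtractf is_pmf_on_sum flip: sum_distrib_right)
  ultimately obtain d where d: "d > 0" "\<forall>h>0. h < d \<longrightarrow> F (0 + h) < F 0"
    using DERIV_neg_dec_right by blast
  then have "F (d / 2) < F 0" by (auto dest!: spec[of _ "d / 2"])
  moreover have "F 0 = 1" using assms by (simp add: F_def is_pmf_on_sum)
  ultimately show ?thesis using d(1) unfolding F_def by (intro exI[of _ "d / 2"]) auto
qed

lemma sum_iid_memoryless:
  assumes "finite I" "finite A" "finite B"
  shows "(\<Sum>xy\<in>(I \<rightarrow>\<^sub>E A) \<times> (I \<rightarrow>\<^sub>E B). joint_law (iid I p) (memoryless I W) xy)
    = (\<Sum>ab\<in>A \<times> B. joint_law p W ab) ^ card I"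
proof -
  have "sum (memoryless I W x) (I \<rightarrow>\<^sub>E B) = iid I (\<lambda>a. sum (W a) B) x" for x
    using assms by (simp add: sum_prod_law prod_law_def[of I "\<lambda>_ a. sum (W a) B"])
  then have "(\<Sum>xy\<in>(I \<rightarrow>\<^sub>E A) \<times> (I \<rightarrow>\<^sub>E B). joint_law (iid I p) (memoryless I W) xy)
      = sum (iid I (\<lambda>a. p a * sum (W a) B)) (I \<rightarrow>\<^sub>E A)"
    using sum_joint_law[of "iid I p" "memoryless I W" "\<lambda>_. 1"]
    by (simp add: prod_law_mult) (simp add: prod_law_def)
  also have "\<dots> = (\<Sum>a\<in>A. p a * sum (W a) B) ^ card I"
    using assms by (simp add: sum_prod_law)
  finally show ?thesis using sum_joint_law[of p W "\<lambda>_. 1" A B] by simp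
qed

lemma of_bool_threshold_le_prod_exp:
  fixes l :: nat
  assumes "0 \<le> \<tau>"
  shows "of_bool (real l * \<theta> \<le> (\<Sum>t<l. f t)) \<le> (\<Prod>t\<in>{0..<l}. exp (\<tau> * (f t - \<theta>)))"
proof -
  have "of_bool (real l * \<theta> \<le> (\<Sum>t<l. f t)) \<le> exp (\<tau> * ((\<Sum>t<l. f t) - real l * \<theta>))"
    using assms by (simp add: of_bool_def)
  also have "\<tau> * ((\<Sum>t<l. f t) - real l * \<theta>) = (\<Sum>t\<in>{0..<l}. \<tau> * (f t - \<theta>))"
    by (simp add: sum_subtractf lessThan_atLeast0 flip: sum_distrib_left)
  finally show ?thesis by (simp add: exp_sum)
qed

lemma memoryless_tail_bound:
  assumes p: "is_pmf_on p A" and W: "is_channel W A B"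
    and mean: "(\<Sum>ab\<in>A \<times> B. joint_law p W ab * f ab) < \<theta>"
  shows "\<exists>r. 0 \<le> r \<and> r < 1 \<and> (\<forall>l. prob_on (iid_joint l p W)
    (seqs l A \<times> seqs l B) (\<lambda>(x, y). real l * \<theta> \<le> (\<Sum>t<l. f (x t, y t))) \<le> r ^ l)"
proof -
  have A: "finite A" and B: "finite B"
    using is_pmf_on_finite[OF p] is_channel_finite[OF W is_pmf_on_nonempty[OF p]] .
  obtain \<tau> where \<tau>: "0 < \<tau>" "(\<Sum>ab\<in>A \<times> B. joint_law p W ab * exp (\<tau> * (f ab - \<theta>))) < 1"
    using chernoff_exponent[OF is_pmf_on_joint_law[OF p W] mean] by blast
  define V where "V a b = W a b * exp (\<tau> * (f (a, b) - \<theta>))" for a b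
  define r where "r = (\<Sum>ab\<in>A \<times> B. joint_law p V ab)"
  have "r < 1" using \<tau>(2) by (simp add: r_def V_def joint_law_def split_def mult.assoc)
  moreover have "0 \<le> r"
    unfolding r_def joint_law_def V_def
    by (intro sum_nonneg) (auto intro!: mult_nonneg_nonneg dest: is_pmf_on_nonneg[OF p] is_channel_nonneg[OF W])
  moreover have "prob_on (iid_joint l p W) (seqs l A \<times> seqs l B) (\<lambda>(x, y). real l * \<theta> \<le> (\<Sum>t<l. f (x t, y t))) \<le> r ^ l"
    for l
  proof -
    have "prob_on (iid_joint l p W) (seqs l A \<times> seqs l B) (\<lambda>(x, y). real l * \<theta> \<le> (\<Sum>t<l. f (x t, y t)))
      \<le> (\<Sum>xy\<in>seqs l A \<times> seqs l B. iid_joint l p V xy)"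
      unfolding prob_on_def
    proof (rule sum_mono)
      fix xy assume xy: "xy \<in> seqs l A \<times> seqs l B"
      obtain x y where [simp]: "xy = (x, y)" by (cases xy)
      have "iid_joint l p W xy * of_bool (real l * \<theta> \<le> (\<Sum>t<l. f (x t, y t)))
          \<le> iid_joint l p W xy * (\<Prod>t\<in>{0..<l}. exp (\<tau> * (f (x t, y t) - \<theta>)))"
        using \<tau>(1) is_pmf_on_nonneg[OF is_pmf_on_iid_joint[OF p W] xy]
        by (intro mult_left_mono of_bool_threshold_le_prod_exp) auto
      then show "iid_joint l p W xy * of_bool (case xy of (x, y) \<Rightarrow> real l * \<theta> \<le> (\<Sum>t<l. f (x t, y t)))
          \<le> iid_joint l p V xy"
        by (simp add: joint_law_def prod_law_def V_def prod.distrib mult.assoc)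
    qed
    also have "\<dots> = r ^ l" using A B by (simp add: sum_iid_memoryless r_def)
    finally show ?thesis .
  qed
  ultimately show ?thesis by blast
qed

lemma log_memoryless_density:
  fixes l :: nat
  assumes p: "is_pmf_on p A" and W: "is_channel W A B"
    and x: "x \<in> seqs l A" and y: "y \<in> seqs l B"
    and nz: "iid_joint l p W (x, y) \<noteq> 0"
  defines "q \<equiv> output_law p W A"
  shows "0 < memoryless {0..<l} W x y" "0 < iid {0..<l} q y"
    "log 2 (memoryless {0..<l} W x y) - log 2 (iid {0..<l} q y)
      = (\<Sum>t<l. log 2 (W (x t) (y t)) - log 2 (q (y t)))"
proof -
  have nz': "iid {0..<l} p x \<noteq> 0" "memoryless {0..<l} W x y \<noteq> 0"
    using nz by (auto simp: joint_law_def)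
  have mem: "x t \<in> A" "y t \<in> B" if "t < l" for t
    using PiE_mem[OF x, of t] PiE_mem[OF y, of t] that by auto
  have w: "0 < W (x t) (y t)" if "t < l" for t
    using that mem[OF that] is_channel_nonneg[OF W] nz'(2) by (intro prod_law_factor_pos[of "{0..<l}" t]) auto
  have "0 < p (x t)" if "t < l" for t
    using that mem[OF that] is_pmf_on_nonneg[OF p] nz'(1)
    by (intro prod_law_factor_pos[of "{0..<l}" t "\<lambda>_. p"]) auto
  then have q: "0 < q (y t)" if "t < l" for t
    unfolding q_def output_law_def using that w mem[OF that] is_pmf_on_nonneg[OF p] is_channel_nonneg[OF W]
    by (intro sum_pos2[of A "x t"] is_pmf_on_finite[OF p]) auto
  show pos: "0 < memoryless {0..<l} W x y" "0 < iid {0..<l} q y"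
    using w q by (auto intro: prod_law_pos)
  show "log 2 (memoryless {0..<l} W x y) - log 2 (iid {0..<l} q y)
      = (\<Sum>t<l. log 2 (W (x t) (y t)) - log 2 (q (y t)))"
    using w q pos log_prod_law[of "{0..<l}" "\<lambda>t. W (x t)" y] log_prod_law[of "{0..<l}" "\<lambda>_. q" y]
    by (simp add: less_imp_le sum_subtractf lessThan_atLeast0)
qed

lemma memoryless_density_tail:
  assumes p: "is_pmf_on p A" and W: "is_channel W A B" and \<theta>: "c * mutual_info p W A B < \<theta>"
  shows "\<exists>r. 0 \<le> r \<and> r < 1 \<and> (\<forall>l. prob_on (iid_joint l p W) (seqs l A \<times> seqs l B) (\<lambda>(x, y). real l * \<theta>
    \<le> c * (log 2 (memoryless {0..<l} W x y) - log 2 (iid {0..<l} (output_law p W A) y))) \<le> r ^ l)"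
proof -
  define f where "f = (\<lambda>(a, b). c * (log 2 (W a b) - log 2 (output_law p W A b)))"
  have "(\<Sum>ab\<in>A \<times> B. joint_law p W ab * f ab) < \<theta>"
    using \<theta> by (simp add: mutual_info_density[OF p W] f_def split_def sum_distrib_left mult.left_commute)
  then obtain r where r: "0 \<le> r" "r < 1" "\<And>l. prob_on (iid_joint l p W) (seqs l A \<times> seqs l B)
      (\<lambda>(x, y). real l * \<theta> \<le> (\<Sum>t<l. f (x t, y t))) \<le> r ^ l"
    using memoryless_tail_bound[OF p W] by meson
  have "prob_on (iid_joint l p W) (seqs l A \<times> seqs l B) (\<lambda>(x, y). real l * \<theta>
      \<le> c * (log 2 (memoryless {0..<l} W x y) - log 2 (iid {0..<l} (output_law p W A) y))) \<le> r ^ l" for l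
  proof (rule order_trans[OF prob_on_mono r(3)])
    show "0 \<le> iid_joint l p W xy" if "xy \<in> seqs l A \<times> seqs l B" for xy
      using that by (rule is_pmf_on_nonneg[OF is_pmf_on_iid_joint[OF p W]])
  next
    fix xy assume "xy \<in> seqs l A \<times> seqs l B" "iid_joint l p W xy \<noteq> 0"
      "case xy of (x, y) \<Rightarrow> real l * \<theta>
        \<le> c * (log 2 (memoryless {0..<l} W x y) - log 2 (iid {0..<l} (output_law p W A) y))"
    then show "case xy of (x, y) \<Rightarrow> real l * \<theta> \<le> (\<Sum>t<l. f (x t, y t))"
      using log_memoryless_density(3)[OF p W] by (auto simp: f_def sum_distrib_left)
  qed
  then show ?thesis using r(1,2) by blast
qed

lemma memoryless_density_lower_tail:
  assumes p: "is_pmf_on p A" and W: "is_channel W A B" and J: "J < mutual_info p W A B"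
  shows "\<exists>r. 0 \<le> r \<and> r < 1 \<and> (\<forall>l. prob_on (iid_joint l p W) (seqs l A \<times> seqs l B) (\<lambda>(x, y).
    2 powr (- (real l * J)) * memoryless {0..<l} W x y < iid {0..<l} (output_law p W A) y) \<le> r ^ l)"
proof -
  define q where "q = output_law p W A"
  obtain r where r: "0 \<le> r" "r < 1" "\<And>l. prob_on (iid_joint l p W) (seqs l A \<times> seqs l B) (\<lambda>(x, y). real l * - J
      \<le> - 1 * (log 2 (memoryless {0..<l} W x y) - log 2 (iid {0..<l} q y))) \<le> r ^ l"
    using memoryless_density_tail[OF p W, of "- 1" "- J"] J unfolding q_def by auto
  have "prob_on (iid_joint l p W) (seqs l A \<times> seqs l B)
      (\<lambda>(x, y). 2 powr (- (real l * J)) * memoryless {0..<l} W x y < iid {0..<l} q y) \<le> r ^ l" for l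
  proof (rule order_trans[OF prob_on_mono r(3)])
    show "0 \<le> iid_joint l p W xy" if "xy \<in> seqs l A \<times> seqs l B" for xy
      using that by (rule is_pmf_on_nonneg[OF is_pmf_on_iid_joint[OF p W]])
  next
    fix xy assume "xy \<in> seqs l A \<times> seqs l B" "iid_joint l p W xy \<noteq> 0"
      and less: "case xy of (x, y) \<Rightarrow> 2 powr (- (real l * J)) * memoryless {0..<l} W x y < iid {0..<l} q y"
    then obtain x y where xy: "xy = (x, y)" and pos: "0 < memoryless {0..<l} W x y" "0 < iid {0..<l} q y"
      using log_memoryless_density(1,2)[OF p W] unfolding q_def by blast
    have "log 2 (2 powr (- (real l * J)) * memoryless {0..<l} W x y) < log 2 (iid {0..<l} q y)"
      using less pos by (subst log_less_cancel_iff) (auto simp: xy)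
    then show "case xy of (x, y) \<Rightarrow> real l * - J \<le> - 1 * (log 2 (memoryless {0..<l} W x y) - log 2 (iid {0..<l} q y))"
      using pos by (simp add: xy log_mult)
  qed
  then show ?thesis using r(1,2) unfolding q_def by blast
qed

lemma memoryless_density_upper_tail:
  assumes p: "is_pmf_on p A" and W: "is_channel W A B" and J: "mutual_info p W A B < J"
  shows "\<exists>r. 0 \<le> r \<and> r < 1 \<and> (\<forall>l. prob_on (iid_joint l p W) (seqs l A \<times> seqs l B) (\<lambda>(x, y).
    iid {0..<l} (output_law p W A) y < 2 powr (- (real l * J)) * memoryless {0..<l} W x y) \<le> r ^ l)"
proof -
  define q where "q = output_law p W A"
  obtain r where r: "0 \<le> r" "r < 1" "\<And>l. prob_on (iid_joint l p W) (seqs l A \<times> seqs l B) (\<lambda>(x, y). real l * J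
      \<le> 1 * (log 2 (memoryless {0..<l} W x y) - log 2 (iid {0..<l} q y))) \<le> r ^ l"
    using memoryless_density_tail[OF p W, of 1 J] J unfolding q_def by auto
  have "prob_on (iid_joint l p W) (seqs l A \<times> seqs l B)
      (\<lambda>(x, y). iid {0..<l} q y < 2 powr (- (real l * J)) * memoryless {0..<l} W x y) \<le> r ^ l" for l
  proof (rule order_trans[OF prob_on_mono r(3)])
    show "0 \<le> iid_joint l p W xy" if "xy \<in> seqs l A \<times> seqs l B" for xy
      using that by (rule is_pmf_on_nonneg[OF is_pmf_on_iid_joint[OF p W]])
  next
    fix xy assume "xy \<in> seqs l A \<times> seqs l B" "iid_joint l p W xy \<noteq> 0"
      and less: "case xy of (x, y) \<Rightarrow> iid {0..<l} q y < 2 powr (- (real l * J)) * memoryless {0..<l} W x y"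
    then obtain x y where xy: "xy = (x, y)" and pos: "0 < memoryless {0..<l} W x y" "0 < iid {0..<l} q y"
      using log_memoryless_density(1,2)[OF p W] unfolding q_def by blast
    have "log 2 (iid {0..<l} q y) < log 2 (2 powr (- (real l * J)) * memoryless {0..<l} W x y)"
      using less pos by (subst log_less_cancel_iff) (auto simp: xy)
    then show "case xy of (x, y) \<Rightarrow> real l * J \<le> 1 * (log 2 (memoryless {0..<l} W x y) - log 2 (iid {0..<l} q y))"
      using pos by (simp add: xy log_mult)
  qed
  then show ?thesis using r(1,2) unfolding q_def by blast
qed

subsection \<open>Channel coding\<close>

lemma exists_codeword_avoiding:
  assumes P: "is_pmf_on P X" and W: "is_channel W X S"
    and good: "prob_on (joint_law P W) (X \<times> S) (\<lambda>(x, s). \<not> D x s) \<le> \<eta>"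
    and used: "prob_on (output_law P W X) S used \<le> \<gamma>"
  shows "\<exists>x\<in>X. 1 - \<eta> - \<gamma> \<le> prob_on (W x) S (\<lambda>s. D x s \<and> \<not> used s)"
proof (rule exists_ge_average[OF P])
  have D_split: "1 - prob_on (W x) S (\<lambda>s. \<not> D x s) - prob_on (W x) S used
      \<le> prob_on (W x) S (\<lambda>s. D x s \<and> \<not> used s)" if x: "x \<in> X" for x
  proof -
    have Wx: "is_pmf_on (W x) S" using W x by (rule is_channel_pmf)
    have "prob_on (W x) S (D x) \<le> prob_on (W x) S (\<lambda>s. (D x s \<and> \<not> used s) \<or> used s)"
      using is_pmf_on_nonneg[OF Wx] by (intro prob_on_mono) auto
    also have "\<dots> \<le> prob_on (W x) S (\<lambda>s. D x s \<and> \<not> used s) + prob_on (W x) S used"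
      using is_pmf_on_nonneg[OF Wx] by (intro prob_on_disj_le)
    finally show ?thesis by (simp add: prob_on_not[OF Wx])
  qed
  have "1 - \<eta> - \<gamma> \<le> (\<Sum>x\<in>X. P x) - (\<Sum>x\<in>X. P x * prob_on (W x) S (\<lambda>s. \<not> D x s))
      - (\<Sum>x\<in>X. P x * prob_on (W x) S used)"
    using good used by (simp add: prob_on_joint_law prob_on_output_law is_pmf_on_sum[OF P])
  also have "\<dots> = (\<Sum>x\<in>X. P x * (1 - prob_on (W x) S (\<lambda>s. \<not> D x s) - prob_on (W x) S used))"
    by (simp add: right_diff_distrib sum_subtractf)
  also have "\<dots> \<le> (\<Sum>x\<in>X. P x * prob_on (W x) S (\<lambda>s. D x s \<and> \<not> used s))"
    by (intro sum_mono mult_left_mono D_split is_pmf_on_nonneg[OF P])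
  finally show "1 - \<eta> - \<gamma> \<le> (\<Sum>x\<in>X. P x * prob_on (W x) S (\<lambda>s. D x s \<and> \<not> used s))" .
qed

text \<open>Codewords are chosen greedily: the decision regions used so far have probability at most
  \<open>M * \<beta>\<close> under the output law, so on average over \<open>P\<close> one more codeword fits.\<close>
lemma greedy_codebook:
  assumes P: "is_pmf_on P X" and W: "is_channel W X S" and \<beta>: "0 \<le> \<beta>"
    and good: "prob_on (joint_law P W) (X \<times> S) (\<lambda>(x, s). \<not> D x s) \<le> \<eta>"
    and bad: "\<And>x. x \<in> X \<Longrightarrow> prob_on (output_law P W X) S (D x) \<le> \<beta>"
  shows "\<exists>c. \<forall>w\<in>{1..M::nat}. c w \<in> X \<and>
    1 - \<eta> - real M * \<beta> \<le> prob_on (W (c w)) S (\<lambda>s. D (c w) s \<and> (\<forall>v\<in>{1..<w}. \<not> D (c v) s))"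
proof (induction M)
  case (Suc M)
  then obtain c where c: "\<And>w. w \<in> {1..M} \<Longrightarrow> c w \<in> X"
    "\<And>w. w \<in> {1..M} \<Longrightarrow> 1 - \<eta> - real M * \<beta>
      \<le> prob_on (W (c w)) S (\<lambda>s. D (c w) s \<and> (\<forall>v\<in>{1..<w}. \<not> D (c v) s))" by blast
  define used where "used s \<longleftrightarrow> (\<exists>v\<in>{1..M}. D (c v) s)" for s
  have "prob_on (output_law P W X) S used \<le> (\<Sum>v\<in>{1..M}. prob_on (output_law P W X) S (D (c v)))"
    unfolding used_def using is_pmf_on_nonneg[OF is_pmf_on_output_law[OF P W]] by (intro prob_on_Bex_le) auto
  also have "\<dots> \<le> (\<Sum>v\<in>{1..M}. \<beta>)" by (intro sum_mono bad c)
  finally have "prob_on (output_law P W X) S used \<le> real M * \<beta>" by simp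
  from exists_codeword_avoiding[OF P W good this]
  obtain x where x: "x \<in> X" "1 - \<eta> - real M * \<beta> \<le> prob_on (W x) S (\<lambda>s. D x s \<and> \<not> used s)" ..
  have "(c(Suc M := x)) w \<in> X \<and> 1 - \<eta> - real M * \<beta> \<le> prob_on (W ((c(Suc M := x)) w)) S
      (\<lambda>s. D ((c(Suc M := x)) w) s \<and> (\<forall>v\<in>{1..<w}. \<not> D ((c(Suc M := x)) v) s))" if w: "w \<in> {1..Suc M}" for w
  proof (cases "w = Suc M")
    case True
    then have "(\<forall>v\<in>{1..<w}. \<not> D ((c(Suc M := x)) v) s) \<longleftrightarrow> \<not> used s" for s
      by (auto simp: used_def)
    then show ?thesis using True x by simp
  next
    case False
    then have "w \<in> {1..M}" using w by auto
    moreover from this have "(\<forall>v\<in>{1..<w}. \<not> D ((c(Suc M := x)) v) s) \<longleftrightarrow> (\<forall>v\<in>{1..<w}. \<not> D (c v) s)" for s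
      by auto
    ultimately show ?thesis using c False by simp
  qed
  then show ?case using \<beta> by (intro exI[of _ "c(Suc M := x)"]) (fastforce simp: algebra_simps)
qed simp

lemma one_shot_channel_coding:
  assumes P: "is_pmf_on P X" and W: "is_channel W X S" and \<beta>: "0 \<le> \<beta>"
  shows "\<exists>c g. \<forall>w\<in>{1..M::nat}. c w \<in> X \<and> prob_on (W (c w)) S (\<lambda>s. g s \<noteq> w)
    \<le> prob_on (joint_law P W) (X \<times> S) (\<lambda>(x, s). \<beta> * W x s < output_law P W X s) + real M * \<beta>"
    (is "\<exists>c g. \<forall>w\<in>_. _ \<and> _ \<le> ?\<eta> + _")
proof -
  define D where "D x s \<longleftrightarrow> output_law P W X s \<le> \<beta> * W x s" for x s
  have "prob_on (output_law P W X) S (D x) \<le> \<beta>" if x: "x \<in> X" for x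
  proof -
    have "prob_on (output_law P W X) S (D x) \<le> (\<Sum>s\<in>S. \<beta> * W x s)"
      unfolding prob_on_def D_def using \<beta> is_channel_nonneg[OF W x] by (intro sum_mono) auto
    then show ?thesis by (simp add: is_channel_sum[OF W x] flip: sum_distrib_left)
  qed
  moreover have "prob_on (joint_law P W) (X \<times> S) (\<lambda>(x, s). \<not> D x s) \<le> ?\<eta>"
    by (simp add: D_def not_le)
  ultimately obtain c where c: "\<And>w. w \<in> {1..M} \<Longrightarrow> c w \<in> X" "\<And>w. w \<in> {1..M} \<Longrightarrow>
      1 - ?\<eta> - real M * \<beta> \<le> prob_on (W (c w)) S (\<lambda>s. D (c w) s \<and> (\<forall>v\<in>{1..<w}. \<not> D (c v) s))"
    using greedy_codebook[OF P W \<beta>, of D ?\<eta> M] by blast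
  define g where "g s = (LEAST w. 1 \<le> w \<and> D (c w) s)" for s
  have "prob_on (W (c w)) S (\<lambda>s. g s \<noteq> w) \<le> ?\<eta> + real M * \<beta>" if w: "w \<in> {1..M}" for w
  proof -
    have cw: "is_pmf_on (W (c w)) S" by (rule is_channel_pmf[OF W c(1)[OF w]])
    have "g s = w" if "D (c w) s \<and> (\<forall>v\<in>{1..<w}. \<not> D (c v) s)" for s
      unfolding g_def using that w by (intro Least_equality) (auto simp: not_less[symmetric])
    then have "prob_on (W (c w)) S (\<lambda>s. D (c w) s \<and> (\<forall>v\<in>{1..<w}. \<not> D (c v) s))
        \<le> prob_on (W (c w)) S (\<lambda>s. g s = w)"
      using is_pmf_on_nonneg[OF cw] by (intro prob_on_mono) auto
    then show ?thesis using c(2)[OF w] by (simp add: prob_on_not[OF cw])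
  qed
  then show ?thesis using c(1) by blast
qed

lemma powr_diff_power: "(2 powr (R - J)) ^ l = 2 powr (real l * R) * 2 powr (- (real l * J))"
  by (simp add: powr_power right_diff_distrib mult.commute[of _ "real l"] flip: powr_add)

theorem channel_coding:
  assumes p: "is_pmf_on p A" and W: "is_channel W A B" and R: "R < mutual_info p W A B"
  shows "\<exists>\<epsilon>. \<epsilon> \<longlonglongrightarrow> 0 \<and> (\<forall>l M. real M \<le> 2 * 2 powr (real l * R) \<longrightarrow> (\<exists>c g. \<forall>w\<in>{1..M::nat}.
    c w \<in> seqs l A \<and> prob_on (memoryless {0..<l} W (c w)) (seqs l B) (\<lambda>s. g s \<noteq> w) \<le> \<epsilon> l))"
proof -
  have A: "finite A" and B: "finite B"
    using is_pmf_on_finite[OF p] is_channel_finite[OF W is_pmf_on_nonempty[OF p]] .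
  define J where "J = (mutual_info p W A B + R) / 2"
  have J: "R < J" "J < mutual_info p W A B" using R by (auto simp: J_def)
  obtain r where r: "0 \<le> r" "r < 1" "\<And>l. prob_on (iid_joint l p W) (seqs l A \<times> seqs l B)
      (\<lambda>(x, y). 2 powr (- (real l * J)) * memoryless {0..<l} W x y < iid {0..<l} (output_law p W A) y) \<le> r ^ l"
    using memoryless_density_lower_tail[OF p W J(2)] by blast
  define \<epsilon> where "\<epsilon> l = r ^ l + 2 * (2 powr (R - J)) ^ l" for l :: nat
  have "2 powr (R - J) < 1" using J powr_less_cancel_iff[of 2 "R - J" 0] by simp
  then have "\<epsilon> \<longlonglongrightarrow> 0 + 2 * 0"
    unfolding \<epsilon>_def using r by (intro tendsto_add tendsto_mult tendsto_const LIMSEQ_realpow_zero) auto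
  moreover have "\<exists>c g. \<forall>w\<in>{1..M::nat}. c w \<in> seqs l A \<and>
      prob_on (memoryless {0..<l} W (c w)) (seqs l B) (\<lambda>s. g s \<noteq> w) \<le> \<epsilon> l"
    if M: "real M \<le> 2 * 2 powr (real l * R)" for l M
  proof -
    let ?\<beta> = "2 powr (- (real l * J))"
    have P: "is_pmf_on (iid {0..<l} p) (seqs l A)" using A p by (intro is_pmf_on_prod_law) auto
    have V: "is_channel (memoryless {0..<l} W) (seqs l A) (seqs l B)"
      using B W by (intro is_channel_memoryless) auto
    have "real M * ?\<beta> \<le> 2 * 2 powr (real l * R) * ?\<beta>"
      using M by (intro mult_right_mono) auto
    also have "\<dots> = 2 * (2 powr (R - J)) ^ l"
      by (simp add: powr_diff_power)
    finally have "prob_on (iid_joint l p W) (seqs l A \<times> seqs l B) (\<lambda>(x, s). ?\<beta> * memoryless {0..<l} W x s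
        < output_law (iid {0..<l} p) (memoryless {0..<l} W) (seqs l A) s) + real M * ?\<beta> \<le> \<epsilon> l"
      using r(3)[of l] A by (simp add: \<epsilon>_def output_law_iid_memoryless)
    then show ?thesis
      using one_shot_channel_coding[OF P V, of ?\<beta> M] by (meson order_trans powr_ge_zero)
  qed
  ultimately show ?thesis by auto
qed

subsection \<open>Covering\<close>

text \<open>Derandomised random covering: each of the \<open>M\<close> codewords is chosen no worse than its average.\<close>
lemma exists_codebook_le_random:
  assumes q: "is_pmf_on q U" and w: "\<And>y. y \<in> Y \<Longrightarrow> 0 \<le> w y"
  shows "\<exists>c. (\<forall>j. c j \<in> U) \<and>
    prob_on w Y (\<lambda>y. \<forall>j<M. \<not> G y (c j)) \<le> (\<Sum>y\<in>Y. w y * prob_on q U (\<lambda>u. \<not> G y u) ^ M)"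
  using w
proof (induction M arbitrary: w)
  case 0
  obtain u where "u \<in> U" using is_pmf_on_nonempty[OF q] by blast
  then show ?case by (intro exI[of _ "\<lambda>_. u"]) (auto simp: prob_on_def)
next
  case (Suc M)
  define miss where "miss y = prob_on q U (\<lambda>u. \<not> G y u)" for y
  have "(\<Sum>u\<in>U. q u * (\<Sum>y\<in>Y. w y * of_bool (\<not> G y u) * miss y ^ M))
      = (\<Sum>u\<in>U. \<Sum>y\<in>Y. w y * miss y ^ M * (q u * of_bool (\<not> G y u)))"
    by (simp add: sum_distrib_left mult_ac)
  also have "\<dots> = (\<Sum>y\<in>Y. \<Sum>u\<in>U. w y * miss y ^ M * (q u * of_bool (\<not> G y u)))"
    by (rule sum.swap)
  also have "\<dots> = (\<Sum>y\<in>Y. w y * miss y ^ Suc M)"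
    unfolding sum_distrib_left[symmetric] by (simp add: miss_def prob_on_def mult_ac)
  finally have "(\<Sum>u\<in>U. q u * (\<Sum>y\<in>Y. w y * of_bool (\<not> G y u) * miss y ^ M))
      \<le> (\<Sum>y\<in>Y. w y * miss y ^ Suc M)" by simp
  from exists_le_average[OF q this] obtain u where u: "u \<in> U"
    "(\<Sum>y\<in>Y. w y * of_bool (\<not> G y u) * miss y ^ M) \<le> (\<Sum>y\<in>Y. w y * miss y ^ Suc M)" ..
  obtain c where c: "\<And>j. c j \<in> U" "prob_on (\<lambda>y. w y * of_bool (\<not> G y u)) Y (\<lambda>y. \<forall>j<M. \<not> G y (c j))
      \<le> (\<Sum>y\<in>Y. w y * of_bool (\<not> G y u) * miss y ^ M)"
    using Suc.IH[of "\<lambda>y. w y * of_bool (\<not> G y u)"] Suc.prems by (auto simp: miss_def)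
  have "prob_on w Y (\<lambda>y. \<forall>j<Suc M. \<not> G y (case_nat u c j))
      = prob_on (\<lambda>y. w y * of_bool (\<not> G y u)) Y (\<lambda>y. \<forall>j<M. \<not> G y (c j))"
    unfolding prob_on_def by (intro sum.cong refl) (auto simp: All_less_Suc2)
  moreover have "case_nat u c j \<in> U" for j using c(1) u(1) by (simp split: nat.split)
  ultimately show ?case using c(2) u(2) unfolding miss_def by (intro exI[of _ "case_nat u c"]) auto
qed

lemma exp_le_chord:
  fixes x t :: real
  assumes "0 \<le> t" "t \<le> 1"
  shows "exp (t * x) \<le> (1 - t) + t * exp x"
  using convex_onD[OF exp_convex assms, of 0 x] by simp

lemma random_codebook_miss_le:
  assumes r: "is_pmf_on r U" and q: "is_pmf_on q U" and dominated: "\<And>u. u \<in> U \<Longrightarrow> G u \<Longrightarrow> a * r u \<le> q u"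
  shows "prob_on q U (\<lambda>u. \<not> G u) ^ M \<le> prob_on r U (\<lambda>u. \<not> G u) + exp (- (real M * a))"
proof -
  define t where "t = prob_on r U G"
  define h where "h = prob_on q U G"
  have t: "0 \<le> t" "t \<le> 1"
    using prob_on_nonneg[of U r G] prob_on_nonneg[of U r "\<lambda>u. \<not> G u"] is_pmf_on_nonneg[OF r]
    by (auto simp: t_def prob_on_not[OF r])
  have h: "h \<le> 1"
    using prob_on_nonneg[of U q "\<lambda>u. \<not> G u"] is_pmf_on_nonneg[OF q] by (auto simp: h_def prob_on_not[OF q])
  have "a * t \<le> h"
    unfolding h_def t_def prob_on_def sum_distrib_left using dominated by (intro sum_mono) auto
  then have ah: "real M * (a * t) \<le> real M * h" by (intro mult_left_mono) auto
  have "(1 - h) ^ M \<le> exp (- h) ^ M"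
    using h exp_ge_add_one_self[of "- h"] by (intro power_mono) auto
  also have "\<dots> \<le> exp (t * - (real M * a))"
    using ah by (simp add: mult_ac flip: exp_of_nat_mult)
  also have "\<dots> \<le> (1 - t) + t * exp (- (real M * a))" by (rule exp_le_chord[OF t])
  also have "\<dots> \<le> (1 - t) + exp (- (real M * a))" using t by (simp add: mult_left_le_one_le)
  finally show ?thesis by (simp add: t_def h_def prob_on_not[OF r] prob_on_not[OF q])
qed

lemma one_shot_covering:
  assumes p: "is_pmf_on p Y" and Q: "is_channel Q Y U" and q: "is_pmf_on q U"
  shows "\<exists>c. (\<forall>j. c j \<in> U) \<and> prob_on p Y (\<lambda>y. \<forall>j<M. \<not> G y (c j))
    \<le> prob_on (joint_law p Q) (Y \<times> U) (\<lambda>(y, u). \<not> G y u)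
      + prob_on (joint_law p Q) (Y \<times> U) (\<lambda>(y, u). q u < a * Q y u) + exp (- (real M * a))"
proof -
  define G' where "G' y u \<longleftrightarrow> G y u \<and> a * Q y u \<le> q u" for y u
  obtain c where c: "\<forall>j. c j \<in> U"
    "prob_on p Y (\<lambda>y. \<forall>j<M. \<not> G' y (c j)) \<le> (\<Sum>y\<in>Y. p y * prob_on q U (\<lambda>u. \<not> G' y u) ^ M)"
    using exists_codebook_le_random[OF q, of Y p M G'] is_pmf_on_nonneg[OF p] by blast
  have "prob_on p Y (\<lambda>y. \<forall>j<M. \<not> G y (c j)) \<le> prob_on p Y (\<lambda>y. \<forall>j<M. \<not> G' y (c j))"
    by (intro prob_on_mono is_pmf_on_nonneg[OF p]) (auto simp: G'_def)
  also note c(2)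
  also have "(\<Sum>y\<in>Y. p y * prob_on q U (\<lambda>u. \<not> G' y u) ^ M)
      \<le> (\<Sum>y\<in>Y. p y * (prob_on (Q y) U (\<lambda>u. \<not> G' y u) + exp (- (real M * a))))"
    using is_channel_pmf[OF Q] q is_pmf_on_nonneg[OF p]
    by (intro sum_mono mult_left_mono random_codebook_miss_le) (auto simp: G'_def)
  also have "\<dots> = prob_on (joint_law p Q) (Y \<times> U) (\<lambda>(y, u). \<not> G' y u) + exp (- (real M * a))"
    by (simp add: prob_on_joint_law distrib_left sum.distrib is_pmf_on_sum[OF p] flip: sum_distrib_right)
  also have "(\<lambda>(y, u). \<not> G' y u) = (\<lambda>yu. (case yu of (y, u) \<Rightarrow> \<not> G y u) \<or> (case yu of (y, u) \<Rightarrow> q u < a * Q y u))"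
    by (auto simp: fun_eq_iff G'_def not_le)
  also have "prob_on (joint_law p Q) (Y \<times> U) \<dots> \<le> prob_on (joint_law p Q) (Y \<times> U) (\<lambda>(y, u). \<not> G y u)
      + prob_on (joint_law p Q) (Y \<times> U) (\<lambda>(y, u). q u < a * Q y u)"
    using is_pmf_on_nonneg[OF is_pmf_on_joint_law[OF p Q]] by (intro prob_on_disj_le)
  finally show ?thesis using c(1) by auto
qed

lemma memoryless_covering:
  assumes p: "is_pmf_on p A" and Q: "is_channel Q A U"
  shows "\<exists>c. (\<forall>j. c j \<in> seqs l U) \<and> prob_on (iid {0..<l} p) (seqs l A) (\<lambda>y. \<forall>j<M. \<not> G y (c j))
    \<le> prob_on (iid_joint l p Q) (seqs l A \<times> seqs l U) (\<lambda>(y, u). \<not> G y u)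
      + prob_on (iid_joint l p Q) (seqs l A \<times> seqs l U)
          (\<lambda>(y, u). iid {0..<l} (output_law p Q A) u < a * memoryless {0..<l} Q y u) + exp (- (real M * a))"
proof (rule one_shot_covering)
  have "finite A" and U: "finite U"
    using is_pmf_on_finite[OF p] is_channel_finite[OF Q is_pmf_on_nonempty[OF p]] .
  then show "is_pmf_on (iid {0..<l} p) (seqs l A)" "is_pmf_on (iid {0..<l} (output_law p Q A)) (seqs l U)"
    using p is_pmf_on_output_law[OF p Q] by (auto intro: is_pmf_on_prod_law)
  show "is_channel (memoryless {0..<l} Q) (seqs l A) (seqs l U)"
    using U Q by (intro is_channel_memoryless) auto
qed

theorem source_covering:
  assumes p: "is_pmf_on p A" and Q: "is_channel Q A U" and R: "mutual_info p Q A U < R"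
    and D: "(\<Sum>au\<in>A \<times> U. joint_law p Q au * (case au of (a, u) \<Rightarrow> d a u)) < D"
  shows "\<exists>\<epsilon>. \<epsilon> \<longlonglongrightarrow> 0 \<and> (\<forall>l M. 2 powr (real l * R) \<le> real M \<longrightarrow> (\<exists>c. (\<forall>j. c j \<in> seqs l U) \<and>
    prob_on (iid {0..<l} p) (seqs l A) (\<lambda>y. \<forall>j<M. real l * D < (\<Sum>t<l. d (y t) (c j t))) \<le> \<epsilon> l))"
proof -
  define J where "J = (mutual_info p Q A U + R) / 2"
  have J: "mutual_info p Q A U < J" "J < R" using R by (auto simp: J_def)
  obtain r1 where r1: "0 \<le> r1" "r1 < 1" "\<And>l. prob_on (iid_joint l p Q) (seqs l A \<times> seqs l U)
      (\<lambda>(y, u). iid {0..<l} (output_law p Q A) u < 2 powr (- (real l * J)) * memoryless {0..<l} Q y u) \<le> r1 ^ l"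
    using memoryless_density_upper_tail[OF p Q J(1)] by blast
  obtain r2 where r2: "0 \<le> r2" "r2 < 1" "\<And>l. prob_on (iid_joint l p Q) (seqs l A \<times> seqs l U)
      (\<lambda>(y, u). real l * D \<le> (\<Sum>t<l. d (y t) (u t))) \<le> r2 ^ l"
    using memoryless_tail_bound[OF p Q D] by auto
  define \<epsilon> where "\<epsilon> l = r2 ^ l + r1 ^ l + exp (- ((2 powr (R - J)) ^ l))" for l :: nat
  have "(\<lambda>l. exp (- (b ^ l))) \<longlonglongrightarrow> 0" if "1 < b" for b :: real
    using that by real_asymp
  then have "(\<lambda>l. exp (- ((2 powr (R - J)) ^ l))) \<longlonglongrightarrow> 0"
    using J powr_less_cancel_iff[of 2 0 "R - J"] by simp
  then have "\<epsilon> \<longlonglongrightarrow> 0 + 0 + 0"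
    unfolding \<epsilon>_def using r1 r2 by (intro tendsto_add LIMSEQ_realpow_zero)
  moreover have "\<exists>c. (\<forall>j. c j \<in> seqs l U) \<and> prob_on (iid {0..<l} p) (seqs l A)
      (\<lambda>y. \<forall>j<M. real l * D < (\<Sum>t<l. d (y t) (c j t))) \<le> \<epsilon> l"
    if M: "2 powr (real l * R) \<le> real M" for l M
  proof -
    let ?a = "2 powr (- (real l * J))"
    obtain c where c: "\<forall>j. c j \<in> seqs l U" and
      uncovered: "prob_on (iid {0..<l} p) (seqs l A) (\<lambda>y. \<forall>j<M. real l * D < (\<Sum>t<l. d (y t) (c j t)))
        \<le> prob_on (iid_joint l p Q) (seqs l A \<times> seqs l U) (\<lambda>(y, u). real l * D < (\<Sum>t<l. d (y t) (u t)))
          + prob_on (iid_joint l p Q) (seqs l A \<times> seqs l U)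
              (\<lambda>(y, u). iid {0..<l} (output_law p Q A) u < ?a * memoryless {0..<l} Q y u) + exp (- (real M * ?a))"
      using memoryless_covering[OF p Q, of l M "\<lambda>y u. (\<Sum>t<l. d (y t) (u t)) \<le> real l * D" ?a]
      unfolding not_le by blast
    note uncovered
    also have "prob_on (iid_joint l p Q) (seqs l A \<times> seqs l U) (\<lambda>(y, u). real l * D < (\<Sum>t<l. d (y t) (u t)))
        \<le> prob_on (iid_joint l p Q) (seqs l A \<times> seqs l U) (\<lambda>(y, u). real l * D \<le> (\<Sum>t<l. d (y t) (u t)))"
      using is_pmf_on_nonneg[OF is_pmf_on_iid_joint[OF p Q]] by (intro prob_on_mono) auto
    also note r2(3)
    also note r1(3)
    also have "exp (- (real M * ?a)) \<le> exp (- ((2 powr (R - J)) ^ l))"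
      using M unfolding powr_diff_power by (simp add: mult_right_mono)
    finally show ?thesis using c by (intro exI[of _ c]) (simp add: \<epsilon>_def)
  qed
  ultimately show ?thesis by auto
qed

subsection \<open>Joint source-channel coding\<close>

lemma expected_decoding_cost_le:
  fixes d :: "'w \<Rightarrow> real"
  assumes V: "is_pmf_on V S" and d: "\<And>j. 0 \<le> d j" "\<And>j. d j \<le> dmax"
  shows "(\<Sum>s\<in>S. V s * d (g s)) \<le> d w + dmax * prob_on V S (\<lambda>s. g s \<noteq> w)"
proof -
  have "(\<Sum>s\<in>S. V s * d (g s)) \<le> (\<Sum>s\<in>S. V s * d w + dmax * (V s * of_bool (g s \<noteq> w)))"
  proof (rule sum_mono)
    fix s assume s: "s \<in> S"
    have "d (g s) \<le> d w + dmax * of_bool (g s \<noteq> w)" using d(1)[of w] d(2)[of "g s"] by auto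
    from mult_left_mono[OF this is_pmf_on_nonneg[OF V s]]
    show "V s * d (g s) \<le> V s * d w + dmax * (V s * of_bool (g s \<noteq> w))" by (simp add: algebra_simps)
  qed
  also have "\<dots> = d w + dmax * prob_on V S (\<lambda>s. g s \<noteq> w)"
    by (simp add: sum.distrib prob_on_def is_pmf_on_sum[OF V] flip: sum_distrib_left sum_distrib_right)
  finally show ?thesis .
qed

lemma one_shot_source_channel_coding:
  fixes d :: "'y \<Rightarrow> nat \<Rightarrow> real"
  assumes P: "is_pmf_on P Y" and V: "is_channel V X S" and M: "1 \<le> M" and \<Delta>: "0 \<le> \<Delta>"
    and d: "\<And>y j. y \<in> Y \<Longrightarrow> 0 \<le> d y j" "\<And>y j. y \<in> Y \<Longrightarrow> d y j \<le> dmax"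
    and c: "\<And>w. w \<in> {1..M} \<Longrightarrow> c w \<in> X"
    and err: "\<And>w. w \<in> {1..M} \<Longrightarrow> prob_on (V (c w)) S (\<lambda>s. g s \<noteq> w) \<le> e"
  shows "\<exists>\<phi>. (\<forall>y. \<phi> y \<in> X) \<and> (\<Sum>y\<in>Y. P y * (\<Sum>s\<in>S. V (\<phi> y) s * d y (g s)))
    \<le> \<Delta> + dmax * (prob_on P Y (\<lambda>y. \<forall>w\<in>{1..M}. \<Delta> < d y w) + e)"
proof -
  define bad where "bad y \<longleftrightarrow> (\<forall>w\<in>{1..M}. \<Delta> < d y w)" for y
  have "\<exists>w\<in>{1..M}. bad y \<or> d y w \<le> \<Delta>" for y
  proof (cases "bad y")
    case True
    then show ?thesis using M by (intro bexI[of _ 1]) auto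
  qed (auto simp: bad_def not_less)
  then obtain w where w: "\<And>y. w y \<in> {1..M}" "\<And>y. bad y \<or> d y (w y) \<le> \<Delta>" by metis
  have loss: "(\<Sum>s\<in>S. V (c (w y)) s * d y (g s)) \<le> \<Delta> + dmax * (of_bool (bad y) + e)" if y: "y \<in> Y" for y
  proof -
    have Vy: "is_pmf_on (V (c (w y))) S" by (rule is_channel_pmf[OF V c[OF w(1)]])
    have dmax: "0 \<le> dmax" using d[OF y] order_trans by blast
    have "(\<Sum>s\<in>S. V (c (w y)) s * d y (g s)) \<le> d y (w y) + dmax * prob_on (V (c (w y))) S (\<lambda>s. g s \<noteq> w y)"
      by (rule expected_decoding_cost_le[OF Vy d[OF y]])
    also have "\<dots> \<le> (\<Delta> + dmax * of_bool (bad y)) + dmax * e"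
      using w(2)[of y] d[OF y, of "w y"] \<Delta> dmax by (intro add_mono mult_left_mono err w(1)) auto
    finally show ?thesis by (simp add: algebra_simps)
  qed
  have "(\<Sum>y\<in>Y. P y * (\<Sum>s\<in>S. V (c (w y)) s * d y (g s))) \<le> (\<Sum>y\<in>Y. P y * (\<Delta> + dmax * (of_bool (bad y) + e)))"
    by (intro sum_mono mult_left_mono loss is_pmf_on_nonneg[OF P])
  also have "\<dots> = (\<Sum>y\<in>Y. P y * (\<Delta> + dmax * e) + dmax * (P y * of_bool (bad y)))"
    by (intro sum.cong refl) (simp add: algebra_simps)
  also have "\<dots> = \<Delta> + dmax * (prob_on P Y bad + e)"
    by (simp add: sum.distrib prob_on_def is_pmf_on_sum[OF P] algebra_simps flip: sum_distrib_left sum_distrib_right)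
  finally show ?thesis using c[OF w(1)] unfolding bad_def by (intro exI[of _ "\<lambda>y. c (w y)"]) auto
qed

lemma num_msgs_ge: "2 powr (real n * R) \<le> real (num_msgs n R)" and num_msgs_pos: "1 \<le> num_msgs n R"
proof -
  show "2 powr (real n * R) \<le> real (num_msgs n R)"
    unfolding num_msgs_def by (simp add: real_nat_ceiling_ge)
  moreover have "0 < 2 powr (real n * R)" by simp
  ultimately show "1 \<le> num_msgs n R" by linarith
qed

lemma num_msgs_le:
  assumes "0 \<le> R"
  shows "real (num_msgs n R) \<le> 2 * 2 powr (real n * R)"
proof -
  have "1 \<le> 2 powr (real n * R)" using assms by (intro ge_one_powr_ge_zero) auto
  then show ?thesis unfolding num_msgs_def by linarith
qed

definition mean_distortion :: "nat \<Rightarrow> ('a \<Rightarrow> real) \<Rightarrow> 'a set \<Rightarrow> ('x \<Rightarrow> 's \<Rightarrow> real) \<Rightarrow> 's set \<Rightarrow> ('a \<Rightarrow> 'u \<Rightarrow> real) \<Rightarrow>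
  ((nat \<Rightarrow> 'a) \<Rightarrow> nat \<Rightarrow> 'x) \<Rightarrow> ((nat \<Rightarrow> 's) \<Rightarrow> nat \<Rightarrow> 'u) \<Rightarrow> real" where
  "mean_distortion l p A W S d \<phi> \<psi>
    = (\<Sum>y\<in>seqs l A. iid {0..<l} p y * (\<Sum>s\<in>seqs l S. memoryless {0..<l} W (\<phi> y) s * (\<Sum>t<l. d (y t) (\<psi> s t))))"

lemma concatenated_code_distortion:
  fixes c :: "nat \<Rightarrow> nat \<Rightarrow> 'u"
  assumes p: "is_pmf_on p A" and W: "is_channel W X S" and S: "finite S" and M: "1 \<le> M" and D: "0 \<le> D"
    and d: "\<And>a u. a \<in> A \<Longrightarrow> u \<in> U \<Longrightarrow> 0 \<le> d a u" "\<And>a u. a \<in> A \<Longrightarrow> u \<in> U \<Longrightarrow> d a u \<le> dmax"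
    and x: "\<And>w. w \<in> {1..M} \<Longrightarrow> x w \<in> seqs l X"
    and err: "\<And>w. w \<in> {1..M} \<Longrightarrow> prob_on (memoryless {0..<l} W (x w)) (seqs l S) (\<lambda>s. g s \<noteq> w) \<le> e1"
    and c: "\<And>j. c j \<in> seqs l U" and dmax: "0 \<le> dmax"
    and uncovered: "prob_on (iid {0..<l} p) (seqs l A) (\<lambda>y. \<forall>j<M. real l * D < (\<Sum>t<l. d (y t) (c j t))) \<le> e2"
  shows "\<exists>\<phi> \<psi>. (\<forall>y. \<phi> y \<in> seqs l X) \<and> (\<forall>s. \<psi> s \<in> seqs l U) \<and>
    mean_distortion l p A W S d \<phi> \<psi> \<le> real l * (D + dmax * (e2 + e1))"
proof -
  define dl where "dl y w = (\<Sum>t<l. d (y t) (c (w - 1) t))" for y and w :: nat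
  have P: "is_pmf_on (iid {0..<l} p) (seqs l A)"
    using p by (auto intro: is_pmf_on_prod_law is_pmf_on_finite)
  have V: "is_channel (memoryless {0..<l} W) (seqs l X) (seqs l S)"
    using S W by (intro is_channel_memoryless) auto
  have mem: "y t \<in> A" "c j t \<in> U" if "y \<in> seqs l A" "t < l" for y t j
    using PiE_mem[OF that(1), of t] PiE_mem[OF c, of t j] that(2) by auto
  have dl: "0 \<le> dl y w" "dl y w \<le> real l * dmax" if "y \<in> seqs l A" for y w
    using d mem[OF that] sum_bounded_above[of "{..<l}" "\<lambda>t. d (y t) (c (w - 1) t)" dmax]
    by (auto simp: dl_def intro!: sum_nonneg)
  have "(\<forall>w\<in>{1..M}. real l * D < dl y w) \<longleftrightarrow> (\<forall>j<M. real l * D < (\<Sum>t<l. d (y t) (c j t)))" for y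
    unfolding dl_def image_Suc_lessThan[symmetric] by auto
  then have uncovered': "prob_on (iid {0..<l} p) (seqs l A) (\<lambda>y. \<forall>w\<in>{1..M}. real l * D < dl y w) \<le> e2"
    using uncovered by simp
  have "0 \<le> real l * D" using D by simp
  from one_shot_source_channel_coding[where d = dl and c = x, OF P V M this dl x err]
  obtain \<phi> where \<phi>: "\<forall>y. \<phi> y \<in> seqs l X"
    "(\<Sum>y\<in>seqs l A. iid {0..<l} p y * (\<Sum>s\<in>seqs l S. memoryless {0..<l} W (\<phi> y) s * dl y (g s)))
      \<le> real l * D + real l * dmax * (prob_on (iid {0..<l} p) (seqs l A) (\<lambda>y. \<forall>w\<in>{1..M}. real l * D < dl y w) + e1)"
    by blast
  note \<phi>(2)
  also have "real l * D + real l * dmax * (prob_on (iid {0..<l} p) (seqs l A) (\<lambda>y. \<forall>w\<in>{1..M}. real l * D < dl y w) + e1)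
      \<le> real l * D + real l * dmax * (e2 + e1)"
    using uncovered' dmax by (intro add_left_mono mult_left_mono) auto
  also have "\<dots> = real l * (D + dmax * (e2 + e1))" by (simp add: algebra_simps)
  finally show ?thesis
    using \<phi>(1) c unfolding dl_def mean_distortion_def by (intro exI[of _ \<phi>] exI[of _ "\<lambda>s. c (g s - 1)"]) auto
qed

lemma source_channel_codes_vanishing_excess:
  assumes p: "is_pmf_on p A" and Q: "is_channel Q A U" and p': "is_pmf_on p' X" and W: "is_channel W X S"
    and less: "mutual_info p Q A U < mutual_info p' W X S"
    and d: "\<And>a u. a \<in> A \<Longrightarrow> u \<in> U \<Longrightarrow> 0 \<le> d a u"
    and D: "(\<Sum>au\<in>A \<times> U. joint_law p Q au * (case au of (a, u) \<Rightarrow> d a u)) < D"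
  shows "\<exists>\<epsilon>. \<epsilon> \<longlonglongrightarrow> 0 \<and> (\<forall>l. \<exists>\<phi> \<psi>. (\<forall>y. \<phi> y \<in> seqs l X) \<and> (\<forall>s. \<psi> s \<in> seqs l U) \<and>
    mean_distortion l p A W S d \<phi> \<psi> \<le> real l * (D + \<epsilon> l))"
proof -
  have fin: "finite A" "finite U" "finite S"
    using is_pmf_on_finite[OF p] is_channel_finite[OF Q is_pmf_on_nonempty[OF p]]
      is_channel_finite[OF W is_pmf_on_nonempty[OF p']] .
  obtain R where R: "mutual_info p Q A U < R" "R < mutual_info p' W X S" using dense[OF less] by blast
  then have R_nonneg: "0 \<le> R" using mutual_info_nonneg[OF p Q] by simp
  have "0 \<le> (\<Sum>au\<in>A \<times> U. joint_law p Q au * (case au of (a, u) \<Rightarrow> d a u))"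
    using d is_pmf_on_nonneg[OF is_pmf_on_joint_law[OF p Q]] by (intro sum_nonneg mult_nonneg_nonneg) auto
  then have D_nonneg: "0 \<le> D" using D by simp
  define dmax where "dmax = (\<Sum>(a, u)\<in>A \<times> U. d a u)"
  have dmax: "d a u \<le> dmax" if "a \<in> A" "u \<in> U" for a u
    using member_le_sum[of "(a, u)" "A \<times> U" "\<lambda>(a, u). d a u"] d fin that by (auto simp: dmax_def)
  have dmax_nonneg: "0 \<le> dmax" unfolding dmax_def using d by (intro sum_nonneg) auto
  obtain \<epsilon>1 where \<epsilon>1: "\<epsilon>1 \<longlonglongrightarrow> 0" "\<forall>l M. real M \<le> 2 * 2 powr (real l * R) \<longrightarrow> (\<exists>x g. \<forall>w\<in>{1..M::nat}.
      x w \<in> seqs l X \<and> prob_on (memoryless {0..<l} W (x w)) (seqs l S) (\<lambda>s. g s \<noteq> w) \<le> \<epsilon>1 l)"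
    using channel_coding[OF p' W R(2)] by (elim exE conjE)
  obtain \<epsilon>2 where \<epsilon>2: "\<epsilon>2 \<longlonglongrightarrow> 0" "\<forall>l M. 2 powr (real l * R) \<le> real M \<longrightarrow> (\<exists>c. (\<forall>j. c j \<in> seqs l U) \<and>
      prob_on (iid {0..<l} p) (seqs l A) (\<lambda>y. \<forall>j<M. real l * D < (\<Sum>t<l. d (y t) (c j t))) \<le> \<epsilon>2 l)"
    using source_covering[OF p Q R(1) D] by (elim exE conjE)
  have "\<exists>\<phi> \<psi>. (\<forall>y. \<phi> y \<in> seqs l X) \<and> (\<forall>s. \<psi> s \<in> seqs l U) \<and>
    mean_distortion l p A W S d \<phi> \<psi> \<le> real l * (D + dmax * (\<epsilon>2 l + \<epsilon>1 l))" for l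
  proof -
    let ?M = "num_msgs l R"
    from \<epsilon>1(2)[rule_format, OF num_msgs_le[OF R_nonneg, of l]]
    obtain x g where xg: "\<forall>w\<in>{1..?M}. x w \<in> seqs l X \<and>
        prob_on (memoryless {0..<l} W (x w)) (seqs l S) (\<lambda>s. g s \<noteq> w) \<le> \<epsilon>1 l" by (elim exE)
    from \<epsilon>2(2)[rule_format, OF num_msgs_ge[of l R]]
    obtain c where c: "\<forall>j. c j \<in> seqs l U"
      "prob_on (iid {0..<l} p) (seqs l A) (\<lambda>y. \<forall>j<?M. real l * D < (\<Sum>t<l. d (y t) (c j t))) \<le> \<epsilon>2 l"
      by (elim exE conjE)
    show ?thesis
      using D_nonneg d dmax dmax_nonneg xg c num_msgs_pos[of l R]
      by (intro concatenated_code_distortion[OF p W fin(3), where x = x and g = g and c = c and M = ?M]) auto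
  qed
  moreover have "(\<lambda>l. dmax * (\<epsilon>2 l + \<epsilon>1 l)) \<longlonglongrightarrow> dmax * (0 + 0)" by (intro tendsto_intros \<epsilon>1(1) \<epsilon>2(1))
  ultimately show ?thesis by (intro exI[of _ "\<lambda>l. dmax * (\<epsilon>2 l + \<epsilon>1 l)"]) auto
qed

theorem source_channel_coding:
  assumes p: "is_pmf_on p A" and Q: "is_channel Q A U" and p': "is_pmf_on p' X" and W: "is_channel W X S"
    and less: "mutual_info p Q A U < mutual_info p' W X S"
    and d: "\<And>a u. a \<in> A \<Longrightarrow> u \<in> U \<Longrightarrow> 0 \<le> d a u"
    and D: "(\<Sum>au\<in>A \<times> U. joint_law p Q au * (case au of (a, u) \<Rightarrow> d a u)) < D"
  shows "\<exists>l>0. \<exists>\<phi> \<psi>. (\<forall>y. \<phi> y \<in> seqs l X) \<and> (\<forall>s. \<psi> s \<in> seqs l U) \<and>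
    mean_distortion l p A W S d \<phi> \<psi> \<le> real l * D"
proof -
  obtain D' where D': "(\<Sum>au\<in>A \<times> U. joint_law p Q au * (case au of (a, u) \<Rightarrow> d a u)) < D'" "D' < D"
    using dense[OF D] by blast
  have "\<exists>\<epsilon>. \<epsilon> \<longlonglongrightarrow> 0 \<and> (\<forall>l. \<exists>\<phi> \<psi>. (\<forall>y. \<phi> y \<in> seqs l X) \<and> (\<forall>s. \<psi> s \<in> seqs l U) \<and>
    mean_distortion l p A W S d \<phi> \<psi> \<le> real l * (D' + \<epsilon> l))"
    by (rule source_channel_codes_vanishing_excess[OF p Q p' W less _ D'(1)]) (rule d)
  then obtain \<epsilon> where \<epsilon>: "\<epsilon> \<longlonglongrightarrow> 0" and codes: "\<forall>l. \<exists>\<phi> \<psi>. (\<forall>y. \<phi> y \<in> seqs l X) \<and> (\<forall>s. \<psi> s \<in> seqs l U) \<and>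
    mean_distortion l p A W S d \<phi> \<psi> \<le> real l * (D' + \<epsilon> l)"
    by (elim exE conjE)
  have "eventually (\<lambda>l. \<epsilon> l < D - D') sequentially"
    using \<epsilon> D'(2) by (intro order_tendstoD(2)) auto
  then have "eventually (\<lambda>l. 0 < l \<and> \<epsilon> l < D - D') sequentially"
    using eventually_gt_at_top[of 0] by eventually_elim auto
  then obtain l where l: "0 < l" "\<epsilon> l < D - D'"
    using eventually_happens'[OF sequentially_bot] by blast
  from codes[rule_format, of l] obtain \<phi> \<psi> where code: "\<forall>y. \<phi> y \<in> seqs l X" "\<forall>s. \<psi> s \<in> seqs l U"
    "mean_distortion l p A W S d \<phi> \<psi> \<le> real l * (D' + \<epsilon> l)" by (elim exE conjE)
  note code(3)
  also have "real l * (D' + \<epsilon> l) \<le> real l * D" using l by (intro mult_left_mono) auto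
  finally show ?thesis using l(1) code(1,2) by blast
qed

section \<open>The single-letter entropy region\<close>

lemma continuous_on_hent:
  assumes "\<And>a. a \<in> A \<Longrightarrow> continuous_on S (\<lambda>x. f x a)" "\<And>x a. x \<in> S \<Longrightarrow> a \<in> A \<Longrightarrow> 0 \<le> f x a"
  shows "continuous_on S (\<lambda>x. hent (f x) A)"
proof -
  have plogp: "continuous_on S (\<lambda>x. plogp (g x))" if "continuous_on S g" "\<And>x. x \<in> S \<Longrightarrow> 0 \<le> g x" for g
    by (rule continuous_on_compose2[OF continuous_on_plogp that(1)]) (use that(2) in auto)
  show ?thesis
    unfolding hent_def using assms
    by (intro continuous_on_diff continuous_on_sum plogp) (auto simp: sum_nonneg)
qed

locale observation =
  fixes K :: "'y::finite \<Rightarrow> 'z \<Rightarrow> real" and Z :: "'z set"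
  assumes K: "is_channel K UNIV Z"
begin

lemma finite_Z: "finite Z"
  using is_channel_finite[OF K] by simp

definition entropy_point :: "('y \<Rightarrow> real) \<Rightarrow> (real ^ 'y) \<times> real \<times> real" where
  "entropy_point v = ((\<chi> y. v y), hent v UNIV, hent (output_law v K UNIV) Z)"

text \<open>A point \<open>(p(y), H(Y | U), H(Z | U))\<close> is realised by a finite auxiliary variable \<open>U\<close> iff it is a convex
  combination of the points \<open>entropy_point v\<close>, where \<open>v\<close> plays the role of \<open>p(y | u)\<close>.\<close>
definition entropy_region :: "((real ^ 'y) \<times> real \<times> real) set" where
  "entropy_region = convex hull (entropy_point ` {v. is_pmf_on v UNIV})"

text \<open>The homogeneous version of the region, also for unnormalised \<open>v\<close>; only lower bounds on \<open>H(Z | U)\<close>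
  matter.\<close>
definition attainable :: "('y \<Rightarrow> real) \<Rightarrow> real \<Rightarrow> real \<Rightarrow> bool" where
  "attainable v h b \<longleftrightarrow> (\<exists>g\<le>b. ((\<chi> y. v y), h, g) \<in> cone hull entropy_region)"

lemma output_law_K_nonneg: "(\<And>y. 0 \<le> v y) \<Longrightarrow> z \<in> Z \<Longrightarrow> 0 \<le> output_law v K UNIV z"
  using is_channel_nonneg[OF K] by (intro output_law_nonneg) auto

lemma entropy_point_scale:
  assumes "0 \<le> c" "\<And>y. 0 \<le> v y"
  shows "entropy_point (\<lambda>y. c * v y) = c *\<^sub>R entropy_point v"
  using assms by (simp add: entropy_point_def output_law_scale hent_scale output_law_K_nonneg vec_eq_iff)

lemma entropy_region_nonempty: "entropy_region \<noteq> {}"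
proof -
  have "is_pmf_on (\<lambda>_::'y. 1 / real (card (UNIV :: 'y set))) UNIV" by (rule is_pmf_on_uniform) auto
  then show ?thesis by (auto simp: entropy_region_def)
qed

lemma attainable_entropy_point:
  assumes v: "\<And>y. 0 \<le> v y"
  shows "attainable v (hent v UNIV) (hent (output_law v K UNIV) Z)"
proof -
  have "entropy_point v \<in> cone hull entropy_region"
  proof (cases "sum v UNIV = 0")
    case True
    then have "v = (\<lambda>y. 0 * v y)" using v by (auto simp: sum_nonneg_eq_0_iff)
    then have "entropy_point v = 0 *\<^sub>R entropy_point v" using entropy_point_scale[of 0 v] v by simp
    then show ?thesis
      using entropy_region_nonempty cone_hull_contains_0[of entropy_region] by simp
  next
    case False
    then have pos: "0 < sum v UNIV" using v by (simp add: less_le sum_nonneg)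
    define w where "w y = v y / sum v UNIV" for y
    have w: "is_pmf_on w UNIV"
      using v pos by (auto simp: is_pmf_on_def w_def simp flip: sum_divide_distrib)
    then have "entropy_point w \<in> cone hull entropy_region"
      unfolding entropy_region_def by (intro hull_inc imageI CollectI)
    moreover have "entropy_point v = sum v UNIV *\<^sub>R entropy_point w"
      using entropy_point_scale[of "sum v UNIV" w] pos is_pmf_on_nonneg[OF w] by (simp add: w_def)
    ultimately show ?thesis using pos by (simp add: mem_cone[OF cone_cone_hull])
  qed
  then show ?thesis unfolding attainable_def entropy_point_def by blast
qed

lemma attainable_mono: "attainable v h b \<Longrightarrow> b \<le> b' \<Longrightarrow> attainable v h b'"
  unfolding attainable_def using order_trans by blast

lemma attainable_scale:
  assumes "attainable v h b" "0 \<le> c"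
  shows "attainable (\<lambda>y. c * v y) (c * h) (c * b)"
proof -
  obtain g where g: "g \<le> b" "((\<chi> y. v y), h, g) \<in> cone hull entropy_region"
    using assms(1) by (auto simp: attainable_def)
  have "c *\<^sub>R ((\<chi> y. v y), h, g) \<in> cone hull entropy_region"
    by (rule mem_cone[OF cone_cone_hull g(2) assms(2)])
  moreover have "c *\<^sub>R ((\<chi> y. v y), h, g) = ((\<chi> y. c * v y), c * h, c * g)"
    by (simp add: vec_eq_iff)
  ultimately show ?thesis using g(1) assms(2) unfolding attainable_def by (metis mult_left_mono)
qed

lemma attainable_add:
  assumes "attainable v h b" "attainable v' h' b'"
  shows "attainable (\<lambda>y. v y + v' y) (h + h') (b + b')"
proof -
  obtain g g' where g: "g \<le> b" "((\<chi> y. v y), h, g) \<in> cone hull entropy_region"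
    "g' \<le> b'" "((\<chi> y. v' y), h', g') \<in> cone hull entropy_region"
    using assms by (auto simp: attainable_def)
  have "convex entropy_region" by (simp add: entropy_region_def)
  then have "convex (cone hull entropy_region)" by (rule convex_cone_hull)
  then have "((\<chi> y. v y), h, g) + ((\<chi> y. v' y), h', g') \<in> cone hull entropy_region"
    using g convex_cone[of "cone hull entropy_region"] cone_cone_hull by blast
  moreover have "((\<chi> y. v y), h, g) + ((\<chi> y. v' y), h', g') = ((\<chi> y. v y + v' y), h + h', g + g')"
    by (simp add: vec_eq_iff)
  ultimately show ?thesis using g(1,3) unfolding attainable_def by (metis add_mono)
qed

lemma attainable_sum:
  assumes "finite J" "\<And>j. j \<in> J \<Longrightarrow> attainable (v j) (h j) (b j)"
  shows "attainable (\<lambda>y. \<Sum>j\<in>J. v j y) (\<Sum>j\<in>J. h j) (\<Sum>j\<in>J. b j)"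
  using assms
proof (induction J)
  case empty
  have "attainable (\<lambda>y. 0) 0 0"
    using attainable_entropy_point[of "\<lambda>_. 0"] output_law_scale[of 0 "\<lambda>_. 0" K UNIV] by simp
  then show ?case by simp
next
  case (insert j J)
  then show ?case by (simp add: attainable_add)
qed

subsection \<open>Single-letterisation\<close>

lemma output_law_memoryless_insert:
  assumes I: "finite I" "i \<notin> I"
  shows "output_law a (memoryless (insert i I) K) (insert i I \<rightarrow>\<^sub>E UNIV) (z(i := z'))
    = (\<Sum>y\<in>UNIV. K y z' * output_law (\<lambda>x. a (x(i := y))) (memoryless I K) (I \<rightarrow>\<^sub>E UNIV) z)"
  unfolding output_law_def sum_PiE_insert[OF I(2)] memoryless_insert[OF I]
  by (simp add: sum_distrib_left mult_ac)

lemma hent_output_memoryless_insert_ge: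
  fixes a :: "('i \<Rightarrow> 'y) \<Rightarrow> real"
  assumes I: "finite I" "i \<notin> I" and a: "\<And>x. x \<in> insert i I \<rightarrow>\<^sub>E UNIV \<Longrightarrow> 0 \<le> a x"
  defines "first \<equiv> \<lambda>y. \<Sum>x\<in>I \<rightarrow>\<^sub>E UNIV. a (x(i := y))"
  shows "hent (output_law first K UNIV) Z
      + (\<Sum>y\<in>UNIV. hent (output_law (\<lambda>x. a (x(i := y))) (memoryless I K) (I \<rightarrow>\<^sub>E UNIV)) (I \<rightarrow>\<^sub>E Z))
    \<le> hent (output_law a (memoryless (insert i I) K) (insert i I \<rightarrow>\<^sub>E UNIV)) (insert i I \<rightarrow>\<^sub>E Z)"
proof -
  define rest where "rest y = output_law (\<lambda>x. a (x(i := y))) (memoryless I K) (I \<rightarrow>\<^sub>E UNIV)" for y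
  define out where "out = output_law a (memoryless (insert i I) K) (insert i I \<rightarrow>\<^sub>E UNIV)"
  have KI: "is_channel (memoryless I K) (I \<rightarrow>\<^sub>E UNIV) (I \<rightarrow>\<^sub>E Z)"
    using I finite_Z K by (intro is_channel_memoryless) auto
  have out_upd: "out (z(i := z')) = (\<Sum>y\<in>UNIV. K y z' * rest y z)" for z z'
    unfolding out_def rest_def by (rule output_law_memoryless_insert[OF I])
  have rest: "0 \<le> rest y z" if "z \<in> I \<rightarrow>\<^sub>E Z" for y z
    unfolding rest_def using a is_channel_nonneg[OF KI _ that]
    by (intro output_law_nonneg) (auto simp: PiE_fun_upd)
  have "(\<Sum>z\<in>I \<rightarrow>\<^sub>E Z. out (z(i := z'))) = output_law first K UNIV z'" for z'
  proof -
    have "(\<Sum>z\<in>I \<rightarrow>\<^sub>E Z. out (z(i := z'))) = (\<Sum>y\<in>UNIV. \<Sum>z\<in>I \<rightarrow>\<^sub>E Z. K y z' * rest y z)"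
      unfolding out_upd by (rule sum.swap)
    also have "\<dots> = (\<Sum>y\<in>UNIV. K y z' * first y)"
      by (simp add: rest_def first_def mass_output_law[OF KI] flip: sum_distrib_left)
    finally show ?thesis by (simp add: output_law_def mult.commute)
  qed
  then have chain: "hent out (insert i I \<rightarrow>\<^sub>E Z)
      = hent (output_law first K UNIV) Z + (\<Sum>z'\<in>Z. hent (\<lambda>z. out (z(i := z'))) (I \<rightarrow>\<^sub>E Z))"
    using hent_PiE_insert[OF I(2,1) finite_Z] by simp
  have "(\<Sum>y\<in>UNIV. hent (rest y) (I \<rightarrow>\<^sub>E Z)) = (\<Sum>y\<in>UNIV. \<Sum>z'\<in>Z. K y z' * hent (rest y) (I \<rightarrow>\<^sub>E Z))"
    by (simp add: is_channel_sum[OF K] flip: sum_distrib_right)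
  also have "\<dots> = (\<Sum>z'\<in>Z. \<Sum>y\<in>UNIV. K y z' * hent (rest y) (I \<rightarrow>\<^sub>E Z))" by (rule sum.swap)
  also have "\<dots> = (\<Sum>z'\<in>Z. \<Sum>y\<in>UNIV. hent (\<lambda>z. K y z' * rest y z) (I \<rightarrow>\<^sub>E Z))"
    using rest is_channel_nonneg[OF K] by (intro sum.cong refl hent_scale[symmetric]) auto
  also have "\<dots> \<le> (\<Sum>z'\<in>Z. hent (\<lambda>z. out (z(i := z'))) (I \<rightarrow>\<^sub>E Z))"
    unfolding out_upd using rest is_channel_nonneg[OF K] I finite_Z
    by (intro sum_mono hent_superadditive mult_nonneg_nonneg) (auto intro: finite_PiE)
  finally show ?thesis using chain by (simp add: rest_def out_def)
qed

lemma sum_pushforward_coordinates_insert: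
  fixes a :: "('i \<Rightarrow> 'y) \<Rightarrow> real"
  assumes I: "finite I" "i \<notin> I"
  shows "(\<Sum>j\<in>insert i I. pushforward (\<lambda>x. x j) a (insert i I \<rightarrow>\<^sub>E UNIV) y')
    = (\<Sum>x\<in>I \<rightarrow>\<^sub>E UNIV. a (x(i := y')))
      + (\<Sum>y\<in>UNIV. \<Sum>j\<in>I. pushforward (\<lambda>x. x j) (\<lambda>x. a (x(i := y))) (I \<rightarrow>\<^sub>E UNIV) y')"
proof -
  have "pushforward (\<lambda>x. x i) a (insert i I \<rightarrow>\<^sub>E UNIV) y'
      = (\<Sum>y\<in>UNIV. (\<Sum>x\<in>I \<rightarrow>\<^sub>E UNIV. a (x(i := y))) * of_bool (y = y'))"
    using I by (simp add: pushforward_def prob_on_def sum_PiE_insert sum_distrib_right)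
  moreover have "(\<Sum>y\<in>UNIV. pushforward (\<lambda>x. x j) (\<lambda>x. a (x(i := y))) (I \<rightarrow>\<^sub>E UNIV) y')
      = pushforward (\<lambda>x. x j) a (insert i I \<rightarrow>\<^sub>E UNIV) y'" if "j \<in> I" for j
    using I that by (auto simp: pushforward_def prob_on_def sum_PiE_insert intro!: sum.cong)
  ultimately show ?thesis using I by (simp add: sum.swap[of _ I])
qed

text \<open>For \<open>a\<close> the law of \<open>Y\<^sup>n\<close> jointly with a fixed value of \<open>S\<^sup>n\<close>, peeling off one coordinate at a time
  corresponds to the auxiliary variables \<open>U\<^sub>i = (S\<^sup>n, Y\<close> at the coordinates peeled off before\<open>)\<close>.\<close>
lemma attainable_single_letter:
  assumes "finite I" and "\<And>x. x \<in> I \<rightarrow>\<^sub>E UNIV \<Longrightarrow> 0 \<le> a x"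
  shows "attainable (\<lambda>y. \<Sum>i\<in>I. pushforward (\<lambda>x. x i) a (I \<rightarrow>\<^sub>E UNIV) y) (hent a (I \<rightarrow>\<^sub>E UNIV))
    (hent (output_law a (memoryless I K) (I \<rightarrow>\<^sub>E UNIV)) (I \<rightarrow>\<^sub>E Z))"
  using assms
proof (induction I arbitrary: a rule: finite_induct)
  case empty
  have "attainable (\<lambda>y. \<Sum>i\<in>({}::'b set). 0) 0 0" using attainable_sum[of "{}"] by simp
  then show ?case by (simp add: hent_def)
next
  case (insert i I)
  define rest where "rest y x = a (x(i := y))" for y x
  define first where "first y = (\<Sum>x\<in>I \<rightarrow>\<^sub>E UNIV. rest y x)" for y
  have rest: "0 \<le> rest y x" if "x \<in> I \<rightarrow>\<^sub>E UNIV" for y x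
    unfolding rest_def by (intro insert.prems PiE_fun_upd that) simp
  have "attainable (\<lambda>y'. first y' + (\<Sum>y\<in>UNIV. \<Sum>j\<in>I. pushforward (\<lambda>x. x j) (rest y) (I \<rightarrow>\<^sub>E UNIV) y'))
      (hent first UNIV + (\<Sum>y\<in>UNIV. hent (rest y) (I \<rightarrow>\<^sub>E UNIV)))
      (hent (output_law first K UNIV) Z
        + (\<Sum>y\<in>UNIV. hent (output_law (rest y) (memoryless I K) (I \<rightarrow>\<^sub>E UNIV)) (I \<rightarrow>\<^sub>E Z)))"
    using rest insert.IH
    by (intro attainable_add attainable_entropy_point attainable_sum) (auto simp: first_def intro: sum_nonneg)
  moreover have "first y' + (\<Sum>y\<in>UNIV. \<Sum>j\<in>I. pushforward (\<lambda>x. x j) (rest y) (I \<rightarrow>\<^sub>E UNIV) y')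
      = (\<Sum>j\<in>insert i I. pushforward (\<lambda>x. x j) a (insert i I \<rightarrow>\<^sub>E UNIV) y')" for y'
    unfolding first_def rest_def[abs_def] by (rule sum_pushforward_coordinates_insert[OF insert.hyps, symmetric])
  moreover have "hent (output_law first K UNIV) Z
      + (\<Sum>y\<in>UNIV. hent (output_law (rest y) (memoryless I K) (I \<rightarrow>\<^sub>E UNIV)) (I \<rightarrow>\<^sub>E Z))
    \<le> hent (output_law a (memoryless (insert i I) K) (insert i I \<rightarrow>\<^sub>E UNIV)) (insert i I \<rightarrow>\<^sub>E Z)"
    unfolding first_def[abs_def] rest_def[abs_def]
    by (rule hent_output_memoryless_insert_ge[OF insert.hyps]) (rule insert.prems)
  moreover have "hent a (insert i I \<rightarrow>\<^sub>E UNIV) = hent first UNIV + (\<Sum>y\<in>UNIV. hent (rest y) (I \<rightarrow>\<^sub>E UNIV))"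
    using hent_PiE_insert[OF insert.hyps(2,1), of UNIV a] by (simp add: first_def[abs_def] rest_def[abs_def])
  ultimately show ?case by (simp only: attainable_mono)
qed

subsection \<open>Test channels\<close>

lemma entropy_region_mass: "x \<in> entropy_region \<Longrightarrow> (\<Sum>y\<in>UNIV. fst x $ y) = 1"
proof -
  have "linear (\<lambda>x :: (real ^ 'y) \<times> real \<times> real. \<Sum>y\<in>UNIV. fst x $ y)"
    by (intro linearI) (auto simp: sum.distrib sum_distrib_left)
  then have "convex {x :: (real ^ 'y) \<times> real \<times> real. (\<Sum>y\<in>UNIV. fst x $ y) = 1}"
    using convex_linear_vimage[of "\<lambda>x :: (real ^ 'y) \<times> real \<times> real. \<Sum>y\<in>UNIV. fst x $ y" "{1}"]
    by (simp add: vimage_def)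
  then have "entropy_region \<subseteq> {x. (\<Sum>y\<in>UNIV. fst x $ y) = 1}"
    unfolding entropy_region_def by (intro hull_minimal) (auto simp: entropy_point_def is_pmf_on_sum)
  then show "x \<in> entropy_region \<Longrightarrow> (\<Sum>y\<in>UNIV. fst x $ y) = 1" by blast
qed

lemma attainable_in_region:
  assumes "attainable p h b" and p: "is_pmf_on p UNIV"
  shows "\<exists>g\<le>b. ((\<chi> y. p y), h, g) \<in> entropy_region"
proof -
  obtain g c x where g: "g \<le> b" "((\<chi> y. p y), h, g) = c *\<^sub>R x" "x \<in> entropy_region"
    using assms(1) unfolding attainable_def cone_hull_expl by blast
  have "1 = (\<Sum>y\<in>UNIV. fst ((\<chi> y. p y), h, g) $ y)" using p by (simp add: is_pmf_on_sum)
  also have "\<dots> = c" unfolding g(2) using entropy_region_mass[OF g(3)] by (simp flip: sum_distrib_left)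
  finally show ?thesis using g by auto
qed

lemma compact_entropy_region: "compact entropy_region"
proof -
  define S where "S = cbox 0 (\<chi> y. 1) \<inter> {x::real^'y. (\<Sum>y\<in>UNIV. x $ y) = 1}"
  have "compact S"
    unfolding S_def by (intro compact_Int_closed compact_cbox closed_Collect_eq continuous_intros)
  have S: "x \<in> S \<longleftrightarrow> is_pmf_on (\<lambda>y. x $ y) UNIV" for x
    using member_le_sum[of _ UNIV "\<lambda>y. x $ y"] by (auto simp: S_def mem_box_cart is_pmf_on_def)
  have "entropy_point ` {v. is_pmf_on v UNIV} = (\<lambda>x. entropy_point (\<lambda>y. x $ y)) ` S"
  proof (intro equalityI subsetI)
    fix w assume "w \<in> entropy_point ` {v. is_pmf_on v UNIV}"
    then obtain v where "is_pmf_on v UNIV" "w = entropy_point v" by auto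
    then show "w \<in> (\<lambda>x. entropy_point (\<lambda>y. x $ y)) ` S"
      by (intro rev_image_eqI[of "\<chi> y. v y"]) (auto simp: S)
  qed (auto simp: S)
  moreover have "continuous_on S (\<lambda>x. entropy_point (\<lambda>y. x $ y))"
    unfolding entropy_point_def output_law_def[abs_def]
    using is_channel_nonneg[OF K]
    by (intro continuous_on_Pair continuous_on_hent continuous_intros sum_nonneg mult_nonneg_nonneg)
      (auto simp: S dest: is_pmf_on_nonneg)
  ultimately show ?thesis unfolding entropy_region_def using \<open>compact S\<close>
    by (simp add: compact_convex_hull compact_continuous_image)
qed

text \<open>The points \<open>entropy_point v\<close> lie in a hyperplane of a space of dimension \<open>|Y| + 2\<close>.\<close>
lemma entropy_region_representation:
  assumes x: "x \<in> entropy_region"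
  obtains k w v where "k \<le> CARD('y) + 2" "is_pmf_on w {0..<k}"
    "\<And>j. j < k \<Longrightarrow> is_pmf_on (v j) UNIV" "(\<Sum>j\<in>{0..<k::nat}. w j *\<^sub>R entropy_point (v j)) = x"
proof -
  let ?P = "entropy_point ` {v. is_pmf_on v UNIV}"
  define e :: "(real ^ 'y) \<times> real \<times> real" where "e = ((\<chi> y. 1), 0, 0)"
  have "e \<noteq> 0" by (auto simp: e_def zero_prod_def vec_eq_iff)
  have "?P \<subseteq> {x. e \<bullet> x = 1}"
    by (auto simp: e_def entropy_point_def is_pmf_on_def inner_vec_def)
  then have "aff_dim ?P \<le> aff_dim {x. e \<bullet> x = 1}" by (rule aff_dim_subset)
  also have "\<dots> = int (CARD('y)) + 1" using \<open>e \<noteq> 0\<close> by simp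
  finally have dim: "aff_dim ?P \<le> int (CARD('y)) + 1" .
  obtain S where S: "finite S" "S \<subseteq> ?P" "int (card S) \<le> aff_dim ?P + 1" "x \<in> convex hull S"
    using x unfolding entropy_region_def caratheodory_aff_dim[of ?P] by auto
  then obtain w where w: "\<And>s. s \<in> S \<Longrightarrow> 0 \<le> w s" "sum w S = 1" "(\<Sum>s\<in>S. w s *\<^sub>R s) = x"
    by (auto simp: convex_hull_finite)
  obtain s where s: "bij_betw s {0..<card S} S" using ex_bij_betw_nat_finite[OF S(1)] by blast
  have sS: "s j \<in> S" if "j < card S" for j using s that by (auto simp: bij_betw_def)
  then have "\<forall>j\<in>{0..<card S}. \<exists>v. is_pmf_on v UNIV \<and> s j = entropy_point v" using S(2) by fastforce
  then obtain v where v: "\<And>j. j < card S \<Longrightarrow> is_pmf_on (v j) UNIV" "\<And>j. j < card S \<Longrightarrow> s j = entropy_point (v j)"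
    by (metis atLeastLessThan_iff zero_le)
  show ?thesis
  proof (rule that[of "card S" "\<lambda>j. w (s j)" v])
    show "card S \<le> CARD('y) + 2" using S(3) dim by simp
    show "is_pmf_on (\<lambda>j. w (s j)) {0..<card S}"
      using w(1,2) sS sum.reindex_bij_betw[OF s, of w] by (simp add: is_pmf_on_def)
    show "(\<Sum>j\<in>{0..<card S}. w (s j) *\<^sub>R entropy_point (v j)) = x"
      using v(2) w(3) sum.reindex_bij_betw[OF s, of "\<lambda>s. w s *\<^sub>R s"] by simp
  qed (fact v(1))
qed

lemma exists_test_channel:
  assumes p: "is_pmf_on p UNIV" and region: "((\<chi> y. p y), h, b) \<in> entropy_region"
  shows "\<exists>k\<le>CARD('y) + 2. \<exists>Q. is_channel Q UNIV {0..<k} \<and> mutual_info p Q UNIV {0..<k} = ent p UNIV - h \<and>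
    (\<Sum>u\<in>{0..<k}. hent (output_law (\<lambda>y. p y * Q y u) K UNIV) Z) = b"
proof -
  obtain k w v where k: "k \<le> CARD('y) + 2" and w: "is_pmf_on w {0..<k}" and v: "\<And>j. j < k \<Longrightarrow> is_pmf_on (v j) UNIV"
    and x: "(\<Sum>j\<in>{0..<k::nat}. w j *\<^sub>R entropy_point (v j)) = ((\<chi> y. p y), h, b)"
    using entropy_region_representation[OF region] by blast
  have rp: "(\<Sum>j\<in>{0..<k}. w j * v j y) = p y" for y
    using arg_cong[OF x, of "\<lambda>x. fst x $ y"] by (simp add: entropy_point_def fst_sum)
  have rh: "(\<Sum>j\<in>{0..<k}. w j * hent (v j) UNIV) = h"
    using arg_cong[OF x, of "\<lambda>x. fst (snd x)"] by (simp add: entropy_point_def fst_sum snd_sum)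
  have rb: "(\<Sum>j\<in>{0..<k}. w j * hent (output_law (v j) K UNIV) Z) = b"
    using arg_cong[OF x, of "\<lambda>x. snd (snd x)"] by (simp add: entropy_point_def snd_sum)
  have wv: "0 \<le> w j" "0 \<le> v j y" if "j < k" for j y
    using that is_pmf_on_nonneg[OF w, of j] is_pmf_on_nonneg[OF v, of j y] by auto
  define Q where "Q y j = (if p y = 0 then w j else w j * v j y / p y)" for y j
  have pQ: "p y * Q y j = w j * v j y" if "j < k" for y j
  proof (cases "p y = 0")
    case True
    then have "(\<Sum>j\<in>{0..<k}. w j * v j y) = 0" using rp by simp
    then have "w j * v j y = 0" using that wv by (subst (asm) sum_nonneg_eq_0_iff) auto
    then show ?thesis using True by simp
  qed (simp add: Q_def)
  have Q: "is_channel Q UNIV {0..<k}"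
  proof (rule is_channelI)
    show "is_pmf_on (Q y) {0..<k}" for y
      using w wv is_pmf_on_nonneg[OF p, of y] rp[of y]
      by (cases "p y = 0") (auto simp: is_pmf_on_def Q_def simp flip: sum_divide_distrib)
  qed
  have pQ': "(\<lambda>y. p y * Q y j) = (\<lambda>y. w j * v j y)" if "j < k" for j using pQ[OF that] by auto
  have "mutual_info p Q UNIV {0..<k} = ent p UNIV - h"
    using wv rh by (simp add: mutual_info_equivocation[OF p Q] pQ' hent_scale)
  moreover have "(\<Sum>u\<in>{0..<k}. hent (output_law (\<lambda>y. p y * Q y u) K UNIV) Z) = b"
    using wv rb by (simp add: pQ' output_law_scale hent_scale output_law_K_nonneg)
  ultimately show ?thesis using k Q by blast
qed

lemma attainable_test_channel:
  assumes p: "is_pmf_on p UNIV" and Q: "is_channel Q UNIV U"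
  shows "attainable p (ent p UNIV - mutual_info p Q UNIV U) (\<Sum>u\<in>U. hent (output_law (\<lambda>y. p y * Q y u) K UNIV) Z)"
proof -
  have "attainable (\<lambda>y. \<Sum>u\<in>U. p y * Q y u) (\<Sum>u\<in>U. hent (\<lambda>y. p y * Q y u) UNIV)
      (\<Sum>u\<in>U. hent (output_law (\<lambda>y. p y * Q y u) K UNIV) Z)"
    using is_channel_finite[OF Q] is_pmf_on_nonneg[OF p] is_channel_nonneg[OF Q]
    by (intro attainable_sum attainable_entropy_point) auto
  then show ?thesis
    by (simp add: mutual_info_equivocation[OF p Q] is_channel_sum[OF Q] flip: sum_distrib_left)
qed

lemma exists_optimal_test_channel:
  assumes p: "is_pmf_on p UNIV" and r: "0 \<le> r"
  shows "\<exists>k\<le>CARD('y) + 2. \<exists>Q. is_channel Q UNIV {0..<k} \<and> mutual_info p Q UNIV {0..<k} \<le> r \<and>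
    (\<forall>h b. attainable p h b \<longrightarrow> ent p UNIV - r \<le> h \<longrightarrow>
      (\<Sum>u\<in>{0..<k}. hent (output_law (\<lambda>y. p y * Q y u) K UNIV) Z) \<le> b)"
proof -
  define C where "C = entropy_region \<inter> ({x. fst x = (\<chi> y. p y)} \<inter> {x. ent p UNIV - r \<le> fst (snd x)})"
  have "compact C"
    unfolding C_def
    by (intro compact_Int_closed compact_entropy_region closed_Int closed_Collect_eq closed_Collect_le
        continuous_intros)
  moreover have "entropy_point p \<in> C"
    using p r by (auto simp: C_def entropy_region_def entropy_point_def hent_pmf intro!: hull_inc)
  moreover have "continuous_on C (\<lambda>x. snd (snd x))" by (intro continuous_intros)
  ultimately obtain x where x: "x \<in> C" "\<And>y. y \<in> C \<Longrightarrow> snd (snd x) \<le> snd (snd y)"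
    using continuous_attains_inf[of C "\<lambda>x. snd (snd x)"] by blast
  obtain h b where hb: "x = ((\<chi> y. p y), h, b)" "x \<in> entropy_region" "ent p UNIV - r \<le> h"
    using x(1) by (cases x) (auto simp: C_def)
  have "b \<le> b'" if "attainable p h' b'" "ent p UNIV - r \<le> h'" for h' b'
  proof -
    obtain g where "g \<le> b'" "((\<chi> y. p y), h', g) \<in> entropy_region"
      using attainable_in_region[OF \<open>attainable p h' b'\<close> p] by blast
    then show ?thesis using x(2)[of "((\<chi> y. p y), h', g)"] that(2) hb(1) by (simp add: C_def)
  qed
  then show ?thesis using exists_test_channel[OF p, of h b] hb by force
qed

text \<open>Erasing \<open>U\<close> with probability \<open>c\<close> makes the rate constraint strict.\<close>
lemma exists_erased_test_channel:
  assumes p: "is_pmf_on p UNIV" and Q: "is_channel Q UNIV U" and c: "0 \<le> c" "c \<le> 1"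
  shows "\<exists>k Q'. is_channel Q' UNIV {0..<k::nat} \<and> mutual_info p Q' UNIV {0..<k} = (1 - c) * mutual_info p Q UNIV U \<and>
    (\<Sum>u\<in>{0..<k}. hent (output_law (\<lambda>y. p y * Q' y u) K UNIV) Z)
      \<le> (1 - c) * (\<Sum>u\<in>U. hent (output_law (\<lambda>y. p y * Q y u) K UNIV) Z) + c * hent (output_law p K UNIV) Z"
proof -
  have "attainable (\<lambda>y. (1 - c) * p y + c * p y) ((1 - c) * (ent p UNIV - mutual_info p Q UNIV U) + c * ent p UNIV)
      ((1 - c) * (\<Sum>u\<in>U. hent (output_law (\<lambda>y. p y * Q y u) K UNIV) Z) + c * hent (output_law p K UNIV) Z)"
    using c attainable_entropy_point[of p] is_pmf_on_nonneg[OF p]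
    by (intro attainable_add attainable_scale attainable_test_channel p Q) (auto simp: hent_pmf[OF p])
  then have "attainable p (ent p UNIV - (1 - c) * mutual_info p Q UNIV U)
      ((1 - c) * (\<Sum>u\<in>U. hent (output_law (\<lambda>y. p y * Q y u) K UNIV) Z) + c * hent (output_law p K UNIV) Z)"
    by (simp add: algebra_simps)
  from attainable_in_region[OF this p] obtain g where "g \<le> (1 - c) * (\<Sum>u\<in>U. hent (output_law (\<lambda>y. p y * Q y u) K UNIV) Z)
      + c * hent (output_law p K UNIV) Z" "((\<chi> y. p y), ent p UNIV - (1 - c) * mutual_info p Q UNIV U, g) \<in> entropy_region"
    by blast
  then show ?thesis using exists_test_channel[OF p] by fastforce
qed

end

section \<open>Fano's inequality for additive noise\<close>

definition output_message_law :: "('z \<Rightarrow> real) \<Rightarrow> 'z set \<Rightarrow> (nat \<Rightarrow> 'z \<Rightarrow> 'z) \<Rightarrow> nat \<Rightarrow> 'z \<times> nat \<Rightarrow> real" where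
  "output_message_law N Z \<sigma> M = (\<lambda>(y, w). N (inv_into Z (\<sigma> w) y) / real M)"

context
  fixes N :: "'z \<Rightarrow> real" and Z :: "'z set" and \<sigma> :: "nat \<Rightarrow> 'z \<Rightarrow> 'z" and M :: nat
  assumes Z: "finite Z" and N: "\<And>z. z \<in> Z \<Longrightarrow> 0 \<le> N z" and M: "1 \<le> M"
    and \<sigma>: "\<And>w. w \<in> {1..M} \<Longrightarrow> bij_betw (\<sigma> w) Z Z"
begin

lemma output_message_law_nonneg: "y \<in> Z \<Longrightarrow> w \<in> {1..M} \<Longrightarrow> 0 \<le> output_message_law N Z \<sigma> M (y, w)"
  using N[OF inv_into_into[of y "\<sigma> w" Z]] bij_betw_imp_surj_on[OF \<sigma>, of w]
  by (simp add: output_message_law_def)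

lemma output_message_law_shift:
  "w \<in> {1..M} \<Longrightarrow> z \<in> Z \<Longrightarrow> output_message_law N Z \<sigma> M (\<sigma> w z, w) = 1 / real M * N z"
  using bij_betw_inv_into_left[OF \<sigma>] by (simp add: output_message_law_def)

lemma sum_output_message_law:
  assumes w: "w \<in> {1..M}"
  shows "(\<Sum>y\<in>Z. output_message_law N Z \<sigma> M (y, w) * F y) = (\<Sum>z\<in>Z. N z * F (\<sigma> w z)) / real M"
  unfolding sum.reindex_bij_betw[OF \<sigma>[OF w], of "\<lambda>y. output_message_law N Z \<sigma> M (y, w) * F y", symmetric]
  using output_message_law_shift[OF w] by (simp add: sum_divide_distrib)

lemma hent_output_message_law:
  "hent (output_message_law N Z \<sigma> M) (Z \<times> {1..M}) = sum N Z * log 2 (real M) + hent N Z"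
proof -
  let ?P = "output_message_law N Z \<sigma> M"
  have "hent (\<lambda>y. ?P (y, w)) Z = 1 / real M * hent N Z" if w: "w \<in> {1..M}" for w
  proof -
    have "hent (\<lambda>y. ?P (y, w)) (\<sigma> w ` Z) = hent (\<lambda>z. ?P (\<sigma> w z, w)) Z"
      using bij_betw_imp_inj_on[OF \<sigma>[OF w]] by (rule hent_reindex)
    also have "\<dots> = hent (\<lambda>z. 1 / real M * N z) Z" by (intro hent_cong output_message_law_shift w)
    also have "\<dots> = 1 / real M * hent N Z" using N by (intro hent_scale) auto
    finally show ?thesis by (simp add: bij_betw_imp_surj_on[OF \<sigma>[OF w]])
  qed
  moreover have "hent (\<lambda>w. \<Sum>y\<in>Z. ?P (y, w)) {1..M} = sum N Z * log 2 (real M)"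
  proof -
    have "hent (\<lambda>w. \<Sum>y\<in>Z. ?P (y, w)) {1..M} = hent (\<lambda>_. sum N Z / real M) {1..M}"
      using sum_output_message_law[of _ "\<lambda>_. 1"] by (intro hent_cong) simp
    then show ?thesis using M N by (simp add: hent_const sum_nonneg)
  qed
  ultimately show ?thesis
    using hent_chain_swap[of Z "{1..M}" ?P] Z M by simp
qed

lemma fano_additive_noise_weights:
  "sum N Z * log 2 (real M) + hent N Z
    \<le> sum N Z * log 2 (real (card Z)) + sum N Z
      + (\<Sum>w\<in>{1..M}. prob_on N Z (\<lambda>z. g (\<sigma> w z) \<noteq> w)) / real M * log 2 (real M)"
proof -
  let ?P = "output_message_law N Z \<sigma> M"
  have total: "(\<Sum>y\<in>Z. \<Sum>w\<in>{1..M}. ?P (y, w) * F y w) = (\<Sum>w\<in>{1..M}. \<Sum>z\<in>Z. N z * F (\<sigma> w z) w) / real M" for F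
    using sum_output_message_law by (subst sum.swap) (simp add: sum_divide_distrib)
  have "hent ?P (Z \<times> {1..M}) = hent (\<lambda>y. \<Sum>w\<in>{1..M}. ?P (y, w)) Z + (\<Sum>y\<in>Z. hent (\<lambda>w. ?P (y, w)) {1..M})"
    using Z by (intro hent_chain) auto
  also have "\<dots> \<le> (\<Sum>y\<in>Z. \<Sum>w\<in>{1..M}. ?P (y, w)) * log 2 (real (card Z))
      + (\<Sum>y\<in>Z. (\<Sum>w\<in>{1..M}. ?P (y, w)) + prob_on (\<lambda>w. ?P (y, w)) {1..M} (\<lambda>w. g y \<noteq> w) * log 2 (real M))"
  proof (intro add_mono sum_mono)
    show "hent (\<lambda>y. \<Sum>w\<in>{1..M}. ?P (y, w)) Z \<le> (\<Sum>y\<in>Z. \<Sum>w\<in>{1..M}. ?P (y, w)) * log 2 (real (card Z))"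
      using Z output_message_law_nonneg by (intro hent_le_log_card sum_nonneg)
    show "hent (\<lambda>w. ?P (y, w)) {1..M}
        \<le> (\<Sum>w\<in>{1..M}. ?P (y, w)) + prob_on (\<lambda>w. ?P (y, w)) {1..M} (\<lambda>w. g y \<noteq> w) * log 2 (real M)"
      if "y \<in> Z" for y
      using fano_inequality[of "{1..M}" "\<lambda>w. ?P (y, w)" "g y"] output_message_law_nonneg[OF that] by simp
  qed
  also have "\<dots> = sum N Z * log 2 (real (card Z)) + (sum N Z
      + (\<Sum>w\<in>{1..M}. prob_on N Z (\<lambda>z. g (\<sigma> w z) \<noteq> w)) / real M * log 2 (real M))"
    using total[of "\<lambda>_ _. 1"] total[of "\<lambda>y w. of_bool (g y \<noteq> w)"] M
    by (simp add: prob_on_def sum.distrib flip: sum_distrib_right)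
  finally show ?thesis unfolding hent_output_message_law by simp
qed

end

lemma fano_additive_noise:
  fixes g :: "'z \<Rightarrow> 's \<Rightarrow> nat"
  assumes N: "is_pmf_on N (Z \<times> S)" and M: "1 \<le> M" and \<sigma>: "\<And>w. w \<in> {1..M} \<Longrightarrow> bij_betw (\<sigma> w) Z Z"
  defines "e \<equiv> (\<Sum>w\<in>{1..M}. prob_on N (Z \<times> S) (\<lambda>(z, s). g (\<sigma> w z) s \<noteq> w)) / real M"
  shows "(1 - e) * log 2 (real M) - 1 \<le> log 2 (real (card Z)) - (\<Sum>s\<in>S. hent (\<lambda>z. N (z, s)) Z)"
proof -
  have Z: "finite Z"
    using is_pmf_on_finite[OF N] is_pmf_on_nonempty[OF N] by (auto simp: finite_cartesian_product_iff)
  define NS where "NS s = (\<Sum>z\<in>Z. N (z, s))" for s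
  define es where "es s = (\<Sum>w\<in>{1..M}. prob_on (\<lambda>z. N (z, s)) Z (\<lambda>z. g (\<sigma> w z) s \<noteq> w)) / real M" for s
  have "NS s * log 2 (real M) + hent (\<lambda>z. N (z, s)) Z
      \<le> NS s * log 2 (real (card Z)) + NS s + es s * log 2 (real M)" if s: "s \<in> S" for s
    unfolding NS_def es_def using is_pmf_on_nonneg[OF N] s
    by (intro fano_additive_noise_weights Z M \<sigma>) auto
  then have "(\<Sum>s\<in>S. NS s * log 2 (real M) + hent (\<lambda>z. N (z, s)) Z)
      \<le> (\<Sum>s\<in>S. NS s * log 2 (real (card Z)) + NS s + es s * log 2 (real M))"
    by (rule sum_mono)
  moreover have "sum NS S = 1" unfolding NS_def by (rule sum_second_marginal[OF N])
  moreover have "sum es S = e"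
  proof -
    have "prob_on N (Z \<times> S) (\<lambda>(z, s). g (\<sigma> w z) s \<noteq> w)
        = (\<Sum>s\<in>S. prob_on (\<lambda>z. N (z, s)) Z (\<lambda>z. g (\<sigma> w z) s \<noteq> w))" for w
      unfolding prob_on_def sum.cartesian_product' by (subst sum.swap) simp
    then show ?thesis
      unfolding e_def es_def sum_divide_distrib[symmetric] by (subst sum.swap) simp
  qed
  ultimately show ?thesis
    by (simp add: sum.distrib algebra_simps flip: sum_distrib_right)
qed

section \<open>The modulo-sum relay channel\<close>

subsection \<open>Modular shifts of sequences\<close>

definition shift_mod :: "nat \<Rightarrow> nat \<Rightarrow> (nat \<Rightarrow> nat) \<Rightarrow> (nat \<Rightarrow> nat) \<Rightarrow> nat \<Rightarrow> nat" where
  "shift_mod m n c z = (\<lambda>i\<in>{0..<n}. (c i + z i) mod m)"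

lemma shift_mod_commute: "shift_mod m n c z = shift_mod m n z c"
  by (simp add: shift_mod_def add.commute)

lemma shift_mod_shift_mod: "shift_mod m n c (shift_mod m n d z) = shift_mod m n (\<lambda>i. c i + d i) z"
  by (auto simp: shift_mod_def fun_eq_iff mod_simps add_ac)

lemma shift_mod_eq_self:
  assumes "z \<in> seqs n {0..<m}" "\<And>i. c i mod m = 0"
  shows "shift_mod m n c z = z"
proof
  fix i
  have "(c i + z i) mod m = z i mod m" using assms(2)[of i] by (metis add_0 mod_add_left_eq)
  then show "shift_mod m n c z i = z i" using assms(1) by (auto simp: shift_mod_def PiE_iff extensional_def)
qed

lemma bij_betw_shift_mod:
  assumes "0 < m"
  shows "bij_betw (shift_mod m n c) (seqs n {0..<m}) (seqs n {0..<m})"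
proof (rule bij_betw_byWitness[where f' = "shift_mod m n (\<lambda>i. m - c i mod m)"])
  have "(m - a mod m + a) mod m = 0" for a
    using mod_less_divisor[OF assms, of a] by (metis le_add_diff_inverse2 less_imp_le mod_add_right_eq mod_self)
  then show "\<forall>z\<in>seqs n {0..<m}. shift_mod m n (\<lambda>i. m - c i mod m) (shift_mod m n c z) = z"
    "\<forall>z\<in>seqs n {0..<m}. shift_mod m n c (shift_mod m n (\<lambda>i. m - c i mod m) z) = z"
    by (simp_all add: shift_mod_shift_mod shift_mod_eq_self add.commute)
qed (use assms in \<open>auto simp: shift_mod_def\<close>)

lemma card_seqs: "card (seqs n {0..<m}) = m ^ n"
  by (simp add: card_PiE)

subsection \<open>The joint law of the noise and the relay output\<close>

locale modsum_relay =
  fixes m :: nat and pz :: "nat \<Rightarrow> real"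
    and W1 :: "nat \<Rightarrow> 'y1::finite \<Rightarrow> real" and Wr :: "'x1::finite \<Rightarrow> 's::finite \<Rightarrow> real"
  assumes m_ge_2: "2 \<le> m" and pz: "is_pmf_on pz {0..<m}"
    and W1: "is_channel W1 {0..<m} UNIV" and Wr: "is_channel Wr UNIV UNIV"
begin

abbreviation pY :: "'y1 \<Rightarrow> real" where "pY \<equiv> pY1 m pz W1"

text \<open>The backward channel \<open>p(z | y\<^sub>1)\<close>, uniform where \<open>p(y\<^sub>1) = 0\<close> so that it is always stochastic.\<close>
definition backward :: "'y1 \<Rightarrow> nat \<Rightarrow> real" where
  "backward y z = (if pY y = 0 then 1 / real m else pz z * W1 z y / pY y)"

lemma pY_eq_output_law: "pY = output_law pz W1 {0..<m}"
  by (simp add: fun_eq_iff pY1_def output_law_def lessThan_atLeast0)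

lemma pY: "is_pmf_on pY UNIV"
  unfolding pY_eq_output_law by (rule is_pmf_on_output_law[OF pz W1])

lemma pY_mult_backward:
  assumes z: "z \<in> {0..<m}"
  shows "pY y * backward y z = pz z * W1 z y"
proof (cases "pY y = 0")
  case True
  then have "\<forall>z\<in>{0..<m}. pz z * W1 z y = 0"
    unfolding pY_eq_output_law output_law_def
    using is_pmf_on_nonneg[OF pz] is_channel_nonneg[OF W1] by (subst (asm) sum_nonneg_eq_0_iff) auto
  then show ?thesis using True z by simp
qed (simp add: backward_def)

lemma is_channel_backward: "is_channel backward UNIV {0..<m}"
proof (rule is_channelI)
  fix y
  show "is_pmf_on (backward y) {0..<m}"
  proof (cases "pY y = 0")
    case True
    then show ?thesis using m_ge_2 by (simp add: is_pmf_on_def backward_def)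
  next
    case False
    then have "sum (backward y) {0..<m} = (\<Sum>z\<in>{0..<m}. pz z * W1 z y) / pY y"
      by (simp add: backward_def sum_divide_distrib)
    also have "\<dots> = 1" using False by (simp add: pY1_def lessThan_atLeast0)
    finally show ?thesis
      using is_pmf_on_nonneg[OF pz] is_channel_nonneg[OF W1] is_pmf_on_nonneg[OF pY]
      by (auto simp: is_pmf_on_def backward_def)
  qed
qed

sublocale observation backward "{0..<m}"
  by unfold_locales (rule is_channel_backward)

lemma output_law_pY_backward:
  assumes "z \<in> {0..<m}"
  shows "output_law pY backward UNIV z = pz z"
  using assms W1 by (simp add: output_law_def pY_mult_backward is_channel_sum flip: sum_distrib_left)

lemma H_Z_given_U_eq:
  "H_Z_given_U m pz W1 k Q = (\<Sum>u\<in>{0..<k}. hent (output_law (\<lambda>y. pY y * Q y u) backward UNIV) {0..<m})"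
proof -
  have "pZU pz W1 Q (z, u) = output_law (\<lambda>y. pY y * Q y u) backward UNIV z" if z: "z \<in> {0..<m}" for z u
    unfolding pZU_def output_law_def prod.case
    using pY_mult_backward[OF z] by (intro sum.cong refl) (metis mult.assoc mult.commute)
  then have "H_Z_given_U m pz W1 k Q = (\<Sum>u\<in>{0..<k}. hent (\<lambda>z. pZU pz W1 Q (z, u)) {0..<m})"
    using sum.swap[of "\<lambda>z u. plogp (pZU pz W1 Q (z, u))" "{0..<k}" "{0..<m}"]
    by (simp add: H_Z_given_U_def hent_def ent_def sum_subtractf lessThan_atLeast0 sum.cartesian_product')
  also have "\<dots> = (\<Sum>u\<in>{0..<k}. hent (output_law (\<lambda>y. pY y * Q y u) backward UNIV) {0..<m})"
    using \<open>\<And>z u. z \<in> {0..<m} \<Longrightarrow> _ z u = _ z u\<close> by (intro sum.cong refl hent_cong)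
  finally show ?thesis .
qed

definition relay_channel :: "nat \<Rightarrow> (nat \<Rightarrow> (nat \<Rightarrow> 'y1) \<Rightarrow> 'x1) \<Rightarrow> (nat \<Rightarrow> 'y1) \<Rightarrow> (nat \<Rightarrow> 's) \<Rightarrow> real" where
  "relay_channel n f y = prod_law {0..<n} (\<lambda>i. Wr (f i y))"

text \<open>The receiver knows its noise \<open>Z\<^sup>n\<close> only through \<open>S\<^sup>n\<close>, so a relaying scheme matters only through the
  joint law of \<open>(Z\<^sup>n, S\<^sup>n)\<close>.\<close>
definition noise_law :: "nat \<Rightarrow> (nat \<Rightarrow> (nat \<Rightarrow> 'y1) \<Rightarrow> 'x1) \<Rightarrow> (nat \<Rightarrow> nat) \<times> (nat \<Rightarrow> 's) \<Rightarrow> real" where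
  "noise_law n f = joint_law (iid {0..<n} pz)
    (\<lambda>z. output_law (memoryless {0..<n} W1 z) (relay_channel n f) (seqs n UNIV))"

definition equivocation :: "nat \<Rightarrow> (nat \<Rightarrow> (nat \<Rightarrow> 'y1) \<Rightarrow> 'x1) \<Rightarrow> real" where
  "equivocation n f = (\<Sum>s\<in>seqs n UNIV. hent (\<lambda>z. noise_law n f (z, s)) (seqs n {0..<m}))"

lemma is_channel_relay_channel: "is_channel (relay_channel n f) (seqs n UNIV) (seqs n UNIV)"
  unfolding relay_channel_def using Wr
  by (intro is_channelI is_pmf_on_prod_law) (auto dest: is_channel_pmf)

lemma is_pmf_on_iid_pz: "is_pmf_on (iid {0..<n} pz) (seqs n {0..<m})"
  using pz by (intro is_pmf_on_prod_law) auto

lemma is_pmf_on_iid_pY: "is_pmf_on (iid {0..<n} pY) (seqs n UNIV)"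
  using pY by (intro is_pmf_on_prod_law) auto

lemma is_channel_relay_output:
  "is_channel (\<lambda>z. output_law (memoryless {0..<n} W1 z) (relay_channel n f) (seqs n UNIV))
    (seqs n {0..<m}) (seqs n UNIV)"
proof (rule is_channelI)
  fix z assume z: "z \<in> seqs n {0..<m}"
  have "is_channel (memoryless {0..<n} W1) (seqs n {0..<m}) (seqs n UNIV)"
    using W1 by (intro is_channel_memoryless) auto
  from is_channel_pmf[OF this z]
  show "is_pmf_on (output_law (memoryless {0..<n} W1 z) (relay_channel n f) (seqs n UNIV)) (seqs n UNIV)"
    using is_channel_relay_channel by (rule is_pmf_on_output_law)
qed

lemma is_pmf_on_noise_law: "is_pmf_on (noise_law n f) (seqs n {0..<m} \<times> seqs n UNIV)"
  unfolding noise_law_def by (rule is_pmf_on_joint_law[OF is_pmf_on_iid_pz is_channel_relay_output])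

lemma sum_noise_law:
  "(\<Sum>zs\<in>seqs n {0..<m} \<times> seqs n UNIV. noise_law n f zs * F zs)
    = (\<Sum>z\<in>seqs n {0..<m}. iid {0..<n} pz z * (\<Sum>y\<in>seqs n UNIV. memoryless {0..<n} W1 z y *
        (\<Sum>s\<in>seqs n UNIV. relay_channel n f y s * F (z, s))))"
  unfolding noise_law_def sum_joint_law sum_output_law ..

lemma noise_law_eq_output_law:
  assumes z: "z \<in> seqs n {0..<m}"
  shows "noise_law n f (z, s)
    = output_law (\<lambda>y. iid {0..<n} pY y * relay_channel n f y s) (memoryless {0..<n} backward) (seqs n UNIV) z"
proof -
  have "iid {0..<n} pz z * memoryless {0..<n} W1 z y = iid {0..<n} pY y * memoryless {0..<n} backward y z" for y
    unfolding prod_law_mult using z by (intro prod.cong refl pY_mult_backward[symmetric]) auto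
  then show ?thesis
    by (simp add: noise_law_def joint_law_def output_law_def sum_distrib_left) (simp add: mult_ac)
qed

lemma err_prob_eq:
  "err_prob m pz W1 Wr n M enc f g = (\<Sum>w\<in>{1..M}. prob_on (noise_law n f) (seqs n {0..<m} \<times> seqs n UNIV)
    (\<lambda>(z, s). g (shift_mod m n (enc w) z) s \<noteq> w)) / real M"
proof -
  have "(\<Prod>i<n. pz (z i) * W1 (z i) (y i) * Wr (f i y) (s i))
      = iid {0..<n} pz z * (memoryless {0..<n} W1 z y * relay_channel n f y s)" for z y s
    by (simp add: prod_law_def relay_channel_def prod.distrib lessThan_atLeast0 mult.assoc)
  then show ?thesis
    unfolding err_prob_def prob_on_def sum_noise_law shift_mod_def
    by (simp add: of_bool_def sum_distrib_left sum_divide_distrib mult.assoc)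
qed

lemma err_prob_nonneg: "0 \<le> err_prob m pz W1 Wr n M enc f g"
  unfolding err_prob_eq
  by (intro divide_nonneg_nonneg sum_nonneg prob_on_nonneg is_pmf_on_nonneg[OF is_pmf_on_noise_law]) auto

lemma equivocation_le_noise_entropy: "equivocation n f \<le> real n * ent pz {0..<m}"
proof -
  have "equivocation n f \<le> hent (\<lambda>z. \<Sum>s\<in>seqs n UNIV. noise_law n f (z, s)) (seqs n {0..<m})"
    unfolding equivocation_def using is_pmf_on_nonneg[OF is_pmf_on_noise_law]
    by (intro hent_superadditive) (auto intro: finite_PiE)
  also have "\<dots> = hent (iid {0..<n} pz) (seqs n {0..<m})"
    unfolding noise_law_def joint_law_def
    by (intro hent_cong) (simp add: is_channel_sum[OF is_channel_relay_output] flip: sum_distrib_left)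
  also have "\<dots> = real n * ent pz {0..<m}"
    unfolding hent_pmf[OF is_pmf_on_iid_pz] using pz by (subst ent_prod_law) auto
  finally show ?thesis .
qed

subsection \<open>Converse\<close>

lemma fano_bound:
  assumes M: "1 \<le> M"
  shows "(1 - err_prob m pz W1 Wr n M enc f g) * log 2 (real M) - 1
    \<le> real n * log 2 (real m) - equivocation n f"
proof -
  have "log 2 (real (card (seqs n {0..<m}))) = real n * log 2 (real m)"
    using m_ge_2 by (simp add: card_seqs log_nat_power)
  then show ?thesis
    unfolding err_prob_eq equivocation_def using m_ge_2
    by (intro order_trans[OF fano_additive_noise[where \<sigma> = "\<lambda>w. shift_mod m n (enc w)" and g = g]])
      (auto intro!: is_pmf_on_noise_law M bij_betw_shift_mod simp del: One_nat_def)
qed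

lemma relay_equivocation_ge:
  "real n * (ent pY UNIV - R0 Wr)
    \<le> (\<Sum>s\<in>seqs n UNIV. hent (\<lambda>y. iid {0..<n} pY y * relay_channel n f y s) (seqs n UNIV))"
proof -
  have "mutual_info (iid {0..<n} pY) (relay_channel n f) (seqs n UNIV) (seqs n UNIV) \<le> real n * R0 Wr"
    unfolding relay_channel_def[abs_def]
    using mutual_info_memoryless_uses_le[OF Wr, of "{0..<n}" "iid {0..<n} pY" "seqs n UNIV" f] is_pmf_on_iid_pY
    by simp
  moreover have "ent (iid {0..<n} pY) (seqs n UNIV) = real n * ent pY UNIV"
    using pY by (subst ent_prod_law) auto
  ultimately show ?thesis
    by (simp add: mutual_info_equivocation[OF is_pmf_on_iid_pY is_channel_relay_channel] right_diff_distrib)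
qed

lemma attainable_equivocation:
  assumes n: "0 < n"
  shows "\<exists>h\<ge>ent pY UNIV - R0 Wr. attainable pY h (equivocation n f / real n)"
proof -
  define a where "a s y = iid {0..<n} pY y * relay_channel n f y s" for s y
  define h where "h = (\<Sum>s\<in>seqs n UNIV. hent (a s) (seqs n UNIV))"
  have "attainable (\<lambda>y. \<Sum>s\<in>seqs n UNIV. \<Sum>i\<in>{0..<n}. pushforward (\<lambda>x. x i) (a s) (seqs n UNIV) y) h
    (\<Sum>s\<in>seqs n UNIV. hent (output_law (a s) (memoryless {0..<n} backward) (seqs n UNIV)) (seqs n {0..<m}))"
    unfolding h_def a_def
    using is_pmf_on_nonneg[OF is_pmf_on_iid_pY] is_channel_nonneg[OF is_channel_relay_channel]
    by (intro attainable_sum attainable_single_letter) (auto intro: finite_PiE)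
  moreover have "(\<Sum>s\<in>seqs n UNIV. \<Sum>i\<in>{0..<n}. pushforward (\<lambda>x. x i) (a s) (seqs n UNIV) y) = real n * pY y" for y
  proof -
    have "(\<Sum>s\<in>seqs n UNIV. pushforward (\<lambda>x. x i) (a s) (seqs n UNIV) y)
        = pushforward (\<lambda>x. x i) (iid {0..<n} pY) (seqs n UNIV) y" for i
      unfolding pushforward_def prob_on_def a_def
      by (subst sum.swap)
        (simp add: is_channel_sum[OF is_channel_relay_channel] mult.assoc mult.left_commute[of _ "of_bool _"]
          flip: sum_distrib_left sum_distrib_right)
    then show ?thesis
      using pY by (subst sum.swap) (simp add: pushforward_prod_law_coordinate)
  qed
  moreover have "(\<Sum>s\<in>seqs n UNIV. hent (output_law (a s) (memoryless {0..<n} backward) (seqs n UNIV)) (seqs n {0..<m}))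
      = equivocation n f"
    unfolding equivocation_def a_def by (intro sum.cong refl hent_cong) (simp add: noise_law_eq_output_law)
  ultimately have "attainable (\<lambda>y. 1 / real n * (real n * pY y)) (1 / real n * h) (1 / real n * equivocation n f)"
    by (intro attainable_scale) simp_all
  then have "attainable pY (h / real n) (equivocation n f / real n)" using n by simp
  moreover have "real n * (ent pY UNIV - R0 Wr) \<le> h" unfolding h_def a_def by (rule relay_equivocation_ge)
  then have "ent pY UNIV - R0 Wr \<le> h / real n" using n by (simp add: field_simps)
  ultimately show ?thesis by blast
qed

theorem converse:
  assumes R: "achievable m pz W1 Wr R"
    and H: "\<And>h b. attainable pY h b \<Longrightarrow> ent pY UNIV - R0 Wr \<le> h \<Longrightarrow> H \<le> b"
  shows "R \<le> log 2 (real m) - H"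
proof -
  obtain enc f g where lim: "(\<lambda>n. err_prob m pz W1 Wr n (num_msgs n R) (enc n) (f n) (g n)) \<longlonglongrightarrow> 0"
    using R unfolding achievable_def by blast
  define e where "e n = err_prob m pz W1 Wr n (num_msgs n R) (enc n) (f n) (g n)" for n
  have e: "e \<longlonglongrightarrow> 0" using lim unfolding e_def .
  have bound: "(1 - e n) * R - 1 / real n \<le> log 2 (real m) - H" if n: "0 < n" and e1: "e n < 1" for n
  proof -
    have "H \<le> equivocation n (f n) / real n" using attainable_equivocation[OF n] H by blast
    then have equiv: "real n * H \<le> equivocation n (f n)" using n by (simp add: field_simps)
    have "real n * R \<le> log 2 (real (num_msgs n R))"
      using num_msgs_ge[where n = n and R = R] num_msgs_pos[of n R] by (subst le_log_iff) auto
    then have "(1 - e n) * (real n * R) \<le> (1 - e n) * log 2 (real (num_msgs n R))"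
      using e1 by (intro mult_left_mono) auto
    also have "\<dots> \<le> real n * log 2 (real m) - real n * H + 1"
      using fano_bound[of "num_msgs n R" n "enc n" "f n" "g n", OF num_msgs_pos] equiv unfolding e_def by linarith
    finally have "real n * ((1 - e n) * R - 1 / real n) \<le> real n * (log 2 (real m) - H)"
      using n by (simp add: algebra_simps)
    then show ?thesis using n by simp
  qed
  have "eventually (\<lambda>n. e n < 1) sequentially" using e by (rule order_tendstoD) simp
  then have "eventually (\<lambda>n. (1 - e n) * R - 1 / real n \<le> log 2 (real m) - H) sequentially"
    using eventually_gt_at_top[of 0] by eventually_elim (rule bound)
  moreover have "(\<lambda>n. (1 - e n) * R - 1 / real n) \<longlonglongrightarrow> (1 - 0) * R - 0"
    by (intro tendsto_intros e lim_1_over_n)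
  ultimately show ?thesis by (intro tendsto_upperbound[of _ R]) auto
qed

end

section \<open>Block decomposition of product distributions\<close>

definition window :: "nat \<Rightarrow> nat \<Rightarrow> (nat \<Rightarrow> 'a) \<Rightarrow> nat \<Rightarrow> 'a" where
  "window l j x = (\<lambda>t\<in>{0..<l}. x (j + t))"

lemma window_in_seqs: "x \<in> seqs n A \<Longrightarrow> j + l \<le> n \<Longrightarrow> window l j x \<in> seqs l A"
  by (auto simp: window_def PiE_iff)

lemma window_window: "i + l \<le> k \<Longrightarrow> window l i (window k j x) = window l (j + i) x"
  by (auto simp: window_def fun_eq_iff add.assoc)

lemma sum_seqs_append:
  fixes A :: "'a set"
  shows "(\<Sum>x\<in>seqs (a + b) A. F (window a 0 x) (window b a x)) = (\<Sum>u\<in>seqs a A. \<Sum>v\<in>seqs b A. F u v)"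
proof -
  define join where "join = (\<lambda>(u, v). \<lambda>i\<in>{0..<a + b}. if i < a then u i else v (i - a) :: 'a)"
  have "(\<Sum>x\<in>seqs (a + b) A. F (window a 0 x) (window b a x)) = (\<Sum>(u, v)\<in>seqs a A \<times> seqs b A. F u v)"
  proof (rule sum.reindex_bij_witness[where i = join and j = "\<lambda>x. (window a 0 x, window b a x)"])
    show "join (window a 0 x, window b a x) = x" if "x \<in> seqs (a + b) A" for x
      using that by (auto simp: join_def window_def fun_eq_iff PiE_iff extensional_def)
    show "(window a 0 x, window b a x) \<in> seqs a A \<times> seqs b A" if "x \<in> seqs (a + b) A" for x
      using that by (intro SigmaI window_in_seqs[OF that]) auto
  next
    fix uv assume uv: "uv \<in> seqs a A \<times> seqs b A"
    then obtain u v where [simp]: "uv = (u, v)" and "u \<in> seqs a A" "v \<in> seqs b A" by auto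
    then show "(window a 0 (join uv), window b a (join uv)) = uv"
      by (auto simp: join_def window_def fun_eq_iff PiE_iff extensional_def)
    show "join uv \<in> seqs (a + b) A"
      using uv by (auto simp: join_def PiE_iff)
  qed auto
  then show ?thesis by (simp add: sum.cartesian_product)
qed

lemma prod_law_append:
  "prod_law {0..<a + b} g x
    = prod_law {0..<a} g (window a 0 x) * prod_law {0..<b} (\<lambda>i. g (a + i)) (window b a x)"
proof -
  have "prod_law {0..<a + b} g x = (\<Prod>i\<in>{0..<a}. g i (x i)) * (\<Prod>i\<in>{a..<a + b}. g i (x i))"
    unfolding prod_law_def by (rule prod.atLeastLessThan_concat[symmetric]) auto
  also have "(\<Prod>i\<in>{a..<a + b}. g i (x i)) = (\<Prod>i\<in>{0..<b}. g (a + i) (x (a + i)))"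
    using prod.shift_bounds_nat_ivl[of "\<lambda>i. g i (x i)" 0 a b] by (simp add: add.commute)
  finally show ?thesis by (simp add: prod_law_def window_def)
qed

lemma sum_prod_law_append:
  "(\<Sum>x\<in>seqs (a + b) A. prod_law {0..<a + b} g x * (F (window a 0 x) * G (window b a x)))
    = (\<Sum>u\<in>seqs a A. prod_law {0..<a} g u * F u) * (\<Sum>v\<in>seqs b A. prod_law {0..<b} (\<lambda>i. g (a + i)) v * G v)"
  using sum_seqs_append[of "\<lambda>u v. (prod_law {0..<a} g u * F u) * (prod_law {0..<b} (\<lambda>i. g (a + i)) v * G v)" a b A]
  by (simp add: prod_law_append sum_product mult_ac)

lemma sum_prod_law_windows:
  assumes A: "finite A" and g: "\<And>i. i < k + B * l + r \<Longrightarrow> sum (g i) A = 1"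
  shows "(\<Sum>x\<in>seqs (k + B * l + r) A. prod_law {0..<k + B * l + r} g x * (\<Prod>b<B. F b (window l (k + b * l) x)))
    = (\<Prod>b<B. \<Sum>x\<in>seqs l A. prod_law {0..<l} (\<lambda>t. g (k + b * l + t)) x * F b x)"
  using g
proof (induction B arbitrary: r)
  case 0
  then show ?case using A by (simp add: sum_prod_law)
next
  case (Suc B)
  let ?n = "k + B * l"
  have n: "k + Suc B * l + r = ?n + (l + r)" by simp
  have earlier: "window l (k + b * l) x = window l (k + b * l) (window ?n 0 x)" if "b < B" for b x
  proof -
    have "b * l + l \<le> B * l" using mult_le_mono1[of "Suc b" B l] that by simp
    then show ?thesis by (simp add: window_window)
  qed
  have last: "window l ?n x = window l 0 (window (l + r) ?n x)" for x by (simp add: window_window)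
  have "(\<Sum>x\<in>seqs (?n + (l + r)) A. prod_law {0..<?n + (l + r)} g x * (\<Prod>b<Suc B. F b (window l (k + b * l) x)))
      = (\<Sum>x\<in>seqs (?n + (l + r)) A. prod_law {0..<?n + (l + r)} g x *
          ((\<Prod>b<B. F b (window l (k + b * l) (window ?n 0 x))) * F B (window l 0 (window (l + r) ?n x))))"
    by (simp flip: earlier last)
  also have "\<dots> = (\<Sum>x\<in>seqs ?n A. prod_law {0..<?n} g x * (\<Prod>b<B. F b (window l (k + b * l) x)))
      * (\<Sum>x\<in>seqs (l + r) A. prod_law {0..<l + r} (\<lambda>i. g (?n + i)) x * F B (window l 0 x))"
    by (rule sum_prod_law_append)
  also have "(\<Sum>x\<in>seqs (l + r) A. prod_law {0..<l + r} (\<lambda>i. g (?n + i)) x * F B (window l 0 x))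
      = (\<Sum>x\<in>seqs l A. prod_law {0..<l} (\<lambda>t. g (?n + t)) x * F B x)"
  proof -
    have "(\<Sum>x\<in>seqs r A. prod_law {0..<r} (\<lambda>i. g (?n + (l + i))) x) = 1"
      using A Suc.prems by (simp add: sum_prod_law add.assoc)
    then show ?thesis
      using sum_prod_law_append[where a = l and b = r and A = A and g = "\<lambda>i. g (?n + i)" and F = "F B" and G = "\<lambda>_. 1"]
      by simp
  qed
  also have "(\<Sum>x\<in>seqs ?n A. prod_law {0..<?n} g x * (\<Prod>b<B. F b (window l (k + b * l) x)))
      = (\<Prod>b<B. \<Sum>x\<in>seqs l A. prod_law {0..<l} (\<lambda>t. g (k + b * l + t)) x * F b x)"
    using Suc.IH[of 0] Suc.prems by simp
  finally show ?case unfolding n by simp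
qed

section \<open>Achievability\<close>

context modsum_relay
begin

subsection \<open>Block relaying\<close>

text \<open>The relay sends \<open>\<phi>\<close> of the previous block; it has nothing to send in the first block.\<close>
definition relay_blocks :: "nat \<Rightarrow> (nat \<Rightarrow> (nat \<Rightarrow> 'y1) \<Rightarrow> 'x1) \<Rightarrow> nat \<Rightarrow> (nat \<Rightarrow> 'y1) \<Rightarrow> 'x1" where
  "relay_blocks l \<phi> i y = (if i < l then undefined else \<phi> (i mod l) (window l ((i div l - 1) * l) y))"

lemma relay_blocks_causal:
  assumes "\<forall>j<i. y j = y' j"
  shows "relay_blocks l \<phi> i y = relay_blocks l \<phi> i y'"
proof (cases "i < l")
  case False
  have "(i div l - 1) * l + t < i" if "t < l" for t
  proof -
    have "0 < i div l" using False that by (simp add: div_greater_zero_iff)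
    then have "(i div l - 1) * l + l \<le> i"
      using div_times_less_eq_dividend[of i l] by (cases "i div l") auto
    then show ?thesis using that by linarith
  qed
  then have "window l ((i div l - 1) * l) y = window l ((i div l - 1) * l) y'"
    using assms by (auto simp: window_def)
  then show ?thesis by (simp add: relay_blocks_def)
qed (simp add: relay_blocks_def)

lemma relay_blocks_block:
  "t < l \<Longrightarrow> relay_blocks l \<phi> (l + b * l + t) y = \<phi> t (window l (b * l) y)"
  by (simp add: relay_blocks_def add.assoc)

lemma sum_noise_law_blocks:
  assumes n: "n = l + B * l + r"
  shows "(\<Sum>zs\<in>seqs n {0..<m} \<times> seqs n UNIV. noise_law n (relay_blocks l \<phi>) zs *
      (\<Prod>b<B. E b (window l (b * l) (fst zs), window l (l + b * l) (snd zs))))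
    = (\<Prod>b<B. \<Sum>zs\<in>seqs l {0..<m} \<times> seqs l UNIV. noise_law l \<phi> zs * E b zs)"
proof -
  have n': "n = 0 + B * l + (l + r)" using n by simp
  define Es where "Es b z y = (\<Sum>s\<in>seqs l UNIV. relay_channel l \<phi> y s * E b (z, s))" for b z y
  define Ey where "Ey b z = (\<Sum>y\<in>seqs l UNIV. memoryless {0..<l} W1 z y * Es b z y)" for b z
  have sum_s: "(\<Sum>s\<in>seqs n UNIV. relay_channel n (relay_blocks l \<phi>) y s *
      (\<Prod>b<B. E b (window l (b * l) z, window l (l + b * l) s)))
    = (\<Prod>b<B. Es b (window l (b * l) z) (window l (b * l) y))" for z y
  proof -
    have "prod_law {0..<l} (\<lambda>t. Wr (relay_blocks l \<phi> (l + b * l + t) y)) = relay_channel l \<phi> (window l (b * l) y)" for b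
      by (simp add: fun_eq_iff prod_law_def relay_channel_def relay_blocks_block)
    then show ?thesis
      unfolding n relay_channel_def Es_def
      by (subst sum_prod_law_windows) (auto simp: is_channel_sum[OF Wr] relay_channel_def)
  qed
  have sum_y: "(\<Sum>y\<in>seqs n UNIV. memoryless {0..<n} W1 z y * (\<Prod>b<B. Es b (window l (b * l) z) (window l (b * l) y)))
    = (\<Prod>b<B. Ey b (window l (b * l) z))" if z: "z \<in> seqs n {0..<m}" for z
  proof -
    have "z i \<in> {0..<m}" if "i < n" for i using PiE_mem[OF z, of i] that by simp
    then have "(\<Sum>y\<in>seqs n UNIV. memoryless {0..<n} W1 z y * (\<Prod>b<B. Es b (window l (b * l) z) (window l (0 + b * l) y)))
      = (\<Prod>b<B. \<Sum>y\<in>seqs l UNIV. prod_law {0..<l} (\<lambda>t. W1 (z (0 + b * l + t))) y * Es b (window l (b * l) z) y)"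
      unfolding n' by (intro sum_prod_law_windows) (auto intro: is_channel_sum[OF W1])
    also have "\<dots> = (\<Prod>b<B. Ey b (window l (b * l) z))"
      unfolding Ey_def by (intro prod.cong sum.cong refl) (simp add: prod_law_def window_def)
    finally show ?thesis by simp
  qed
  have "(\<Sum>zs\<in>seqs n {0..<m} \<times> seqs n UNIV. noise_law n (relay_blocks l \<phi>) zs *
      (\<Prod>b<B. E b (window l (b * l) (fst zs), window l (l + b * l) (snd zs))))
    = (\<Sum>z\<in>seqs n {0..<m}. iid {0..<n} pz z * (\<Prod>b<B. Ey b (window l (0 + b * l) z)))"
    unfolding sum_noise_law fst_conv snd_conv by (simp add: sum_s sum_y)
  also have "\<dots> = (\<Prod>b<B. \<Sum>z\<in>seqs l {0..<m}. iid {0..<l} pz z * Ey b z)"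
    unfolding n' by (intro sum_prod_law_windows) (auto simp: is_pmf_on_sum[OF pz])
  finally show ?thesis by (simp add: Ey_def Es_def sum_noise_law)
qed

subsection \<open>Blocks as letters of a memoryless channel\<close>

definition block_channel :: "nat \<Rightarrow> (nat \<Rightarrow> (nat \<Rightarrow> 'y1) \<Rightarrow> 'x1) \<Rightarrow> (nat \<Rightarrow> nat) \<Rightarrow> (nat \<Rightarrow> nat) \<times> (nat \<Rightarrow> 's) \<Rightarrow> real" where
  "block_channel l \<phi> = additive_channel (shift_mod m l) (noise_law l \<phi>) (seqs l {0..<m}) (seqs l UNIV)"

lemma finite_block_outputs: "finite (seqs l {0..<m} \<times> seqs l (UNIV :: 's set))"
  by (intro finite_cartesian_product finite_PiE) auto

lemma shift_mod_in_seqs: "shift_mod m n c z \<in> seqs n {0..<m}"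
  using m_ge_2 by (auto simp: shift_mod_def)

lemma bij_betw_shift_mod_input:
  "bij_betw (\<lambda>x. shift_mod m l x z) (seqs l {0..<m}) (seqs l {0..<m})"
  unfolding shift_mod_commute[of m l _ z] using m_ge_2 by (intro bij_betw_shift_mod) auto

lemma is_channel_block_channel:
  "is_channel (block_channel l \<phi>) (seqs l {0..<m}) (seqs l {0..<m} \<times> seqs l UNIV)"
  unfolding block_channel_def using m_ge_2
  by (intro is_channel_additive_channel is_pmf_on_noise_law bij_betw_shift_mod bij_betw_shift_mod_input) auto

lemma mutual_info_block_channel:
  "mutual_info (\<lambda>_. 1 / real (card (seqs l {0..<m}))) (block_channel l \<phi>) (seqs l {0..<m})
      (seqs l {0..<m} \<times> seqs l UNIV)
    = real l * log 2 (real m) - equivocation l \<phi>"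
proof -
  have "mutual_info (\<lambda>_. 1 / real (card (seqs l {0..<m}))) (block_channel l \<phi>) (seqs l {0..<m})
        (seqs l {0..<m} \<times> seqs l UNIV)
      = log 2 (real (card (seqs l {0..<m}))) - equivocation l \<phi>"
    unfolding block_channel_def equivocation_def using m_ge_2
    by (intro mutual_info_additive_channel_uniform is_pmf_on_noise_law bij_betw_shift_mod bij_betw_shift_mod_input) auto
  then show ?thesis using m_ge_2 by (simp add: card_seqs log_nat_power)
qed

lemma prob_on_noise_law_blocks:
  assumes n: "n = l + B * l + r"
  shows "prob_on (noise_law n (relay_blocks l \<phi>)) (seqs n {0..<m} \<times> seqs n UNIV)
      (\<lambda>(z, s). P (\<lambda>b\<in>{0..<B}. (shift_mod m l (c b) (window l (b * l) z), window l (l + b * l) s)))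
    = prob_on (memoryless {0..<B} (block_channel l \<phi>) c) (seqs B (seqs l {0..<m} \<times> seqs l UNIV)) P"
proof -
  let ?out = "\<lambda>(z, s). \<lambda>b\<in>{0..<B}. (shift_mod m l (c b) (window l (b * l) z), window l (l + b * l) s)"
  let ?O = "seqs B (seqs l {0..<m} \<times> seqs l (UNIV :: 's set))"
  let ?ZS = "seqs n {0..<m} \<times> seqs n (UNIV :: 's set)"
  have "memoryless {0..<B} (block_channel l \<phi>) c o' = pushforward ?out (noise_law n (relay_blocks l \<phi>)) ?ZS o'"
    if o': "o' \<in> ?O" for o'
  proof -
    have "?out zs = o' \<longleftrightarrow> (\<forall>b<B. (shift_mod m l (c b) (window l (b * l) (fst zs)), window l (l + b * l) (snd zs)) = o' b)"
      for zs
      using o' by (auto simp: fun_eq_iff PiE_iff extensional_def split_def)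
    then have out: "of_bool (?out zs = o') = (\<Prod>b<B. of_bool
        ((shift_mod m l (c b) (window l (b * l) (fst zs)), window l (l + b * l) (snd zs)) = o' b) :: real)" for zs
      by (simp add: of_bool_def prod_zero_iff) (auto intro!: prod.neutral[symmetric])
    have "memoryless {0..<B} (block_channel l \<phi>) c o' = (\<Prod>b<B. \<Sum>zs\<in>seqs l {0..<m} \<times> seqs l UNIV.
        noise_law l \<phi> zs * of_bool ((shift_mod m l (c b) (fst zs), snd zs) = o' b))"
      by (simp add: prod_law_def block_channel_def additive_channel_def pushforward_def prob_on_def split_def lessThan_atLeast0)
    also have "\<dots> = (\<Sum>zs\<in>?ZS. noise_law n (relay_blocks l \<phi>) zs * (\<Prod>b<B. of_bool
        ((shift_mod m l (c b) (window l (b * l) (fst zs)), window l (l + b * l) (snd zs)) = o' b)))"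
      using sum_noise_law_blocks[OF n, of \<phi> "\<lambda>b zs. of_bool ((shift_mod m l (c b) (fst zs), snd zs) = o' b)"] by simp
    finally show ?thesis unfolding out[symmetric] by (simp add: pushforward_def prob_on_def)
  qed
  then have "prob_on (memoryless {0..<B} (block_channel l \<phi>) c) ?O P
      = prob_on (pushforward ?out (noise_law n (relay_blocks l \<phi>)) ?ZS) ?O P"
    by (simp add: prob_on_def)
  also have "\<dots> = prob_on (noise_law n (relay_blocks l \<phi>)) ?ZS (\<lambda>zs. P (?out zs))"
  proof (rule prob_on_pushforward)
    show "finite ?O" by (intro finite_PiE finite_block_outputs) auto
    have "window l (l + b * l) s \<in> seqs l UNIV" if "s \<in> seqs n UNIV" "b < B" for s :: "nat \<Rightarrow> 's" and b
      using mult_le_mono1[of "Suc b" B l] that n by (intro window_in_seqs[of s n]) auto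
    then show "?out ` ?ZS \<subseteq> ?O"
      by (simp add: image_subset_iff split_def restrict_PiE_iff shift_mod_in_seqs)
  qed
  finally show ?thesis by (simp add: split_def)
qed

lemma block_code_err_prob:
  assumes n: "n = l + B * l + r" and M: "1 \<le> M"
    and c: "\<And>w. w \<in> {1..M} \<Longrightarrow> c w \<in> seqs B (seqs l {0..<m})"
    and err: "\<And>w. w \<in> {1..M} \<Longrightarrow> prob_on (memoryless {0..<B} (block_channel l \<phi>) (c w))
      (seqs B (seqs l {0..<m} \<times> seqs l UNIV)) (\<lambda>o'. g o' \<noteq> w) \<le> \<epsilon>"
  shows "\<exists>enc g'. (\<forall>w\<in>{1..M}. \<forall>i<n. enc w i < m) \<and> err_prob m pz W1 Wr n M enc (relay_blocks l \<phi>) g' \<le> \<epsilon>"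
proof -
  define enc where "enc w i = (if i < B * l then c w (i div l) (i mod l) else 0)" for w i
  define g' where "g' v s = g (\<lambda>b\<in>{0..<B}. (window l (b * l) v, window l (l + b * l) s))" for v s
  have enc_block: "b * l + t < B * l" "enc w (b * l + t) = c w b t" if "b < B" "t < l" for w b t
  proof -
    show *: "b * l + t < B * l" using mult_le_mono1[of "Suc b" B l] that by simp
    show "enc w (b * l + t) = c w b t" using * that by (simp add: enc_def)
  qed
  have "window l (b * l) (shift_mod m n (enc w) z) = shift_mod m l (c w b) (window l (b * l) z)" if b: "b < B" for w b z
  proof -
    have "b * l + t < n" if "t < l" for t using enc_block(1)[OF b that] n by linarith
    then show ?thesis by (auto simp: window_def shift_mod_def fun_eq_iff enc_block(2)[OF b])
  qed
  then have decode: "g' (shift_mod m n (enc w) z) s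
      = g (\<lambda>b\<in>{0..<B}. (shift_mod m l (c w b) (window l (b * l) z), window l (l + b * l) s))" for w z s
    unfolding g'_def by (intro arg_cong[of _ _ g] restrict_ext) auto
  have "enc w i < m" if w: "w \<in> {1..M}" for w i
  proof (cases "i < B * l")
    case True
    then have "i div l < B" "i mod l < l" by (auto simp: less_mult_imp_div_less intro!: mod_less_divisor gr0I)
    then have "c w (i div l) (i mod l) \<in> {0..<m}"
      using PiE_mem[OF PiE_mem[OF c[OF w], of "i div l"], of "i mod l"] by simp
    then show ?thesis using True by (simp add: enc_def)
  qed (use m_ge_2 in \<open>simp add: enc_def\<close>)
  moreover have "err_prob m pz W1 Wr n M enc (relay_blocks l \<phi>) g' \<le> \<epsilon>"
  proof -
    have "err_prob m pz W1 Wr n M enc (relay_blocks l \<phi>) g' \<le> (\<Sum>w\<in>{1..M}. \<epsilon>) / real M"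
      unfolding err_prob_eq decode prob_on_noise_law_blocks[OF n, of \<phi> "\<lambda>o'. g o' \<noteq> _"]
      by (intro divide_right_mono sum_mono err) auto
    then show ?thesis using M by simp
  qed
  ultimately show ?thesis by blast
qed

subsection \<open>Rates below the block equivocation bound\<close>

lemma achievable_nonpos_rate:
  assumes "R \<le> 0"
  shows "achievable m pz W1 Wr R"
proof -
  have "num_msgs n R = 1" for n
  proof -
    have "2 powr (real n * R) \<le> 2 powr 0" using assms by (intro powr_mono) (auto simp: mult_nonneg_nonpos)
    then have "\<lceil>2 powr (real n * R)\<rceil> = 1" by (intro ceiling_unique) auto
    then show ?thesis by (simp add: num_msgs_def)
  qed
  then have "err_prob m pz W1 Wr n (num_msgs n R) (\<lambda>_ _. 0) (\<lambda>_ _. undefined) (\<lambda>_ _. 1) = 0" for n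
    by (simp add: err_prob_def)
  then show ?thesis unfolding achievable_def using m_ge_2
    by (intro exI[of _ "\<lambda>_ _ _. 0"] exI[of _ "\<lambda>_ _ _. undefined"] exI[of _ "\<lambda>_ _ _. 1"]) auto
qed

lemma filterlim_block_count: "0 < l \<Longrightarrow> filterlim (\<lambda>n. n div l - 1) at_top sequentially" for l :: nat
  by (intro filterlim_compose[OF filterlim_minus_const_nat_at_top] filterlim_at_top_div_const_nat)

lemma block_length_decomposition:
  fixes l n :: nat
  assumes "0 < l" "l \<le> n"
  shows "n = l + (n div l - 1) * l + n mod l"
proof -
  have "Suc (n div l - 1) = n div l" using assms by (simp add: div_greater_zero_iff)
  then have "l + (n div l - 1) * l = n div l * l" by (metis mult_Suc)
  then show ?thesis by simp
qed

lemma eventually_num_msgs_le_blocks: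
  assumes l: "0 < l" and R: "0 \<le> R" "real l * R < R'"
  shows "eventually (\<lambda>n. real (num_msgs n R) \<le> 2 * 2 powr (real (n div l - 1) * R')) sequentially"
proof -
  define N where "N = nat \<lceil>2 * real l * R / (R' - real l * R)\<rceil>"
  have "eventually (\<lambda>n. N \<le> n div l - 1) sequentially"
    using filterlim_block_count[OF l] by (simp add: filterlim_at_top)
  then show ?thesis
  proof eventually_elim
    case (elim n)
    define B where "B = n div l - 1"
    have "2 * real l * R / (R' - real l * R) \<le> real B"
      using elim by (simp add: N_def B_def)
    then have B: "2 * real l * R \<le> real B * (R' - real l * R)" using R(2) by (simp add: pos_divide_le_eq)
    have "n < Suc (n div l) * l" using l by (metis dividend_less_times_div mult.commute mult_Suc_right)
    also have "\<dots> \<le> (B + 2) * l" by (intro mult_le_mono1) (simp add: B_def)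
    finally have "real n \<le> real ((B + 2) * l)" by (simp only: of_nat_le_iff less_imp_le)
    then have "real n * R \<le> real ((B + 2) * l) * R" using R(1) by (rule mult_right_mono)
    also have "\<dots> \<le> real B * R'" using B by (simp add: algebra_simps)
    finally have "2 powr (real n * R) \<le> 2 powr (real B * R')" by (intro powr_mono) auto
    then show ?case using num_msgs_le[OF R(1), of n] unfolding B_def by linarith
  qed
qed

lemma exists_block_codes:
  assumes R: "R < real l * log 2 (real m) - equivocation l \<phi>"
  shows "\<exists>\<epsilon>. \<epsilon> \<longlonglongrightarrow> 0 \<and> (\<forall>n B r M. n = l + B * l + r \<and> 1 \<le> M \<and> real M \<le> 2 * 2 powr (real B * R) \<longrightarrow>
    (\<exists>enc g. (\<forall>w\<in>{1..M}. \<forall>i<n. enc w i < m) \<and> err_prob m pz W1 Wr n M enc (relay_blocks l \<phi>) g \<le> \<epsilon> B))"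
proof -
  have "seqs l {0..<m} \<noteq> {}" "finite (seqs l {0..<m})" using m_ge_2 by (auto simp: PiE_eq_empty_iff finite_PiE)
  then have uniform: "is_pmf_on (\<lambda>_. 1 / real (card (seqs l {0..<m}))) (seqs l {0..<m})"
    by (intro is_pmf_on_uniform)
  from channel_coding[OF uniform is_channel_block_channel[of l \<phi>], unfolded mutual_info_block_channel, OF R]
  obtain \<epsilon> where \<epsilon>: "\<epsilon> \<longlonglongrightarrow> 0" and code: "\<forall>B M. real M \<le> 2 * 2 powr (real B * R) \<longrightarrow> (\<exists>c g. \<forall>w\<in>{1..M::nat}.
      c w \<in> seqs B (seqs l {0..<m}) \<and> prob_on (memoryless {0..<B} (block_channel l \<phi>) (c w))
        (seqs B (seqs l {0..<m} \<times> seqs l UNIV)) (\<lambda>o'. g o' \<noteq> w) \<le> \<epsilon> B)"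
    by (elim exE conjE)
  have "\<exists>enc g. (\<forall>w\<in>{1..M}. \<forall>i<n. enc w i < m) \<and> err_prob m pz W1 Wr n M enc (relay_blocks l \<phi>) g \<le> \<epsilon> B"
    if n: "n = l + B * l + r" and M: "1 \<le> M" and le: "real M \<le> 2 * 2 powr (real B * R)" for n B r M
  proof -
    from code[rule_format, OF le] obtain c g where cg: "\<forall>w\<in>{1..M}. c w \<in> seqs B (seqs l {0..<m}) \<and>
        prob_on (memoryless {0..<B} (block_channel l \<phi>) (c w)) (seqs B (seqs l {0..<m} \<times> seqs l UNIV))
          (\<lambda>o'. g o' \<noteq> w) \<le> \<epsilon> B"
      by (elim exE)
    show ?thesis
      by (rule block_code_err_prob[OF n M, where c = c and g = g]) (use cg in simp_all)
  qed
  then show ?thesis using \<epsilon> by (intro exI[of _ \<epsilon>] conjI allI impI) auto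
qed

theorem achievable_below_equivocation:
  assumes l: "0 < l" and R: "real l * R < real l * log 2 (real m) - equivocation l \<phi>"
  shows "achievable m pz W1 Wr R"
proof (cases "R \<le> 0")
  case True
  then show ?thesis by (rule achievable_nonpos_rate)
next
  case False
  obtain R' where R': "real l * R < R'" "R' < real l * log 2 (real m) - equivocation l \<phi>"
    using dense[OF R] by blast
  define B where "B n = n div l - 1" for n
  from exists_block_codes[OF R'(2)] obtain \<epsilon> where \<epsilon>: "\<epsilon> \<longlonglongrightarrow> 0"
    and code: "\<forall>n b r M. n = l + b * l + r \<and> 1 \<le> M \<and> real M \<le> 2 * 2 powr (real b * R') \<longrightarrow>
      (\<exists>enc g. (\<forall>w\<in>{1..M}. \<forall>i<n. enc w i < m) \<and> err_prob m pz W1 Wr n M enc (relay_blocks l \<phi>) g \<le> \<epsilon> b)"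
    by (elim exE conjE)
  define good where "good n \<longleftrightarrow> l \<le> n \<and> real (num_msgs n R) \<le> 2 * 2 powr (real (B n) * R')" for n
  define P where "P n enc g \<longleftrightarrow> (\<forall>w\<in>{1..num_msgs n R}. \<forall>i<n. enc w i < m) \<and>
    (good n \<longrightarrow> err_prob m pz W1 Wr n (num_msgs n R) enc (relay_blocks l \<phi>) g \<le> \<epsilon> (B n))" for n enc g
  have "\<exists>enc g. P n enc g" for n
  proof (cases "good n")
    case True
    then have "n = l + B n * l + n mod l" unfolding good_def B_def by (intro block_length_decomposition l) simp
    then show ?thesis
      using code[rule_format, of n "B n" "n mod l" "num_msgs n R"] num_msgs_pos True unfolding P_def good_def by simp
  next
    case False
    then show ?thesis unfolding P_def using m_ge_2
      by (intro exI[of _ "\<lambda>_ _. 0"]) auto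
  qed
  then obtain enc g where code': "\<And>n. P n (enc n) (g n)" by metis
  have lim: "(\<lambda>n. \<epsilon> (B n)) \<longlonglongrightarrow> 0"
    unfolding B_def by (rule filterlim_compose[OF \<epsilon> filterlim_block_count[OF l]])
  have "eventually good sequentially"
    unfolding good_def[abs_def] B_def using False eventually_num_msgs_le_blocks[OF l _ R'(1)]
    by (intro eventually_conj eventually_ge_at_top) auto
  then have "eventually (\<lambda>n. err_prob m pz W1 Wr n (num_msgs n R) (enc n) (relay_blocks l \<phi>) (g n) \<le> \<epsilon> (B n)) sequentially"
    by eventually_elim (use code' in \<open>simp add: P_def split: if_splits\<close>)
  then have "(\<lambda>n. err_prob m pz W1 Wr n (num_msgs n R) (enc n) (relay_blocks l \<phi>) (g n)) \<longlonglongrightarrow> 0"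
    using lim by (intro tendsto_sandwich[OF _ _ tendsto_const lim]) (auto simp: err_prob_nonneg)
  then show ?thesis
    unfolding achievable_def using code' relay_blocks_causal
    by (intro exI[of _ enc] exI[of _ "\<lambda>_. relay_blocks l \<phi>"] exI[of _ g] conjI allI impI) (simp_all add: P_def)
qed

subsection \<open>Quantising the relay observation under logarithmic loss\<close>

definition log_loss :: "('u \<Rightarrow> nat \<Rightarrow> real) \<Rightarrow> 'y1 \<Rightarrow> 'u \<Rightarrow> real" where
  "log_loss \<rho> y u = (\<Sum>z\<in>{0..<m}. backward y z * - log 2 (\<rho> u z))"

lemma log_loss_nonneg:
  assumes \<rho>: "is_channel \<rho> U {0..<m}" "\<And>z. z \<in> {0..<m} \<Longrightarrow> 0 < \<rho> u z" and u: "u \<in> U"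
  shows "0 \<le> log_loss \<rho> y u"
  unfolding log_loss_def
proof (intro sum_nonneg mult_nonneg_nonneg)
  fix z assume z: "z \<in> {0..<m}"
  show "0 \<le> backward y z" using is_channel_nonneg[OF is_channel_backward] z by simp
  have "\<rho> u z \<le> 1"
    using member_le_sum[of z "{0..<m}" "\<rho> u"] z is_channel_sum[OF \<rho>(1) u] is_channel_nonneg[OF \<rho>(1) u] by simp
  then show "0 \<le> - log 2 (\<rho> u z)" using \<rho>(2)[OF z] by simp
qed

lemma sum_memoryless_log_loss:
  assumes \<rho>: "\<And>u z. u \<in> U \<Longrightarrow> z \<in> {0..<m} \<Longrightarrow> 0 < \<rho> u z" and u: "u \<in> seqs l U"
  shows "(\<Sum>z\<in>seqs l {0..<m}. memoryless {0..<l} backward y z * - log 2 (memoryless {0..<l} \<rho> u z))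
    = (\<Sum>t<l. log_loss \<rho> (y t) (u t))"
proof -
  have "- log 2 (memoryless {0..<l} \<rho> u z) = (\<Sum>t\<in>{0..<l}. - log 2 (\<rho> (u t) (z t)))" if z: "z \<in> seqs l {0..<m}" for z
  proof -
    have pos: "0 < \<rho> (u t) (z t)" if "t \<in> {0..<l}" for t using \<rho>[OF PiE_mem[OF u that] PiE_mem[OF z that]] .
    then have "0 < memoryless {0..<l} \<rho> u z" by (rule prod_law_pos)
    then show ?thesis using pos by (subst log_prod_law) (auto simp: sum_negf less_imp_le)
  qed
  then have "(\<Sum>z\<in>seqs l {0..<m}. memoryless {0..<l} backward y z * - log 2 (memoryless {0..<l} \<rho> u z))
      = (\<Sum>z\<in>seqs l {0..<m}. memoryless {0..<l} backward y z * (\<Sum>t\<in>{0..<l}. - log 2 (\<rho> (u t) (z t))))"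
    by (intro sum.cong refl) simp
  also have "\<dots> = (\<Sum>t\<in>{0..<l}. \<Sum>z\<in>{0..<m}. backward (y t) z * - log 2 (\<rho> (u t) z))"
    by (intro sum_prod_law_additive) (auto simp: is_channel_sum[OF is_channel_backward])
  finally show ?thesis by (simp add: log_loss_def lessThan_atLeast0)
qed

lemma equivocation_le_log_loss:
  assumes \<psi>: "\<And>s. \<psi> s \<in> seqs l U" and \<rho>: "is_channel \<rho> U {0..<m}" "\<And>u z. u \<in> U \<Longrightarrow> z \<in> {0..<m} \<Longrightarrow> 0 < \<rho> u z"
  shows "equivocation l \<phi> \<le> mean_distortion l pY UNIV Wr UNIV (log_loss \<rho>) (\<lambda>y t. \<phi> t y) \<psi>"
proof -
  define \<pi> where "\<pi> s = memoryless {0..<l} \<rho> (\<psi> s)" for s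
  have "is_channel (memoryless {0..<l} \<rho>) (seqs l U) (seqs l {0..<m})"
    using \<rho>(1) by (intro is_channel_memoryless) auto
  then have \<pi>: "is_pmf_on (\<pi> s) (seqs l {0..<m})" for s
    unfolding \<pi>_def using \<psi> by (rule is_channel_pmf)
  have \<pi>_pos: "0 < \<pi> s z" if "z \<in> seqs l {0..<m}" for s z
    unfolding \<pi>_def by (intro prod_law_pos \<rho>(2) PiE_mem[OF \<psi>] PiE_mem[OF that])
  have "equivocation l \<phi> \<le> (\<Sum>s\<in>seqs l UNIV. \<Sum>z\<in>seqs l {0..<m}. noise_law l \<phi> (z, s) * - log 2 (\<pi> s z))"
    unfolding equivocation_def
    using \<pi>_pos is_pmf_on_nonneg[OF is_pmf_on_noise_law] is_pmf_on_sum[OF \<pi>]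
    by (intro sum_mono gibbs_inequality) (auto intro: finite_PiE less_imp_le)
  also have "\<dots> = (\<Sum>s\<in>seqs l UNIV. \<Sum>y\<in>seqs l UNIV. iid {0..<l} pY y * relay_channel l \<phi> y s *
      (\<Sum>t<l. log_loss \<rho> (y t) (\<psi> s t)))"
  proof (rule sum.cong[OF refl])
    fix s
    have "(\<Sum>z\<in>seqs l {0..<m}. noise_law l \<phi> (z, s) * - log 2 (\<pi> s z))
        = (\<Sum>y\<in>seqs l UNIV. iid {0..<l} pY y * relay_channel l \<phi> y s *
          (\<Sum>z\<in>seqs l {0..<m}. memoryless {0..<l} backward y z * - log 2 (\<pi> s z)))"
      unfolding sum_output_law[symmetric] by (intro sum.cong refl) (simp add: noise_law_eq_output_law)
    moreover have "(\<Sum>z\<in>seqs l {0..<m}. memoryless {0..<l} backward y z * - log 2 (\<pi> s z))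
        = (\<Sum>t<l. log_loss \<rho> (y t) (\<psi> s t))" for y
      unfolding \<pi>_def using \<rho>(2) \<psi> by (rule sum_memoryless_log_loss)
    ultimately show "(\<Sum>z\<in>seqs l {0..<m}. noise_law l \<phi> (z, s) * - log 2 (\<pi> s z))
        = (\<Sum>y\<in>seqs l UNIV. iid {0..<l} pY y * relay_channel l \<phi> y s * (\<Sum>t<l. log_loss \<rho> (y t) (\<psi> s t)))"
      by (simp only:)
  qed
  also have "\<dots> = (\<Sum>y\<in>seqs l UNIV. \<Sum>s\<in>seqs l UNIV. iid {0..<l} pY y * relay_channel l \<phi> y s *
      (\<Sum>t<l. log_loss \<rho> (y t) (\<psi> s t)))" by (rule sum.swap)
  finally show ?thesis
    by (simp only: mean_distortion_def relay_channel_def sum_distrib_left mult.assoc)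
qed

lemma exists_near_optimal_log_loss:
  assumes Q: "is_channel Q UNIV {0..<k}" and \<epsilon>: "0 < \<epsilon>"
  shows "\<exists>\<rho>. is_channel \<rho> {0..<k} {0..<m} \<and> (\<forall>u\<in>{0..<k}. \<forall>z\<in>{0..<m}. 0 < \<rho> u z) \<and>
    (\<Sum>yu\<in>UNIV \<times> {0..<k}. joint_law pY Q yu * (case yu of (y, u) \<Rightarrow> log_loss \<rho> y u))
      \<le> H_Z_given_U m pz W1 k Q + \<epsilon>"
proof -
  define v where "v u = output_law (\<lambda>y. pY y * Q y u) backward UNIV" for u
  define P where "P u \<rho> \<longleftrightarrow> is_pmf_on \<rho> {0..<m} \<and> (\<forall>z\<in>{0..<m}. 0 < \<rho> z) \<and>
      (\<Sum>z\<in>{0..<m}. v u z * - log 2 (\<rho> z)) \<le> hent (v u) {0..<m} + \<epsilon> * sum (v u) {0..<m}" for u \<rho>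
  have "\<exists>\<rho>. P u \<rho>" if u: "u \<in> {0..<k}" for u
    unfolding P_def
  proof (rule exists_positive_near_optimal_code)
    show "0 \<le> v u z" if "z \<in> {0..<m}" for z
      unfolding v_def using is_pmf_on_nonneg[OF pY] is_channel_nonneg[OF Q] u that
      by (intro output_law_K_nonneg mult_nonneg_nonneg) auto
  qed (use m_ge_2 \<epsilon> in auto)
  then obtain \<rho> where \<rho>: "\<forall>u\<in>{0..<k}. P u (\<rho> u)" by metis
  have "(\<Sum>yu\<in>UNIV \<times> {0..<k}. joint_law pY Q yu * (case yu of (y, u) \<Rightarrow> log_loss \<rho> y u))
      = (\<Sum>y\<in>UNIV. \<Sum>u\<in>{0..<k}. pY y * Q y u * log_loss \<rho> y u)"
    unfolding sum_joint_law by (simp add: sum_distrib_left mult.assoc)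
  also have "\<dots> = (\<Sum>u\<in>{0..<k}. \<Sum>y\<in>UNIV. pY y * Q y u * log_loss \<rho> y u)" by (rule sum.swap)
  also have "\<dots> = (\<Sum>u\<in>{0..<k}. \<Sum>z\<in>{0..<m}. v u z * - log 2 (\<rho> u z))"
    unfolding v_def log_loss_def sum_output_law ..
  also have "\<dots> \<le> (\<Sum>u\<in>{0..<k}. hent (v u) {0..<m} + \<epsilon> * sum (v u) {0..<m})"
    using \<rho> unfolding P_def by (intro sum_mono) auto
  also have "\<dots> = H_Z_given_U m pz W1 k Q + \<epsilon>"
  proof -
    have "(\<Sum>u\<in>{0..<k}. sum (v u) {0..<m}) = 1"
      unfolding v_def mass_output_law[OF is_channel_backward]
      by (subst sum.swap) (simp add: is_channel_sum[OF Q] is_pmf_on_sum[OF pY] flip: sum_distrib_left)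
    then show ?thesis
      unfolding sum.distrib sum_distrib_left[symmetric] by (simp add: H_Z_given_U_eq v_def)
  qed
  finally show ?thesis using \<rho> unfolding P_def is_channel_def by (intro exI[of _ \<rho>]) auto
qed

text \<open>With logarithmic loss as distortion measure, no Markov lemma for \<open>Z\<close> is needed.\<close>
lemma exists_block_relay:
  assumes Q: "is_channel Q UNIV {0..<k}" and less: "I_UY1 m pz W1 k Q < R0 Wr" and \<epsilon>: "0 < \<epsilon>"
  shows "\<exists>l>0. \<exists>\<phi>. equivocation l \<phi> \<le> real l * (H_Z_given_U m pz W1 k Q + \<epsilon>)"
proof -
  obtain \<rho> where \<rho>: "is_channel \<rho> {0..<k} {0..<m}" "\<forall>u\<in>{0..<k}. \<forall>z\<in>{0..<m}. 0 < \<rho> u z"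
    and "(\<Sum>yu\<in>UNIV \<times> {0..<k}. joint_law pY Q yu * (case yu of (y, u) \<Rightarrow> log_loss \<rho> y u))
      \<le> H_Z_given_U m pz W1 k Q + \<epsilon> / 2"
    using exists_near_optimal_log_loss[OF Q half_gt_zero[OF \<epsilon>]] by (elim exE conjE)
  then have mean: "(\<Sum>yu\<in>UNIV \<times> {0..<k}. joint_law pY Q yu * (case yu of (y, u) \<Rightarrow> log_loss \<rho> y u))
      < H_Z_given_U m pz W1 k Q + \<epsilon>" using \<epsilon> by simp
  obtain p where p: "is_pmf_on p UNIV" "mutual_info pY Q UNIV {0..<k} < mutual_info p Wr UNIV UNIV"
    using less_R0E[OF Wr] less unfolding I_UY1_def by metis
  have "\<exists>l>0. \<exists>x \<psi>. (\<forall>y. x y \<in> seqs l UNIV) \<and> (\<forall>s. \<psi> s \<in> seqs l {0..<k}) \<and>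
      mean_distortion l pY UNIV Wr UNIV (log_loss \<rho>) x \<psi> \<le> real l * (H_Z_given_U m pz W1 k Q + \<epsilon>)"
    by (rule source_channel_coding[OF pY Q p(1) Wr p(2) _ mean]) (use \<rho> in \<open>blast intro: log_loss_nonneg\<close>)
  then obtain l x \<psi> where l: "0 < l" and \<psi>: "\<forall>s. \<psi> s \<in> seqs l {0..<k}" and
    loss: "mean_distortion l pY UNIV Wr UNIV (log_loss \<rho>) x \<psi> \<le> real l * (H_Z_given_U m pz W1 k Q + \<epsilon>)"
    by (elim exE conjE)
  have "equivocation l (\<lambda>t y. x y t) \<le> mean_distortion l pY UNIV Wr UNIV (log_loss \<rho>) x \<psi>"
    using \<psi> \<rho> by (intro equivocation_le_log_loss[where U = "{0..<k}"]) auto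
  also note loss
  finally show ?thesis using l by (intro exI[of _ l] conjI exI)
qed

lemma noise_entropy_le_H_Z_given_U:
  assumes Q: "is_channel Q UNIV {0..<k}" and I: "I_UY1 m pz W1 k Q \<le> 0"
  shows "ent pz {0..<m} \<le> H_Z_given_U m pz W1 k Q"
proof -
  have V: "(\<lambda>y. \<Sum>u\<in>{0..<k}. pY y * Q y u) = pY"
    using is_channel_sum[OF Q] by (simp flip: sum_distrib_left)
  have "hent (output_law pY backward UNIV) {0..<m} - H_Z_given_U m pz W1 k Q
      \<le> hent pY UNIV - (\<Sum>u\<in>{0..<k}. hent (\<lambda>y. pY y * Q y u) UNIV)"
    using hent_data_processing[of "{0..<k}" UNIV "{0..<m}" "\<lambda>u y. pY y * Q y u" backward]
      is_pmf_on_nonneg[OF pY] is_channel_nonneg[OF Q] is_channel_backward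
    unfolding V by (simp add: H_Z_given_U_eq)
  also have "\<dots> = I_UY1 m pz W1 k Q"
    by (simp add: I_UY1_def mutual_info_equivocation[OF pY Q] hent_pmf[OF pY])
  finally have "hent (output_law pY backward UNIV) {0..<m} \<le> H_Z_given_U m pz W1 k Q" using I by simp
  moreover have "hent (output_law pY backward UNIV) {0..<m} = ent pz {0..<m}"
    unfolding hent_pmf[OF pz, symmetric] by (intro hent_cong output_law_pY_backward)
  ultimately show ?thesis by simp
qed

lemma exists_strict_test_channel:
  assumes Q: "is_channel Q UNIV {0..<k}" and le: "I_UY1 m pz W1 k Q \<le> R0 Wr" and R0: "0 < R0 Wr" and \<epsilon>: "0 < \<epsilon>"
  shows "\<exists>k' Q'. is_channel Q' UNIV {0..<k'} \<and> I_UY1 m pz W1 k' Q' < R0 Wr \<and>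
    H_Z_given_U m pz W1 k' Q' \<le> H_Z_given_U m pz W1 k Q + \<epsilon>"
proof -
  define H where "H = H_Z_given_U m pz W1 k Q"
  define Hz where "Hz = hent (output_law pY backward UNIV) {0..<m}"
  define c where "c = min (1 / 2) (\<epsilon> / (1 + \<bar>Hz - H\<bar>))"
  have c: "0 < c" "c < 1" using \<epsilon> by (auto simp: c_def)
  have "c * \<bar>Hz - H\<bar> \<le> \<epsilon> / (1 + \<bar>Hz - H\<bar>) * \<bar>Hz - H\<bar>" by (intro mult_right_mono) (auto simp: c_def)
  also have "\<dots> \<le> \<epsilon>" using \<epsilon> by (simp add: field_simps)
  finally have "c * (Hz - H) \<le> \<epsilon>" using c(1) abs_ge_self[of "Hz - H"] by (smt (verit) mult_left_mono)
  then have mix: "(1 - c) * H + c * Hz \<le> H + \<epsilon>" by (simp add: algebra_simps)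
  obtain k' Q' where Q': "is_channel Q' UNIV {0..<k'}"
    "mutual_info pY Q' UNIV {0..<k'} = (1 - c) * mutual_info pY Q UNIV {0..<k}"
    "H_Z_given_U m pz W1 k' Q' \<le> (1 - c) * H + c * Hz"
    using exists_erased_test_channel[OF pY Q, of c] c unfolding H_def Hz_def H_Z_given_U_eq by auto
  have "(1 - c) * I_UY1 m pz W1 k Q < R0 Wr"
  proof (cases "I_UY1 m pz W1 k Q = 0")
    case False
    then have "0 < I_UY1 m pz W1 k Q" using mutual_info_nonneg[OF pY Q] by (simp add: I_UY1_def)
    then have "(1 - c) * I_UY1 m pz W1 k Q < I_UY1 m pz W1 k Q" using c by simp
    then show ?thesis using le by simp
  qed (use R0 in simp)
  then show ?thesis using Q' mix unfolding I_UY1_def H_def by (metis order_trans)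
qed

theorem achievability:
  assumes Q: "is_channel Q UNIV {0..<k}" and le: "I_UY1 m pz W1 k Q \<le> R0 Wr" and \<epsilon>: "0 < \<epsilon>"
  shows "achievable m pz W1 Wr (log 2 (real m) - H_Z_given_U m pz W1 k Q - \<epsilon>)"
proof -
  have "\<exists>l>0. \<exists>\<phi>. equivocation l \<phi> \<le> real l * (H_Z_given_U m pz W1 k Q + \<epsilon> / 2)"
  proof (cases "R0 Wr = 0")
    case True
    then have "equivocation 1 (\<lambda>_ _. undefined) \<le> real 1 * (H_Z_given_U m pz W1 k Q + \<epsilon> / 2)"
      using equivocation_le_noise_entropy[of 1 "\<lambda>_ _. undefined"] noise_entropy_le_H_Z_given_U[OF Q] le \<epsilon> by simp
    then show ?thesis by (intro exI[of _ 1]) auto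
  next
    case False
    then obtain k' Q' where Q': "is_channel Q' UNIV {0..<k'}" "I_UY1 m pz W1 k' Q' < R0 Wr"
      "H_Z_given_U m pz W1 k' Q' \<le> H_Z_given_U m pz W1 k Q + \<epsilon> / 4"
      using exists_strict_test_channel[OF Q le, of "\<epsilon> / 4"] R0_nonneg[OF Wr] \<epsilon> by auto
    obtain l \<phi> where l: "0 < l" "equivocation l \<phi> \<le> real l * (H_Z_given_U m pz W1 k' Q' + \<epsilon> / 4)"
      using exists_block_relay[OF Q'(1,2), of "\<epsilon> / 4"] \<epsilon> by auto
    have "real l * (H_Z_given_U m pz W1 k' Q' + \<epsilon> / 4) \<le> real l * (H_Z_given_U m pz W1 k Q + \<epsilon> / 2)"
      using Q'(3) by (intro mult_left_mono) auto
    then show ?thesis using l by (meson order_trans)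
  qed
  then obtain l \<phi> where l: "0 < l" "equivocation l \<phi> \<le> real l * (H_Z_given_U m pz W1 k Q + \<epsilon> / 2)" by blast
  then have "equivocation l \<phi> < real l * (H_Z_given_U m pz W1 k Q + \<epsilon>)"
    using \<epsilon> by (smt (verit) divide_pos_pos mult_strict_left_mono of_nat_0_less_iff field_sum_of_halves)
  then show ?thesis
    by (intro achievable_below_equivocation[OF l(1)]) (simp add: algebra_simps)
qed

lemma capacity_le:
  assumes "\<And>R. achievable m pz W1 Wr R \<Longrightarrow> R \<le> c"
  shows "capacity m pz W1 Wr \<le> c"
  unfolding capacity_def using assms achievable_nonpos_rate[of 0] by (intro cSup_least) auto

lemma capacity_ge:
  assumes Q: "is_channel Q UNIV {0..<k}" and le: "I_UY1 m pz W1 k Q \<le> R0 Wr"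
    and bdd: "bdd_above {R. achievable m pz W1 Wr R}"
  shows "log 2 (real m) - H_Z_given_U m pz W1 k Q \<le> capacity m pz W1 Wr"
proof (rule field_le_epsilon)
  fix \<epsilon> :: real assume "0 < \<epsilon>"
  then have "log 2 (real m) - H_Z_given_U m pz W1 k Q - \<epsilon> \<le> capacity m pz W1 Wr"
    unfolding capacity_def using achievability[OF Q le] by (intro cSup_upper bdd) auto
  then show "log 2 (real m) - H_Z_given_U m pz W1 k Q \<le> capacity m pz W1 Wr + \<epsilon>" by simp
qed

end

theorem theorem2:
  fixes m :: nat
    and pz :: "nat \<Rightarrow> real"
    and W1 :: "nat \<Rightarrow> 'y1::finite \<Rightarrow> real"
    and Wr :: "'x1::finite \<Rightarrow> 's::finite \<Rightarrow> real"
  assumes "m \<ge> 2"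
    and "is_pmf_on pz {0..<m}"
    and "\<forall>z<m. is_pmf_on (W1 z) UNIV"
    and "\<forall>x1. is_pmf_on (Wr x1) UNIV"
  shows "(\<exists>k \<le> card (UNIV :: 'y1 set) + 2. \<exists>Q :: 'y1 \<Rightarrow> nat \<Rightarrow> real.
            (\<forall>y1. is_pmf_on (Q y1) {0..<k}) \<and> I_UY1 m pz W1 k Q \<le> R0 Wr \<and>
            capacity m pz W1 Wr = log 2 (real m) - H_Z_given_U m pz W1 k Q)
       \<and> (\<forall>k (Q :: 'y1 \<Rightarrow> nat \<Rightarrow> real).
            (\<forall>y1. is_pmf_on (Q y1) {0..<k}) \<and> I_UY1 m pz W1 k Q \<le> R0 Wr \<longrightarrow>
            log 2 (real m) - H_Z_given_U m pz W1 k Q \<le> capacity m pz W1 Wr)"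
proof -
  interpret modsum_relay m pz W1 Wr
    using assms by unfold_locales (auto simp: is_channel_def)
  obtain k Q where k: "k \<le> CARD('y1) + 2" and Q: "is_channel Q UNIV {0..<k}" and le: "I_UY1 m pz W1 k Q \<le> R0 Wr"
    and opt: "\<And>h b. attainable pY h b \<Longrightarrow> ent pY UNIV - R0 Wr \<le> h \<Longrightarrow> H_Z_given_U m pz W1 k Q \<le> b"
    using exists_optimal_test_channel[OF pY R0_nonneg[OF Wr]] unfolding I_UY1_def H_Z_given_U_eq by blast
  have upper: "R \<le> log 2 (real m) - H_Z_given_U m pz W1 k Q" if "achievable m pz W1 Wr R" for R
    using that opt by (rule converse)
  then have bdd: "bdd_above {R. achievable m pz W1 Wr R}" by (intro bdd_aboveI) auto
  have "capacity m pz W1 Wr = log 2 (real m) - H_Z_given_U m pz W1 k Q"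
    using capacity_le[OF upper] capacity_ge[OF Q le bdd] by (rule antisym)
  then show ?thesis using k Q le capacity_ge[OF _ _ bdd] unfolding is_channel_def by blast
qed

end
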